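(* Let $\Phi$ be an irreducible simply-laced crystallographic root system spanning $\mathbb{R}^\ell$ with $\ell\ge 3$, with Coxeter number $\mathrm{h}$, exponents $m_1\le m_2\le\cdots\le m_\ell$, and highest root $\theta$ (with respect to a fixed positive system). Let $\Omega$ be an irreducible component of the root system $\theta^\perp=\{\alpha\in\Phi:(\alpha,\theta)=0\}$. Then the Coxeter number of $\Omega$ is given by $$\mathrm{h}(\Omega)=\begin{cases}2 & \text{if } \mathrm{rank}(\Omega)=1,\\ \mathrm{h}-2m_2+2 & \text{if } \mathrm{rank}(\Omega)\ge 2.\end{cases}$$
   Context: Simply-laced means all roots have the same length. Exponents and Coxeter number are those of the Weyl group of $\Phi$ (resp. of $\Omega$). $(\cdot,\cdot)$ is the standard inner product. *)

theory Defs
  imports "HOL-Analysis.Analysis"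
begin

definition root_reflection :: "'a::euclidean_space \<Rightarrow> 'a \<Rightarrow> 'a" where
  "root_reflection \<alpha> x = x - (2 * (x \<bullet> \<alpha>) / (\<alpha> \<bullet> \<alpha>)) *\<^sub>R \<alpha>"

text \<open>
  Crystallographic reduced root systems. The roots are not required to span the ambient
  space, so that subsystems of a root system are again root systems in the same space.
\<close>

definition root_system :: "'a::euclidean_space set \<Rightarrow> bool" where
  "root_system \<Phi> \<longleftrightarrow>
     finite \<Phi> \<and> 0 \<notin> \<Phi> \<and>
     (\<forall>\<alpha>\<in>\<Phi>. \<Phi> \<inter> range (\<lambda>t::real. t *\<^sub>R \<alpha>) = {\<alpha>, - \<alpha>}) \<and>
     (\<forall>\<alpha>\<in>\<Phi>. root_reflection \<alpha> ` \<Phi> = \<Phi>) \<and>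
     (\<forall>\<alpha>\<in>\<Phi>. \<forall>\<beta>\<in>\<Phi>. 2 * (\<beta> \<bullet> \<alpha>) / (\<alpha> \<bullet> \<alpha>) \<in> \<int>)"

definition irreducible_roots :: "'a::euclidean_space set \<Rightarrow> bool" where
  "irreducible_roots \<Phi> \<longleftrightarrow>
     \<Phi> \<noteq> {} \<and>
     \<not> (\<exists>A B. A \<noteq> {} \<and> B \<noteq> {} \<and> A \<union> B = \<Phi> \<and> A \<inter> B = {} \<and>
            (\<forall>\<alpha>\<in>A. \<forall>\<beta>\<in>B. \<alpha> \<bullet> \<beta> = 0))"

definition irreducible_component :: "'a::euclidean_space set \<Rightarrow> 'a set \<Rightarrow> bool" where
  "irreducible_component \<Psi> \<Omega> \<longleftrightarrow>
     \<Omega> \<subseteq> \<Psi> \<and> irreducible_roots \<Omega> \<and> (\<forall>\<alpha>\<in>\<Omega>. \<forall>\<beta>\<in>\<Psi> - \<Omega>. \<alpha> \<bullet> \<beta> = 0)"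

definition simply_laced :: "'a::euclidean_space set \<Rightarrow> bool" where
  "simply_laced \<Phi> \<longleftrightarrow> (\<forall>\<alpha>\<in>\<Phi>. \<forall>\<beta>\<in>\<Phi>. norm \<alpha> = norm \<beta>)"

definition root_rank :: "'a::euclidean_space set \<Rightarrow> nat" where
  "root_rank \<Phi> = dim (span \<Phi>)"

definition simple_system :: "'a::euclidean_space set \<Rightarrow> 'a set \<Rightarrow> bool" where
  "simple_system \<Phi> \<Delta> \<longleftrightarrow>
     \<Delta> \<subseteq> \<Phi> \<and> independent \<Delta> \<and>
     (\<forall>\<beta>\<in>\<Phi>. \<exists>k::'a \<Rightarrow> int. \<beta> = (\<Sum>\<alpha>\<in>\<Delta>. of_int (k \<alpha>) *\<^sub>R \<alpha>) \<and>
        ((\<forall>\<alpha>\<in>\<Delta>. k \<alpha> \<ge> 0) \<or> (\<forall>\<alpha>\<in>\<Delta>. k \<alpha> \<le> 0)))"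

definition positive_system :: "'a::euclidean_space set \<Rightarrow> 'a set \<Rightarrow> bool" where
  "positive_system \<Phi> P \<longleftrightarrow>
     (\<exists>\<Delta>. simple_system \<Phi> \<Delta> \<and>
          P = {\<beta>\<in>\<Phi>. \<exists>k::'a \<Rightarrow> nat. \<beta> = (\<Sum>\<alpha>\<in>\<Delta>. of_nat (k \<alpha>) *\<^sub>R \<alpha>)})"

text \<open>
  The root order of a positive system: a vector is below another one if the difference is
  a (possibly empty) sum of positive roots, repetitions allowed. The highest root is the
  greatest root in this order.
\<close>

definition root_le :: "'a::euclidean_space set \<Rightarrow> 'a \<Rightarrow> 'a \<Rightarrow> bool" where
  "root_le P x y \<longleftrightarrow> (\<exists>k::'a \<Rightarrow> nat. y - x = (\<Sum>\<gamma>\<in>P. of_nat (k \<gamma>) *\<^sub>R \<gamma>))"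

definition highest_root :: "'a::euclidean_space set \<Rightarrow> 'a set \<Rightarrow> 'a \<Rightarrow> bool" where
  "highest_root \<Phi> P \<theta> \<longleftrightarrow> \<theta> \<in> \<Phi> \<and> (\<forall>\<alpha>\<in>\<Phi>. root_le P \<alpha> \<theta>)"

text \<open>
  A Coxeter element of the Weyl group is a product, in some order, of the reflections in
  the members of some simple system. All Coxeter elements are conjugate in the Weyl group,
  so the choice made in \<open>coxeter_element\<close> affects neither the order nor the eigenvalues.
\<close>

definition is_coxeter_element :: "'a::euclidean_space set \<Rightarrow> ('a \<Rightarrow> 'a) \<Rightarrow> bool" where
  "is_coxeter_element \<Phi> c \<longleftrightarrow>
     (\<exists>\<alpha>s. distinct \<alpha>s \<and> simple_system \<Phi> (set \<alpha>s) \<and>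
           c = foldr (\<lambda>\<alpha> f. root_reflection \<alpha> \<circ> f) \<alpha>s id)"

definition coxeter_element :: "'a::euclidean_space set \<Rightarrow> 'a \<Rightarrow> 'a" where
  "coxeter_element \<Phi> = (SOME c. is_coxeter_element \<Phi> c)"

definition coxeter_number :: "'a::euclidean_space set \<Rightarrow> nat" where
  "coxeter_number \<Phi> = (LEAST n. 0 < n \<and> coxeter_element \<Phi> ^^ n = id)"

text \<open>
  The exponents \<open>m\<^sub>1 \<le> \<dots> \<le> m\<^sub>r\<close> of a root system of rank \<open>r\<close> and Coxeter number \<open>h\<close> are the
  integers in \<open>[0, h)\<close> such that the eigenvalues, with multiplicity, of a Coxeter element on
  the complexified span of the roots are \<open>exp (2 \<pi> i m\<^sub>j / h)\<close>. The Coxeter element fixes the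
  orthogonal complement of the span pointwise, whence the factor with \<open>z - 1\<close> in its
  characteristic polynomial on the whole space; it is trivial when the roots span.
\<close>

definition exponents :: "(real ^ 'n::finite) set \<Rightarrow> nat list" where
  "exponents \<Phi> = (THE ms.
     sorted ms \<and> length ms = root_rank \<Phi> \<and> (\<forall>m\<in>set ms. m < coxeter_number \<Phi>) \<and>
     (\<forall>z::complex.
        det (mat z - map_matrix complex_of_real (matrix (coxeter_element \<Phi>))) =
        (z - 1) ^ (CARD('n) - root_rank \<Phi>) *
        (\<Prod>m\<leftarrow>ms. z - cis (2 * pi * real m / real (coxeter_number \<Phi>)))))"

text \<open>The numbering of the exponents starts at 1.\<close>

definition exponent :: "(real ^ 'n::finite) set \<Rightarrow> nat \<Rightarrow> nat" where
  "exponent \<Phi> j = exponents \<Phi> ! (j - 1)"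

end

(*
  Fix a simple system of \<Phi>. The new ingredient at each step of the classification is the strict
  Cauchy-Schwarz inequality against the highest root of the part of the Dynkin diagram already
  known: a further simple root is attached to exactly one node, and the highest root has coefficient
  1 there. So \<Phi> is of type A, D or E. For a Coxeter element c, written in a simple system with
  Cartan matrix U + U^T (U unitriangular in the order of the reflections), det (z - c) equals
  det (z U + U^T); on a tree this does not depend on the order, and removing leaves gives it
  in closed form. Since c has finite order, its order and the exponents can be read off from this
  polynomial. Finally the simple roots of \<Omega> form a connected component of the simple roots
  orthogonal to \<theta>, which turns A_n into A_(n-2), D_n into D_(n-2) or A_1, and E_6, E_7, E_8 into
  A_5, D_6, E_7.
*)

theory Submission
  imports Defs
begin

text \<open>\<open>coxeter_element\<close> is an arbitrary choice of a simple system and of an order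
  of its members. The choice is harmless because the Gram matrix of the simple roots is all that
  enters: two simple systems differ by an orthogonal map, and a tree determinant sees only products
  \<open>M i j * M j i\<close>. A factorisation of the characteristic polynomial into factors
  \<open>z - unity_root h m\<close>, with \<open>m = 1\<close> among them, then settles Coxeter
  number and exponents together: the eigenvalue for \<open>m = 1\<close> has exact order
  \<open>h\<close>, and an isometry of finite order whose eigenvalues are all \<open>h\<close>-th
  roots of unity satisfies \<open>c^h = 1\<close>.

  The highest root is found without maximising anything. The vector whose coefficients are the
  classical marks has the length of a root and is dominant, which forces it to be \<theta>. Its
  pairings with the simple roots vanish exactly at the nodes that are not joined to the extra node
  of the extended diagram.

  A component \<Omega> does not span the space, so its reflections act on the same
  \<open>real ^ 'n\<close>, with eigenvalue 1 on the complement, and determinants have to be indexed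
  by subsets of a fixed type.\<close>

subsection \<open>Determinants over finite index sets\<close>

text \<open>Deleting nodes of a diagram changes the size of its matrix; indexing by subsets of one
  type avoids a new type for every size.\<close>

definition det_on :: "'b set \<Rightarrow> ('b \<Rightarrow> 'b \<Rightarrow> 'a::comm_ring_1) \<Rightarrow> 'a" where
  "det_on S M = (\<Sum>p | p permutes S. of_int (sign p) * (\<Prod>i\<in>S. M i (p i)))"

lemma det_on_empty [simp]: "det_on {} M = 1"
  by (simp add: det_on_def sign_id)

lemma det_on_cong:
  assumes "\<And>i j. i \<in> S \<Longrightarrow> j \<in> S \<Longrightarrow> M i j = M' i j"
  shows "det_on S M = det_on S M'"
  unfolding det_on_def
  by (intro sum.cong refl arg_cong2[where f="(*)"] prod.cong)
     (auto simp: assms permutes_in_image)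

lemma det_eq_det_on: "det A = det_on UNIV (\<lambda>i j. A $ i $ j)"
  by (simp add: det_def det_on_def)

lemma permutes_fixing_eq:
  assumes "v \<in> S"
  shows "{p. p permutes S \<and> p v = v} = {p. p permutes (S - {v})}"
proof -
  have "p permutes (S - {v})" if "p permutes S" "p v = v" for p
    by (rule permutes_superset[OF that(1)]) (use that in auto)
  moreover have "p permutes S" if "p permutes (S - {v})" for p
    by (rule permutes_subset[OF that]) simp
  moreover have "p v = v" if "p permutes (S - {v})" for p
    using permutes_not_in[OF that, of v] by simp
  ultimately show ?thesis by blast
qed

lemma sum_permutes_fixing:
  assumes "finite S" "v \<in> S"
  shows "(\<Sum>p | p permutes S \<and> p v = v. of_int (sign p) * (\<Prod>i\<in>S. M i (p i)))
       = M v v * det_on (S - {v}) M"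
proof -
  have "(\<Sum>p | p permutes S \<and> p v = v. of_int (sign p) * (\<Prod>i\<in>S. M i (p i)))
     = (\<Sum>p | p permutes (S - {v}). M v v * (of_int (sign p) * (\<Prod>i\<in>S-{v}. M i (p i))))"
    unfolding permutes_fixing_eq[OF assms(2)]
  proof (rule sum.cong[OF refl])
    fix p assume "p \<in> {p. p permutes S - {v}}"
    then have "p v = v" using permutes_not_in[of p "S - {v}" v] by simp
    then show "of_int (sign p) * (\<Prod>i\<in>S. M i (p i)) =
        M v v * (of_int (sign p) * (\<Prod>i\<in>S - {v}. M i (p i)))"
      using assms by (simp add: prod.remove[of S v] mult_ac)
  qed
  then show ?thesis by (simp add: det_on_def sum_distrib_left)
qed

text \<open>A permutation that moves \<open>v\<close> sends some other \<open>u\<close> to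
  \<open>v\<close> and hits a zero of column \<open>v\<close>. Row \<open>v\<close> may be nonzero,
  so triangular matrices can be expanded this way.\<close>

lemma det_on_isolated:
  assumes "finite S" "v \<in> S" "\<And>u. u \<in> S - {v} \<Longrightarrow> M u v = 0"
  shows "det_on S M = M v v * det_on (S - {v}) M"
proof -
  have "det_on S M = (\<Sum>p | p permutes S \<and> p v = v. of_int (sign p) * (\<Prod>i\<in>S. M i (p i)))"
    unfolding det_on_def
  proof (rule sum.mono_neutral_right)
    show "\<forall>p\<in>{p. p permutes S} - {p. p permutes S \<and> p v = v}.
            of_int (sign p) * (\<Prod>i\<in>S. M i (p i)) = 0"
    proof
      fix p assume "p \<in> {p. p permutes S} - {p. p permutes S \<and> p v = v}"
      then have p: "p permutes S" and pv: "p v \<noteq> v" by auto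
      obtain u where u: "u \<in> S" "p u = v"
        using p assms(2) by (metis imageE permutes_image)
      with pv have "u \<noteq> v" by auto
      then have "M u (p u) = 0" using u assms(3) by auto
      then have "(\<Prod>i\<in>S. M i (p i)) = 0"
        using u assms(1) by (intro prod_zero) auto
      then show "of_int (sign p) * (\<Prod>i\<in>S. M i (p i)) = 0" by simp
    qed
  qed (use assms in \<open>auto simp: finite_permutations\<close>)
  then show ?thesis using sum_permutes_fixing[OF assms(1,2), of M] by simp
qed

text \<open>When \<open>v\<close> is adjacent only to \<open>w\<close>, a permutation with nonzero
  term fixes \<open>v\<close> or exchanges \<open>v\<close> and \<open>w\<close>; the two kinds give
  the two terms.\<close>

lemma det_on_leaf:
  assumes fin: "finite S" and vw: "v \<in> S" "w \<in> S" "v \<noteq> w"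
    and zero: "\<And>u. u \<in> S - {v, w} \<Longrightarrow> M v u = 0 \<and> M u v = 0"
  shows "det_on S M = M v v * det_on (S - {v}) M - M v w * M w v * det_on (S - {v, w}) M"
proof -
  let ?f = "\<lambda>p. of_int (sign p) * (\<Prod>i\<in>S. M i (p i))"
  let ?A = "{p. p permutes S \<and> p v = v}" and ?B = "{p. p permutes S \<and> p v = w \<and> p w = v}"
  have finP: "finite {p. p permutes S}" using fin by (rule finite_permutations)
  have "det_on S M = sum ?f (?A \<union> ?B)"
    unfolding det_on_def
  proof (rule sum.mono_neutral_right)
    show "\<forall>p\<in>{p. p permutes S} - (?A \<union> ?B). ?f p = 0"
    proof
      fix p assume "p \<in> {p. p permutes S} - (?A \<union> ?B)"
      then have p: "p permutes S" and no: "p \<notin> ?A \<union> ?B" by blast+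
      obtain u where u: "u \<in> S" "p u = v"
        using p vw by (metis imageE permutes_image)
      have pv: "p v \<in> S" using p vw by (simp add: permutes_in_image)
      have "\<exists>i\<in>S. M i (p i) = 0"
      proof (cases "p v = w")
        case True
        then have "u \<noteq> w" using no p u by auto
        moreover have "u \<noteq> v" using True u vw by auto
        ultimately show ?thesis using u zero by (intro bexI[of _ u]) auto
      next
        case False
        moreover have "p v \<noteq> v" using no p by auto
        ultimately show ?thesis using pv zero vw by (intro bexI[of _ v]) auto
      qed
      then have "(\<Prod>i\<in>S. M i (p i)) = 0" using fin by (intro prod_zero) auto
      then show "of_int (sign p) * (\<Prod>i\<in>S. M i (p i)) = 0" by simp
    qed
  qed (use finP in auto)
  also have "\<dots> = sum ?f ?A + sum ?f ?B"
    by (rule sum.union_disjoint) (use finP vw in \<open>auto intro: rev_finite_subset\<close>)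
  also have "sum ?f ?A = M v v * det_on (S - {v}) M"
    by (rule sum_permutes_fixing[OF fin vw(1)])
  \<comment> \<open>Composing with the transposition of \<open>v\<close> and \<open>w\<close> turns
    the exchanging permutations into those of the remaining nodes; the change of sign is the minus
    in the second term.\<close>
  also have "sum ?f ?B = (\<Sum>p | p permutes (S - {v, w}). ?f (Transposition.transpose v w \<circ> p))"
  proof (rule sum.reindex_bij_witness[of _ "\<lambda>p. Transposition.transpose v w \<circ> p" "\<lambda>p. Transposition.transpose v w \<circ> p"])
    fix p assume p: "p \<in> ?B"
    show "Transposition.transpose v w \<circ> (Transposition.transpose v w \<circ> p) = p" by (simp add: fun_eq_iff)
    have "Transposition.transpose v w \<circ> p permutes S"
      using p vw by (intro permutes_compose permutes_swap_id) auto
    then show "Transposition.transpose v w \<circ> p \<in> {p. p permutes S - {v, w}}"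
      using p by (auto intro!: permutes_superset[of _ S] simp: Transposition.transpose_def)
  next
    fix p assume "p \<in> {p. p permutes S - {v, w}}"
    then have p: "p permutes S - {v, w}" by simp
    have "p v = v" "p w = w" using permutes_not_in[OF p, of v] permutes_not_in[OF p, of w] by simp_all
    moreover have "Transposition.transpose v w \<circ> p permutes S"
      using permutes_subset[OF p, of S] vw by (intro permutes_compose permutes_swap_id) auto
    ultimately show "Transposition.transpose v w \<circ> p \<in> ?B" by simp
    show "Transposition.transpose v w \<circ> (Transposition.transpose v w \<circ> p) = p" by (simp add: fun_eq_iff)
  qed (simp add: o_def)
  also have "\<dots> = (\<Sum>p | p permutes (S - {v, w}).
      - (M v w * M w v) * (of_int (sign p) * (\<Prod>i\<in>S-{v, w}. M i (p i))))"
  proof (rule sum.cong[OF refl])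
    fix p assume "p \<in> {p. p permutes S - {v, w}}"
    then have p: "p permutes S - {v, w}" by simp
    have pvw: "p v = v" "p w = w" using permutes_not_in[OF p, of v] permutes_not_in[OF p, of w] by simp_all
    have "permutation p" using p fin permutation_permutes by blast
    then have sgn: "sign (Transposition.transpose v w \<circ> p) = - sign p"
      using vw by (subst sign_compose) (auto simp: sign_swap_id permutation_swap_id)
    have "(\<Prod>i\<in>S. M i ((Transposition.transpose v w \<circ> p) i))
        = M v w * (M w v * (\<Prod>i\<in>S-{v}-{w}. M i ((Transposition.transpose v w \<circ> p) i)))"
      using fin vw pvw by (simp add: prod.remove[of S v] prod.remove[of "S-{v}" w])
    also have "(\<Prod>i\<in>S-{v}-{w}. M i ((Transposition.transpose v w \<circ> p) i)) = (\<Prod>i\<in>S-{v, w}. M i (p i))"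
    proof (rule prod.cong)
      fix i assume i: "i \<in> S - {v, w}"
      then have "p i \<in> S - {v, w}" using i permutes_in_image[OF p, of i] by blast
      then show "M i ((Transposition.transpose v w \<circ> p) i) = M i (p i)" by (auto simp: Transposition.transpose_def)
    qed auto
    finally show "?f (Transposition.transpose v w \<circ> p) =
      - (M v w * M w v) * (of_int (sign p) * (\<Prod>i\<in>S-{v, w}. M i (p i)))"
      by (simp add: sgn mult_ac)
  qed
  finally show ?thesis by (simp add: det_on_def sum_distrib_left sum_negf)
qed

text \<open>The determinant of \<open>z U + U\<^sup>T\<close> for a path with \<open>n\<close> nodes, where \<open>U + U\<^sup>T\<close> is
  its Cartan matrix.\<close>

fun path_det :: "complex \<Rightarrow> nat \<Rightarrow> complex" where
  "path_det z 0 = 1"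
| "path_det z (Suc 0) = z + 1"
| "path_det z (Suc (Suc n)) = (z + 1) * path_det z (Suc n) - z * path_det z n"

lemma path_det_closed: "(z - 1) * path_det z n = z ^ Suc n - 1"
proof (induction z n rule: path_det.induct)
  case (3 z n)
  have "(z - 1) * path_det z (Suc (Suc n)) = (z + 1) * ((z - 1) * path_det z (Suc n))
          - z * ((z - 1) * path_det z n)"
    by (simp add: algebra_simps)
  then show ?case unfolding 3 by (simp add: algebra_simps)
qed (auto simp: algebra_simps)

section \<open>Determinants along a path\<close>

fun chain :: "('b \<Rightarrow> 'b \<Rightarrow> bool) \<Rightarrow> 'b list \<Rightarrow> bool" where
  "chain A (x # y # ys) \<longleftrightarrow> A x y \<and> (\<forall>u\<in>set ys. \<not> A x u) \<and> chain A (y # ys)"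
| "chain A _ \<longleftrightarrow> True"

text \<open>What a tree determinant sees of \<open>z U + U^T\<close>: the order of the reflections
  decides in which triangle an edge puts \<open>z\<close>, but the product of its two entries is
  \<open>z\<close> in any case.\<close>

definition tree_matrix :: "complex \<Rightarrow> 'b set \<Rightarrow> ('b \<Rightarrow> 'b \<Rightarrow> bool) \<Rightarrow> ('b \<Rightarrow> 'b \<Rightarrow> complex) \<Rightarrow> bool" where
  "tree_matrix z S A M \<longleftrightarrow> (\<forall>i\<in>S. M i i = z + 1) \<and>
     (\<forall>i\<in>S. \<forall>j\<in>S. i \<noteq> j \<longrightarrow> (if A i j then M i j * M j i = z else M i j = 0 \<and> M j i = 0))"

lemma tree_matrix_subset: "tree_matrix z S A M \<Longrightarrow> T \<subseteq> S \<Longrightarrow> tree_matrix z T A M"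
  by (auto simp: tree_matrix_def subset_iff)

text \<open>Leaf expansion at the first node reproduces the recursion of \<open>path_det\<close>.
  The detached set \<open>R\<close> is carried along because deleting a branch node leaves several
  components.\<close>

lemma det_on_chain:
  assumes "chain A xs" "distinct xs" "set xs \<inter> R = {}" "finite R"
    "tree_matrix z (set xs \<union> R) A M" "\<And>x r. x \<in> set xs \<Longrightarrow> r \<in> R \<Longrightarrow> \<not> A x r"
  shows "det_on (set xs \<union> R) M = path_det z (length xs) * det_on R M"
  using assms
proof (induction "length xs" arbitrary: xs rule: less_induct)
  case less
  have chain_tl: "chain A ws" if "chain A (w # ws)" for w ws
    using that by (cases ws) auto
  show ?case
  proof (cases xs rule: remdups_adj.cases)
    case (3 x y ys)
    then have xs: "xs = x # y # ys" by simp
    let ?S = "set (x # y # ys) \<union> R"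
    have T: "tree_matrix z ?S A M" using less xs by blast
    have nA: "\<not> A x u" if "u \<in> ?S - {x, y}" for u using less xs that by auto
    have "det_on ?S M = M x x * det_on (?S - {x}) M - M x y * M y x * det_on (?S - {x, y}) M"
    proof (rule det_on_leaf)
      fix u assume u: "u \<in> ?S - {x, y}"
      then show "M x u = 0 \<and> M u x = 0" using T nA[OF u] by (auto simp: tree_matrix_def)
    qed (use less xs in auto)
    moreover have "?S - {x} = set (y # ys) \<union> R" using less xs by auto
    moreover have "?S - {x, y} = set ys \<union> R" using less xs by auto
    moreover have "M x x = z + 1" "M x y * M y x = z"
      using T less xs by (auto simp: tree_matrix_def)
    moreover have "det_on (set (y # ys) \<union> R) M = path_det z (length (y # ys)) * det_on R M"
      using less xs T by (intro less.hyps) (auto intro: tree_matrix_subset)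
    moreover have "det_on (set ys \<union> R) M = path_det z (length ys) * det_on R M"
      using less xs T chain_tl[of y ys] by (intro less.hyps) (auto intro: tree_matrix_subset)
    ultimately show ?thesis by (simp add: xs algebra_simps)
  next
    case 1
    then show ?thesis by simp
  next
    case (2 v)
    then have xs: "xs = [v]" by simp
    have "det_on (insert v R) M = M v v * det_on (insert v R - {v}) M"
      by (rule det_on_isolated) (use less xs in \<open>auto simp: tree_matrix_def\<close>)
    then show ?thesis using less xs by (auto simp: tree_matrix_def)
  qed
qed

subsection \<open>The characteristic polynomial of a product of reflections\<close>

definition refl_prod :: "'a::euclidean_space list \<Rightarrow> 'a \<Rightarrow> 'a" where
  "refl_prod \<alpha>s = foldr (\<lambda>\<alpha> f. root_reflection \<alpha> \<circ> f) \<alpha>s id"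

lemma refl_prod_simps [simp]:
  "refl_prod [] = id" "refl_prod (\<alpha> # \<alpha>s) = root_reflection \<alpha> \<circ> refl_prod \<alpha>s"
  by (simp_all add: refl_prod_def)

lemma linear_root_reflection: "linear (root_reflection \<alpha>)"
  by (rule linearI) (simp_all add: root_reflection_def inner_add_left distrib_left
      add_divide_distrib scaleR_add_left scaleR_diff_right mult_ac)

lemma linear_refl_prod: "linear (refl_prod \<alpha>s)"
proof (induction \<alpha>s)
  case Nil
  show ?case using linear_id by (simp add: id_def)
next
  case (Cons \<alpha> \<alpha>s)
  show ?case using linear_compose[OF Cons linear_root_reflection[of \<alpha>]] by (simp add: o_def)
qed

text \<open>With \<open>c v = v - \<Sum>\<^sub>j t\<^sub>j(v) \<alpha>\<^sub>j\<close> and \<open>G = U + U\<^sup>T\<close> the Cartan matrix split at the diagonal,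
  \<open>\<Sum>\<^sub>j U\<^sub>i\<^sub>j t\<^sub>j(v) = 2 (v, \<alpha>\<^sub>i) / N\<close>.\<close>

lemma refl_prod_triangular:
  fixes b :: "'i \<Rightarrow> 'a::euclidean_space" and N :: real
  assumes "distinct is" "N > 0" "\<forall>i\<in>set is. b i \<bullet> b i = N"
  defines "a \<equiv> \<lambda>i j. 2 * (b i \<bullet> b j) / N"
  shows "\<exists>(U :: 'i \<Rightarrow> 'i \<Rightarrow> real) t. (\<forall>i. U i i = 1) \<and>
     (\<forall>i\<in>set is. \<forall>j\<in>set is. i \<noteq> j \<longrightarrow> (U i j = a i j \<and> U j i = 0) \<or> (U i j = 0 \<and> U j i = a i j)) \<and>
     det_on (set is) U = 1 \<and> (\<forall>i\<in>set is. linear (t i)) \<and>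
     (\<forall>v. refl_prod (map b is) v = v - (\<Sum>j\<in>set is. t j v *\<^sub>R b j)) \<and>
     (\<forall>v. \<forall>i\<in>set is. 2 * (v \<bullet> b i) / N = (\<Sum>j\<in>set is. U i j * t j v))"
  using assms(1,3)
proof (induction "is")
  case Nil
  show ?case by (intro exI[of _ "\<lambda>i j. if i = j then 1 else 0"]) auto
next
  case (Cons k ks)
  then obtain U t where U1: "\<forall>i. U i i = (1::real)"
    and Ua: "\<forall>i\<in>set ks. \<forall>j\<in>set ks. i \<noteq> j \<longrightarrow>
        (U i j = a i j \<and> U j i = 0) \<or> (U i j = 0 \<and> U j i = a i j)"
    and dU: "det_on (set ks) U = 1" and lt: "\<forall>i\<in>set ks. linear (t i)"
    and c: "\<forall>v. refl_prod (map b ks) v = v - (\<Sum>j\<in>set ks. t j v *\<^sub>R b j)"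
    and Ut: "\<forall>v. \<forall>i\<in>set ks. 2 * (v \<bullet> b i) / N = (\<Sum>j\<in>set ks. U i j * t j v)"
    by auto
  have k: "k \<notin> set ks" using Cons by simp
  \<comment> \<open>The reflection in \<open>b k\<close> is applied last, to \<open>v\<close> minus
    the earlier terms, so its coefficient involves every earlier \<open>t j\<close>: the new row of
    \<open>U\<close> is the Cartan row and the new column vanishes off the diagonal, which keeps the
    determinant 1.\<close>
  define U' where "U' i j = (if i = j then 1 else if i = k then a k j else if j = k then 0 else U i j)"
    for i j
  define t' where "t' = t(k := \<lambda>v. 2 * (refl_prod (map b ks) v \<bullet> b k) / N)"
  have aux: "i \<noteq> k" if "i \<in> set ks" for i using that k by auto
  have t'k: "t' k v = 2 * (v \<bullet> b k) / N - (\<Sum>j\<in>set ks. a k j * t j v)" for v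
  proof -
    have "refl_prod (map b ks) v \<bullet> b k = v \<bullet> b k - (\<Sum>j\<in>set ks. t j v * (b j \<bullet> b k))"
      using c by (simp add: inner_diff_left inner_sum_left)
    moreover have "(\<Sum>j\<in>set ks. a k j * t j v) = (\<Sum>j\<in>set ks. 2 / N * (t j v * (b j \<bullet> b k)))"
      by (rule sum.cong) (simp_all add: a_def inner_commute)
    ultimately show ?thesis
      by (simp add: t'_def sum_distrib_left sum_divide_distrib right_diff_distrib diff_divide_distrib)
  qed
  show ?case
  proof (intro exI[of _ U'] exI[of _ t'] conjI allI ballI)
    show "det_on (set (k # ks)) U' = 1"
    proof -
      have "det_on (set (k # ks)) U' = U' k k * det_on (set (k # ks) - {k}) U'"
        by (rule det_on_isolated) (auto simp: U'_def)
      also have "set (k # ks) - {k} = set ks" using k by auto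
      also have "det_on (set ks) U' = det_on (set ks) U"
        using k U1 by (intro det_on_cong) (auto simp: U'_def)
      finally show ?thesis using dU by (simp add: U'_def[of k k])
    qed
    show "linear (t' i)" if "i \<in> set (k # ks)" for i
    proof (cases "i = k")
      case True
      have "linear (\<lambda>v. 2 * (refl_prod (map b ks) v \<bullet> b k) / N)"
        by (rule linearI) (simp_all add: linear_add[OF linear_refl_prod]
            linear_cmul[OF linear_refl_prod] inner_add_left distrib_left add_divide_distrib)
      then show ?thesis using True by (simp add: t'_def)
    qed (use that lt in \<open>auto simp: t'_def\<close>)
    show "refl_prod (map b (k # ks)) v = v - (\<Sum>j\<in>set (k # ks). t' j v *\<^sub>R b j)" for v
    proof -
      have "(\<Sum>j\<in>set ks. t' j v *\<^sub>R b j) = (\<Sum>j\<in>set ks. t j v *\<^sub>R b j)"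
        by (rule sum.cong) (auto simp: t'_def aux)
      moreover have "b k \<bullet> b k = N" using Cons by simp
      moreover have "t' k v = 2 * (refl_prod (map b ks) v \<bullet> b k) / N" by (simp add: t'_def)
      ultimately have "root_reflection (b k) (refl_prod (map b ks) v)
          = (v - (\<Sum>j\<in>set ks. t' j v *\<^sub>R b j)) - t' k v *\<^sub>R b k"
        using c by (simp add: root_reflection_def)
      then show ?thesis using k by simp
    qed
    show "2 * (v \<bullet> b i) / N = (\<Sum>j\<in>set (k # ks). U' i j * t' j v)" if "i \<in> set (k # ks)" for v i
    proof (cases "i = k")
      case True
      have "(\<Sum>j\<in>set ks. U' k j * t' j v) = (\<Sum>j\<in>set ks. a k j * t j v)"
        using aux by (intro sum.cong) (auto simp: t'_def U'_def)
      then show ?thesis using k True by (simp add: t'k U'_def)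
    next
      case False
      then have i: "i \<in> set ks" using that by auto
      have "(\<Sum>j\<in>set ks. U' i j * t' j v) = (\<Sum>j\<in>set ks. U i j * t j v)"
        using aux[OF i] aux U1 by (intro sum.cong) (auto simp: t'_def U'_def)
      then show ?thesis using k i Ut False by (simp add: U'_def)
    qed
  next
    fix i j assume ij: "i \<in> set (k # ks)" "j \<in> set (k # ks)"
    show "i \<noteq> j \<longrightarrow> (U' i j = a i j \<and> U' j i = 0) \<or> (U' i j = 0 \<and> U' j i = a i j)"
      using ij Ua by (auto simp: U'_def a_def inner_commute)
  qed (simp add: U'_def)
qed

lemma det_on_isolated_set:
  assumes "finite J" "finite I" "I \<inter> J = {}"
    "\<And>v u. v \<in> J \<Longrightarrow> u \<in> I \<union> J \<Longrightarrow> u \<noteq> v \<Longrightarrow> M u v = 0" "\<And>v. v \<in> J \<Longrightarrow> M v v = d"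
  shows "det_on (I \<union> J) M = d ^ card J * det_on I M"
  using assms
proof (induction J rule: finite_induct)
  case (insert v J)
  have "det_on (I \<union> insert v J) M = M v v * det_on (I \<union> insert v J - {v}) M"
    using insert by (intro det_on_isolated) auto
  moreover have "I \<union> insert v J - {v} = I \<union> J" using insert by auto
  moreover have "det_on (I \<union> J) M = d ^ card J * det_on I M"
    by (rule insert.IH) (use insert.prems in auto)
  ultimately show ?case using insert.hyps insert.prems(4)[of v] by (simp add: mult.assoc)
qed simp

section \<open>From reflections to a determinant on the whole space\<close>

lemma orthogonal_basis_completion:
  fixes S :: "'a::euclidean_space set"
  assumes "independent S"
  obtains E where "finite E" "S \<inter> E = {}" "\<And>s e. s \<in> S \<Longrightarrow> e \<in> E \<Longrightarrow> s \<bullet> e = 0"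
    "span (S \<union> E) = UNIV" "card (S \<union> E) = DIM('a)"
proof -
  let ?V = "{y \<in> UNIV. \<forall>x\<in>span S. orthogonal x y}"
  obtain E where E: "E \<subseteq> ?V" "independent E" "?V \<subseteq> span E" "card E = dim ?V"
    using basis_exists by blast
  have finS: "finite S" using assms by (rule independent_imp_finite)
  have finE: "finite E" using E by (simp add: independent_imp_finite)
  have orth: "s \<bullet> e = 0" if "s \<in> S" "e \<in> E" for s e
    using that E(1) by (auto simp: orthogonal_def span_base)
  have disj: "S \<inter> E = {}"
  proof (rule ccontr)
    assume "S \<inter> E \<noteq> {}"
    then obtain x where "x \<in> S" "x \<in> E" by auto
    with orth have "x = 0" by fastforce
    with \<open>x \<in> S\<close> assms show False using dependent_zero by blast
  qed
  have "dim ?V + dim (span S) = dim (UNIV :: 'a set)"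
    by (rule dim_subspace_orthogonal_to_vectors) auto
  then have "card E + card S = DIM('a)"
    using E(4) assms by (simp add: dim_eq_card_independent)
  then have card: "card (S \<union> E) = DIM('a)"
    using disj finS finE by (simp add: card_Un_disjoint)
  have "x \<in> span (S \<union> E)" for x
  proof -
    obtain y z where yz: "y \<in> span S" "\<And>w. w \<in> span S \<Longrightarrow> orthogonal z w" "x = y + z"
      using orthogonal_subspace_decomp_exists[of S x] by metis
    then have "z \<in> span E" using E(3) by (auto simp: orthogonal_commute)
    then show ?thesis using yz
      by (metis (no_types, lifting) Un_upper1 Un_upper2 span_add span_mono subsetD)
  qed
  then have span: "span (S \<union> E) = UNIV" by blast
  show ?thesis
    by (rule that[of E]) (use finE disj orth span card in \<open>simp_all\<close>)
qed

abbreviation cmat :: "real ^ 'n ^ 'm \<Rightarrow> complex ^ 'n ^ 'm" where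
  "cmat \<equiv> map_matrix complex_of_real"

lemma cmat_mult: "cmat (A ** B) = cmat A ** cmat B"
  by (simp add: vec_eq_iff matrix_matrix_mult_def)

lemma det_cmat: "det (cmat A) = of_real (det A)"
  by (simp add: det_def)

lemma matrix_mult_diff_right: "A ** (B - C) = A ** B - A ** (C :: 'a::comm_ring_1 ^ 'n ^ 'm)"
  by (simp add: vec_eq_iff matrix_matrix_mult_def right_diff_distrib sum_subtractf)

lemma matrix_mult_diff_left: "(B - C) ** A = B ** A - (C :: 'a::comm_ring_1 ^ 'n ^ 'm) ** A"
  by (simp add: vec_eq_iff matrix_matrix_mult_def left_diff_distrib sum_subtractf)

lemma mat_mult_commute: "A ** mat z = mat z ** (A :: 'a::comm_semiring_1 ^ 'n ^ 'n)"
proof -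
  have "(\<Sum>k\<in>UNIV. A $ i $ k * (if k = j then z else 0)) = A $ i $ j * z"
    "(\<Sum>k\<in>UNIV. (if i = k then z else 0) * A $ k $ j) = z * A $ i $ j" for i j
    by (simp_all add: if_distrib[where f="\<lambda>x. _ * x"] if_distrib[where f="\<lambda>x. x * _"] cong: if_cong)
  then show ?thesis
    by (simp add: vec_eq_iff matrix_matrix_mult_def mat_def mult.commute)
qed

lemma mat_mult_nth: "(mat z ** (A :: 'a::comm_semiring_1 ^ 'n ^ 'n)) $ i $ j = z * A $ i $ j"
  by (simp add: matrix_matrix_mult_def mat_def if_distrib[where f="\<lambda>x. x * _"] cong: if_cong)

text \<open>On \<open>I\<close>, the rows of \<open>B\<close> are the functionals
  \<open>2 (v, b i) / N\<close> and those of \<open>T\<close> the coefficients \<open>t i\<close>.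
  Then \<open>B = U' ** T\<close> with \<open>det U' = 1\<close>, and \<open>B ** C = X ** T\<close>
  with \<open>X\<close> equal to \<open>- U^T\<close> on \<open>I\<close>, because the Cartan entry
  is \<open>U i j + U j i\<close>. Hence \<open>det (z - C)\<close> is the determinant of
  \<open>z U' - X\<close>. The remaining rows are vectors orthogonal to the roots; the product fixes
  them and they give the powers of \<open>z - 1\<close>.\<close>

theorem refl_prod_charpoly:
  fixes \<alpha>s :: "(real ^ 'n) list"
  assumes dist: "distinct \<alpha>s" and ind: "independent (set \<alpha>s)" and N: "N > 0"
    and norm: "\<forall>\<alpha>\<in>set \<alpha>s. \<alpha> \<bullet> \<alpha> = N"
  obtains b and I :: "'n set" and M where "bij_betw b I (set \<alpha>s)"
    "\<And>z. det (mat z - cmat (matrix (refl_prod \<alpha>s))) =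
        (z - 1) ^ (CARD('n) - length \<alpha>s) * det_on I (M z)"
    "\<And>z i. i \<in> I \<Longrightarrow> M z i i = z + 1"
    "\<And>z i j. i \<in> I \<Longrightarrow> j \<in> I \<Longrightarrow> i \<noteq> j \<Longrightarrow> M z i j * M z j i = z * of_real ((2 * (b i \<bullet> b j) / N)\<^sup>2)"
    "\<And>z i j. i \<in> I \<Longrightarrow> j \<in> I \<Longrightarrow> i \<noteq> j \<Longrightarrow> b i \<bullet> b j = 0 \<Longrightarrow> M z i j = 0"
proof -
  let ?S = "set \<alpha>s" and ?c = "refl_prod \<alpha>s"
  obtain E where E: "finite E" "?S \<inter> E = {}" "\<And>s e. s \<in> ?S \<Longrightarrow> e \<in> E \<Longrightarrow> s \<bullet> e = 0"
    "span (?S \<union> E) = UNIV" "card (?S \<union> E) = DIM(real ^ 'n)"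
    using orthogonal_basis_completion[OF ind] by metis
  have "card (UNIV :: 'n set) = card (?S \<union> E)" using E(5) by simp
  then obtain b where b: "bij_betw b (UNIV :: 'n set) (?S \<union> E)"
    using finite_same_card_bij[of "UNIV :: 'n set" "?S \<union> E"] E(1) by auto
  have inj: "inj b" and ran: "range b = ?S \<union> E" using b by (auto simp: bij_betw_def)
  define I where "I = b -` ?S"
  have bI: "bij_betw b I ?S"
    using inj ran by (auto simp: I_def bij_betw_def inj_on_def)
  have Iiff: "i \<in> I \<longleftrightarrow> b i \<in> ?S" for i by (simp add: I_def)
  have nI: "b i \<in> E" if "i \<notin> I" for i using that ran Iiff by blast
  define "is" where "is = map (inv b) \<alpha>s"
  have map_is: "map b is = \<alpha>s"
    using ran by (simp add: is_def map_idI f_inv_into_f)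
  have dist_is: "distinct is" using dist map_is by (metis distinct_map)
  have set_is: "set is = I"
    using map_is inj by (metis I_def inj_vimage_image_eq list.set_map)
  have norm_is: "\<forall>i\<in>set is. b i \<bullet> b i = N"
    using norm set_is Iiff by blast
  let ?a = "\<lambda>i j. 2 * (b i \<bullet> b j) / N"
  obtain U t where U1: "\<forall>i. U i i = (1::real)"
    and Ua: "\<forall>i\<in>I. \<forall>j\<in>I. i \<noteq> j \<longrightarrow> (U i j = ?a i j \<and> U j i = 0) \<or> (U i j = 0 \<and> U j i = ?a i j)"
    and dU: "det_on I U = 1" and lt: "\<forall>i\<in>I. linear (t i)"
    and c: "\<forall>v. ?c v = v - (\<Sum>j\<in>I. t j v *\<^sub>R b j)"
    and Ut: "\<forall>v. \<forall>i\<in>I. 2 * (v \<bullet> b i) / N = (\<Sum>j\<in>I. U i j * t j v)"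
    using refl_prod_triangular[of "is" N b, OF dist_is N norm_is, unfolded map_is set_is]
    by (elim exE conjE) (rule that)
  define R where "R i = (if i \<in> I then (2 / N) *\<^sub>R b i else b i)" for i
  define B where "B = (\<chi> i j. R i $ j)"
  define T where "T = (\<chi> i j. if i \<in> I then t i (axis j 1) else b i $ j)"
  define U' where "U' = (\<chi> i j. if i \<in> I \<and> j \<in> I then U i j else if i = j then 1 else (0::real))"
  define X where "X = (\<chi> i j. if i \<in> I \<and> j \<in> I then - U j i else if i = j then 1 else (0::real))"
  define C where "C = matrix ?c"
  have split: "(\<Sum>k\<in>UNIV. f k) = (\<Sum>k\<in>I. f k) + (\<Sum>k\<in>-I. f k)" for f :: "'n \<Rightarrow> real"
    by (metis Compl_partition finite sum.union_disjoint inf_compl_bot)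
  have BUT: "B = U' ** T"
  proof -
    have "R i $ j = (\<Sum>k\<in>UNIV. U' $ i $ k * T $ k $ j)" for i j
    proof (cases "i \<in> I")
      case True
      have "(\<Sum>k\<in>-I. U' $ i $ k * T $ k $ j) = 0"
        using True by (intro sum.neutral) (auto simp: U'_def)
      moreover have "(\<Sum>k\<in>I. U' $ i $ k * T $ k $ j) = (\<Sum>k\<in>I. U i k * t k (axis j 1))"
        using True by (intro sum.cong) (auto simp: U'_def T_def)
      moreover have "\<dots> = R i $ j"
        using Ut[rule_format, OF True, of "axis j 1"] True by (simp add: R_def inner_axis')
      ultimately show ?thesis by (simp add: split)
    next
      case False
      have "(\<Sum>k\<in>UNIV. U' $ i $ k * T $ k $ j) = (\<Sum>k\<in>UNIV. if i = k then T $ k $ j else 0)"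
        using False by (intro sum.cong) (auto simp: U'_def)
      then show ?thesis using False by (simp add: R_def T_def)
    qed
    then show ?thesis by (simp add: vec_eq_iff B_def matrix_matrix_mult_def)
  qed
  have BCXT: "B ** C = X ** T"
  proof -
    have "(\<Sum>l\<in>UNIV. R i $ l * C $ l $ j) = (\<Sum>k\<in>UNIV. X $ i $ k * T $ k $ j)" for i j
    proof -
      have "(\<Sum>l\<in>UNIV. R i $ l * C $ l $ j) = R i \<bullet> ?c (axis j 1)"
        by (simp add: C_def matrix_def inner_vec_def)
      also have "\<dots> = R i $ j - (\<Sum>k\<in>I. t k (axis j 1) * (R i \<bullet> b k))"
        using c by (simp add: inner_diff_right inner_sum_right inner_axis)
      finally have lhs: "(\<Sum>l\<in>UNIV. R i $ l * C $ l $ j) = \<dots>" .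
      show ?thesis
      proof (cases "i \<in> I")
        case True
        have "(\<Sum>k\<in>-I. X $ i $ k * T $ k $ j) = 0"
          using True by (intro sum.neutral) (auto simp: X_def)
        moreover have "(\<Sum>k\<in>I. X $ i $ k * T $ k $ j) = (\<Sum>k\<in>I. - U k i * t k (axis j 1))"
          using True by (intro sum.cong) (auto simp: X_def T_def)
        moreover have "R i $ j = (\<Sum>k\<in>I. U i k * t k (axis j 1))"
          using Ut[rule_format, OF True, of "axis j 1"] True by (simp add: R_def inner_axis')
        moreover have "(\<Sum>k\<in>I. t k (axis j 1) * (R i \<bullet> b k)) =
            (\<Sum>k\<in>I. U i k * t k (axis j 1) + U k i * t k (axis j 1))"
        proof (rule sum.cong[OF refl])
          fix k assume k: "k \<in> I"
          have "R i \<bullet> b k = U i k + U k i"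
          proof (cases "i = k")
            case True
            then show ?thesis using k U1 norm N by (simp add: R_def Iiff)
          next
            case False
            have "R i \<bullet> b k = ?a i k" using \<open>i \<in> I\<close> by (simp add: R_def)
            then show ?thesis using Ua \<open>i \<in> I\<close> k False by fastforce
          qed
          then show "t k (axis j 1) * (R i \<bullet> b k) =
              U i k * t k (axis j 1) + U k i * t k (axis j 1)" by (simp add: algebra_simps)
        qed
        ultimately show ?thesis using lhs by (simp add: split[of "\<lambda>k. X $ i $ k * T $ k $ j"] sum.distrib sum_negf)
      next
        case False
        have "R i \<bullet> b k = 0" if "k \<in> I" for k
          using E(3)[of "b k" "b i"] False that nI[OF False] by (simp add: R_def Iiff inner_commute)
        then have "(\<Sum>l\<in>UNIV. R i $ l * C $ l $ j) = R i $ j" using lhs by simp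
        moreover have "(\<Sum>k\<in>UNIV. X $ i $ k * T $ k $ j) = (\<Sum>k\<in>UNIV. if i = k then T $ k $ j else 0)"
          using False by (intro sum.cong) (auto simp: X_def)
        ultimately show ?thesis using False by (simp add: R_def T_def)
      qed
    qed
    then show ?thesis by (simp add: vec_eq_iff B_def matrix_matrix_mult_def)
  qed
  have "det U' = det_on (I \<union> -I) (\<lambda>i j. U' $ i $ j)" by (simp add: det_eq_det_on)
  also have "\<dots> = 1 ^ card (-I) * det_on I (\<lambda>i j. U' $ i $ j)"
    by (rule det_on_isolated_set) (auto simp: U'_def)
  also have "det_on I (\<lambda>i j. U' $ i $ j) = det_on I U"
    by (rule det_on_cong) (simp add: U'_def)
  finally have dU': "det U' = 1" using dU by simp
  \<comment> \<open>The rows of \<open>B\<close> span the space, so \<open>B\<close> is invertible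
    and \<open>det B = det T\<close> cancels.\<close>
  have "x = 0" if "B *v x = 0" for x
  proof -
    have "R i \<bullet> x = 0" for i
    proof -
      have "R i \<bullet> x = (B *v x) $ i"
        by (simp add: B_def matrix_vector_mult_def inner_vec_def)
      then show ?thesis using that by simp
    qed
    then have "b i \<bullet> x = 0" for i using N by (metis (no_types, lifting) R_def divide_eq_0_iff
          inner_scaleR_left less_numeral_extra(3) mult_eq_0_iff zero_neq_numeral)
    then have "orthogonal x y" if "y \<in> ?S \<union> E" for y
      using that ran by (metis imageE inner_commute orthogonal_def)
    then have "orthogonal x x"
      using orthogonal_to_span[of x "?S \<union> E" x] E(4) by auto
    then show ?thesis by (simp add: orthogonal_def)
  qed
  then have "invertible B"
    using matrix_left_invertible_ker[of B] invertible_left_inverse[of B] by blast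
  then have dB: "det B \<noteq> 0" by (simp add: invertible_det_nz)
  have dBT: "det B = det T" using BUT dU' by (simp add: det_mul)
  define M where "M z i j = z * of_real (U i j) + of_real (U j i)" for z :: complex and i j
  have det: "det (mat z - cmat C) = (z - 1) ^ (CARD('n) - length \<alpha>s) * det_on I (M z)" for z
  proof -
    define M' where "M' = mat z ** cmat U' - cmat X"
    have "cmat B ** (mat z - cmat C) = mat z ** cmat B - cmat (B ** C)"
      by (simp add: matrix_mult_diff_right mat_mult_commute cmat_mult)
    also have "\<dots> = M' ** cmat T"
      by (simp add: BCXT) (simp add: BUT M'_def cmat_mult matrix_mul_assoc matrix_mult_diff_left)
    finally have "det (cmat B) * det (mat z - cmat C) = det M' * det (cmat T)"
      by (metis det_mul)
    then have "det (mat z - cmat C) = det M'"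
      using dB dBT by (simp add: det_cmat)
    also have "det M' = det_on (I \<union> -I) (\<lambda>i j. M' $ i $ j)" by (simp add: det_eq_det_on)
    also have "\<dots> = (z - 1) ^ card (-I) * det_on I (\<lambda>i j. M' $ i $ j)"
      by (rule det_on_isolated_set) (auto simp: M'_def U'_def X_def mat_mult_nth)
    also have "det_on I (\<lambda>i j. M' $ i $ j) = det_on I (M z)"
      by (rule det_on_cong) (simp add: M_def M'_def U'_def X_def mat_mult_nth)
    also have "card (-I) = CARD('n) - length \<alpha>s"
      using bij_betw_same_card[OF bI] dist 
      by (simp add: Compl_eq_Diff_UNIV card_Diff_subset distinct_card)
    finally show ?thesis .
  qed
  have M2: "M z i j * M z j i = z * of_real ((2 * (b i \<bullet> b j) / N)\<^sup>2)"
    if "i \<in> I" "j \<in> I" "i \<noteq> j" for z i j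
  proof -
    have "(U i j = ?a i j \<and> U j i = 0) \<or> (U i j = 0 \<and> U j i = ?a i j)" using Ua that by blast
    then show ?thesis by (auto simp: M_def power2_eq_square)
  qed
  have M3: "M z i j = 0" if "i \<in> I" "j \<in> I" "i \<noteq> j" "b i \<bullet> b j = 0" for z i j
  proof -
    have "(U i j = ?a i j \<and> U j i = 0) \<or> (U i j = 0 \<and> U j i = ?a i j)" using Ua that by blast
    then show ?thesis using that(4) by (auto simp: M_def)
  qed
  have M1: "M z i i = z + 1" for z i
    using U1 by (simp add: M_def)
  show ?thesis
    by (rule that[OF bI det[unfolded C_def] M1 M2 M3])
qed

subsection \<open>Labelled diagrams\<close>

lemma chainI:
  assumes "\<And>i j. i < j \<Longrightarrow> j < length xs \<Longrightarrow> A (xs ! i) (xs ! j) \<longleftrightarrow> j = Suc i"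
  shows "chain A xs"
  using assms
proof (induction A xs rule: chain.induct)
  case (1 A x y ys)
  have "chain A (y # ys)"
  proof (rule 1)
    fix i j assume "i < j" "j < length (y # ys)"
    then show "A ((y # ys) ! i) ((y # ys) ! j) \<longleftrightarrow> j = Suc i"
      using "1.prems"[of "Suc i" "Suc j"] by simp
  qed
  moreover have "A x y" using "1.prems"[of 0 1] by simp
  moreover have "\<not> A x u" if u: "u \<in> set ys" for u
  proof -
    from u obtain i where "i < length ys" "u = ys ! i" by (auto simp: in_set_conv_nth)
    then show ?thesis using "1.prems"[of 0 "Suc (Suc i)"] by simp
  qed
  ultimately show ?case by simp
qed auto

text \<open>The diagram with node set \<open>{0, 1, \<dots>}\<close> in which \<open>1, 2, \<dots>\<close> form a path and node \<open>0\<close> is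
  joined to node \<open>k + 1\<close>. With \<open>n\<close> nodes it has type \<open>A\<^sub>n\<close> for \<open>k = 0\<close>, \<open>D\<^sub>n\<close> for \<open>k = 1\<close> and
  \<open>E\<^sub>n\<close> for \<open>k = 2\<close>.\<close>

definition edge :: "nat \<Rightarrow> nat \<Rightarrow> nat \<Rightarrow> bool" where
  "edge k i j \<longleftrightarrow> (i = 0 \<and> j = Suc k) \<or> (j = 0 \<and> i = Suc k) \<or>
     (0 < i \<and> j = Suc i) \<or> (0 < j \<and> i = Suc j)"

definition cartan :: "nat \<Rightarrow> nat \<Rightarrow> nat \<Rightarrow> real" where
  "cartan k i j = (if i = j then 2 else if edge k i j then -1 else 0)"

text \<open>Leaf expansion at node 0: deleting its neighbour as well leaves paths with
  \<open>k\<close> and \<open>n - 2 - k\<close> nodes. For \<open>n = 1\<close> there is no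
  neighbour, hence no second term.\<close>

definition tree_det :: "complex \<Rightarrow> nat \<Rightarrow> nat \<Rightarrow> complex" where
  "tree_det z k n = (z + 1) * path_det z (n - 1) - (if n = 1 then 0 else z * path_det z k * path_det z (n - 2 - k))"

lemma det_on_tree:
  assumes dist: "distinct zs" and T: "tree_matrix z (set zs) A M"
    and A: "\<And>i j. i < length zs \<Longrightarrow> j < length zs \<Longrightarrow> i \<noteq> j \<Longrightarrow> A (zs ! i) (zs ! j) \<longleftrightarrow> edge k i j"
    and n: "length zs = 1 \<or> Suc k < length zs"
  shows "det_on (set zs) M = tree_det z k (length zs)"
proof -
  obtain e xs where zs: "zs = e # xs" using n by (cases zs) auto
  have Axs: "A (xs ! i) (xs ! j) \<longleftrightarrow> j = Suc i \<or> i = Suc j"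
    if "i < length xs" "j < length xs" "i \<noteq> j" for i j
    using A[of "Suc i" "Suc j"] that by (auto simp: zs edge_def)
  have Aex: "A e (xs ! j) \<longleftrightarrow> j = k" "A (xs ! j) e \<longleftrightarrow> j = k" if "j < length xs" for j
    using A[of 0 "Suc j"] A[of "Suc j" 0] that by (auto simp: zs edge_def)
  have ch: "chain A xs" "chain A (take k xs)" "chain A (drop (Suc k) xs)"
    by (rule chainI; simp add: Axs)+
  show ?thesis
  proof (cases "length zs = 1")
    case True
    then have "det_on {e} M = M e e * det_on ({e} - {e}) M"
      by (intro det_on_isolated) auto
    then show ?thesis using True zs T by (auto simp: tree_det_def tree_matrix_def)
  next
    case False
    then have k: "k < length xs" using n zs by auto
    define w where "w = xs ! k"
    have w: "w \<in> set xs" using k by (simp add: w_def)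
    have e: "e \<notin> set xs" using dist zs by simp
    have "det_on (set zs) M = M e e * det_on (set zs - {e}) M
        - M e w * M w e * det_on (set zs - {e, w}) M"
    proof (rule det_on_leaf)
      fix u assume u: "u \<in> set zs - {e, w}"
      then obtain j where "j < length xs" "u = xs ! j" by (auto simp: zs in_set_conv_nth)
      then have "\<not> A e u" using Aex(1)[of j] u by (auto simp: w_def)
      then show "M e u = 0 \<and> M u e = 0" using T u by (auto simp: tree_matrix_def zs)
    qed (use zs w e in auto)
    moreover have "M e e = z + 1" using T zs by (auto simp: tree_matrix_def)
    moreover have "M e w * M w e = z"
    proof -
      have "A e w" "e \<noteq> w" using Aex(1)[OF k] w e by (auto simp: w_def)
      moreover have "e \<in> set zs" "w \<in> set zs" using zs w by auto
      ultimately show ?thesis using T by (simp add: tree_matrix_def)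
    qed
    moreover have "set zs - {e} = set xs \<union> {}" using e zs by auto
    moreover have "det_on (set xs \<union> {}) M = path_det z (length xs) * det_on {} M"
      using ch(1) dist T zs by (intro det_on_chain[where A=A]) (auto intro: tree_matrix_subset)
    moreover have "set zs - {e, w} = set (take k xs) \<union> set (drop (Suc k) xs)"
    proof -
      have xs: "xs = take k xs @ w # drop (Suc k) xs"
        using k by (simp add: w_def id_take_nth_drop[symmetric])
      then have "w \<notin> set (take k xs) \<union> set (drop (Suc k) xs)"
        using dist zs by (metis Un_iff distinct.simps(2) not_distinct_conv_prefix
            disjoint_insert(1) distinct_append list.set(2) )
      moreover have "set xs = set (take k xs) \<union> {w} \<union> set (drop (Suc k) xs)"
        by (subst xs) auto
      ultimately show ?thesis using e zs by auto
    qed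
    moreover have "det_on (set (take k xs) \<union> set (drop (Suc k) xs)) M
        = path_det z k * det_on (set (drop (Suc k) xs)) M"
    proof -
      have sub: "set (take k xs) \<union> set (drop (Suc k) xs) \<subseteq> set zs"
        using zs by (auto dest: in_set_takeD in_set_dropD)
      have "det_on (set (take k xs) \<union> set (drop (Suc k) xs)) M
        = path_det z (length (take k xs)) * det_on (set (drop (Suc k) xs)) M"
      proof (rule det_on_chain[OF ch(2) _ _ _ tree_matrix_subset[OF T sub]])
        show "set (take k xs) \<inter> set (drop (Suc k) xs) = {}"
          using dist zs by (simp add: set_take_disj_set_drop_if_distinct)
        fix x r assume "x \<in> set (take k xs)" "r \<in> set (drop (Suc k) xs)"
        then obtain i j where "i < k" "x = xs ! i" "r = xs ! (Suc k + j)" "Suc k + j < length xs"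
          unfolding in_set_conv_nth by (force simp: less_diff_conv add.commute)
        then show "\<not> A x r" using Axs[of i "Suc k + j"] by auto
      qed (use dist zs in auto)
      then show ?thesis using k by simp
    qed
    moreover have "det_on (set (drop (Suc k) xs) \<union> {}) M
        = path_det z (length xs - Suc k) * det_on {} M"
    proof -
      have sub: "set (drop (Suc k) xs) \<union> {} \<subseteq> set zs"
        using zs by (auto dest: in_set_dropD)
      show ?thesis
        using det_on_chain[OF ch(3) _ _ _ tree_matrix_subset[OF T sub]] dist zs by simp
    qed
    ultimately have "det_on (set zs) M = (z + 1) * path_det z (length xs)
        - z * (path_det z k * path_det z (length xs - Suc k))"
      by (simp only: Un_empty_right det_on_empty mult_1_right)
    then show ?thesis using k by (auto simp: zs tree_det_def)
  qed
qed

text \<open>The condition on the length puts the neighbour of node 0 into the list, which makes the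
  diagram connected. No root system is mentioned, so the notion applies to \<Phi>, to \<Omega> and
  to images under orthogonal maps alike.\<close>

definition dynkin :: "real \<Rightarrow> nat \<Rightarrow> 'a::euclidean_space list \<Rightarrow> bool" where
  "dynkin N k zs \<longleftrightarrow> N > 0 \<and> distinct zs \<and> independent (set zs) \<and>
     (length zs = 1 \<or> Suc k < length zs) \<and>
     (\<forall>i<length zs. \<forall>j<length zs. 2 * (zs ! i \<bullet> zs ! j) = N * cartan k i j)"

text \<open>The order \<open>\<alpha>s\<close> of the reflections is unrelated to the labelling
  \<open>zs\<close>. Along an edge \<open>2 (b i, b j) / N = -1\<close>, so the square in the
  off-diagonal product is 1 and every order yields a \<open>tree_matrix\<close>.\<close>

theorem dynkin_charpoly:
  fixes zs \<alpha>s :: "(real ^ 'n) list"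
  assumes D: "dynkin N k zs" and \<alpha>s: "distinct \<alpha>s" "set \<alpha>s = set zs"
  shows "det (mat z - cmat (matrix (refl_prod \<alpha>s))) =
           (z - 1) ^ (CARD('n) - length zs) * tree_det z k (length zs)"
proof -
  have gram: "2 * (zs ! i \<bullet> zs ! j) = N * cartan k i j" if "i < length zs" "j < length zs" for i j
    using D that by (simp add: dynkin_def)
  have N: "N > 0" and dist: "distinct zs" and ind: "independent (set \<alpha>s)"
    using D \<alpha>s by (auto simp: dynkin_def)
  have norm: "\<forall>\<alpha>\<in>set \<alpha>s. \<alpha> \<bullet> \<alpha> = N"
  proof
    fix \<alpha> assume "\<alpha> \<in> set \<alpha>s"
    then obtain i where "i < length zs" "\<alpha> = zs ! i" using \<alpha>s by (auto simp: in_set_conv_nth)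
    then show "\<alpha> \<bullet> \<alpha> = N" using gram[of i i] by (simp add: cartan_def)
  qed
  obtain b and I :: "'n set" and M where b: "bij_betw b I (set \<alpha>s)"
    and det: "\<And>z. det (mat z - cmat (matrix (refl_prod \<alpha>s))) =
        (z - 1) ^ (CARD('n) - length \<alpha>s) * det_on I (M z)"
    and M: "\<And>z i. i \<in> I \<Longrightarrow> M z i i = z + 1"
    "\<And>z i j. i \<in> I \<Longrightarrow> j \<in> I \<Longrightarrow> i \<noteq> j \<Longrightarrow> M z i j * M z j i = z * of_real ((2 * (b i \<bullet> b j) / N)\<^sup>2)"
    "\<And>z i j. i \<in> I \<Longrightarrow> j \<in> I \<Longrightarrow> i \<noteq> j \<Longrightarrow> b i \<bullet> b j = 0 \<Longrightarrow> M z i j = 0"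
    by (rule refl_prod_charpoly[OF \<alpha>s(1) ind N norm]) (rule that; assumption)
  define ks where "ks = map (inv_into I b) zs"
  have set_ks: "set ks = I"
    using b \<alpha>s(2) inv_into_image_cancel[of b I I] by (auto simp: ks_def bij_betw_def)
  have b_ks: "b (ks ! i) = zs ! i" if "i < length zs" for i
    using that b \<alpha>s(2) by (simp add: ks_def bij_betw_def f_inv_into_f)
  have len: "length ks = length zs" by (simp add: ks_def)
  have dist_ks: "distinct ks"
    using dist b \<alpha>s(2) by (auto simp: ks_def distinct_map bij_betw_def intro: inj_on_inv_into)
  have "det_on (set ks) (M z) = tree_det z k (length ks)"
  proof (rule det_on_tree[OF dist_ks, where A = "\<lambda>i j. b i \<bullet> b j \<noteq> 0"])
    fix i j assume "i < length ks" "j < length ks" "i \<noteq> j"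
    then show "(b (ks ! i) \<bullet> b (ks ! j) \<noteq> 0) = edge k i j"
      using gram[of i j] N by (auto simp: len b_ks cartan_def split: if_splits)
  next
    have "M z i j * M z j i = z"
      if ij: "i \<in> I" "j \<in> I" "i \<noteq> j" "b i \<bullet> b j \<noteq> 0" for i j
    proof -
      obtain k' where k': "k' < length zs" "i = ks ! k'" using ij unfolding set_ks[symmetric] in_set_conv_nth len by blast
      obtain l where l: "l < length zs" "j = ks ! l" using ij unfolding set_ks[symmetric] in_set_conv_nth len by blast
      have "2 * (b i \<bullet> b j) / N = -1"
        using ij gram[of k' l] k' l b_ks N by (auto simp: cartan_def field_simps split: if_splits)
      then show ?thesis using M(2)[of i j z] ij by simp
    qed
    then show "tree_matrix z (set ks) (\<lambda>i j. b i \<bullet> b j \<noteq> 0) (M z)"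
      using M(1,3) by (auto simp: tree_matrix_def set_ks inner_commute)
  qed (use D len in \<open>auto simp: dynkin_def\<close>)
  moreover have "length \<alpha>s = length zs"
    using \<alpha>s dist by (metis distinct_card)
  ultimately show ?thesis using det by (simp add: set_ks len)
qed

subsection \<open>Roots of unity\<close>

definition unity_root :: "nat \<Rightarrow> nat \<Rightarrow> complex" where
  "unity_root h m = cis (2 * pi * real m / real h)"

lemma unity_root_power: "unity_root h m ^ j = unity_root h (m * j)"
  by (simp only: unity_root_def Complex.DeMoivre) (simp add: mult_ac)

lemma unity_root_add: "unity_root h (m + n) = unity_root h m * unity_root h n"
  by (simp add: unity_root_def cis_mult distrib_left add_divide_distrib)

lemma unity_root_eq_1_iff:
  assumes "h > 0"
  shows "unity_root h m = 1 \<longleftrightarrow> h dvd m"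
proof -
  have "unity_root h m = exp (2 * of_real pi * \<i> * of_nat m / of_nat h)"
    by (simp add: unity_root_def cis_conv_exp mult_ac)
  then show ?thesis using complex_root_unity_eq_1[of h m] assms by simp
qed

lemma unity_root_power_eq_1_iff: "h > 0 \<Longrightarrow> unity_root h m ^ j = 1 \<longleftrightarrow> h dvd m * j"
  by (simp add: unity_root_power unity_root_eq_1_iff)

lemma unity_root_nonzero [simp]: "unity_root h m \<noteq> 0"
  by (simp add: unity_root_def)

lemma inj_on_unity_root: "inj_on (unity_root h) {..<h}"
proof (rule linorder_inj_onI')
  fix i j assume ij: "i \<in> {..<h}" "j \<in> {..<h}" "i < j"
  then have "unity_root h j = unity_root h i * unity_root h (j - i)"
    using unity_root_add[of h i "j - i"] by simp
  moreover have "unity_root h (j - i) \<noteq> 1"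
    using ij by (subst unity_root_eq_1_iff) (auto dest: dvd_imp_le)
  ultimately show "unity_root h i \<noteq> unity_root h j" by simp
qed

lemma unity_root_half_power:
  assumes "odd m" "h > 0"
  shows "unity_root (2 * h) m ^ h = -1"
proof -
  have "(unity_root (2 * h) m ^ h)\<^sup>2 = 1"
    using assms by (simp add: power_mult[symmetric] unity_root_power_eq_1_iff)
  moreover have "unity_root (2 * h) m ^ h \<noteq> 1"
    using assms by (simp add: unity_root_power_eq_1_iff)
  ultimately show ?thesis by (metis power2_eq_1_iff)
qed

lemma sum_unity_root_powers:
  assumes "h > 0"
  shows "(\<Sum>j<h. unity_root h (j * m)) = (if h dvd m then of_nat h else 0)"
proof (cases "h dvd m")
  case True
  then have "unity_root h (j * m) = 1" for j using assms by (simp add: unity_root_eq_1_iff)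
  then show ?thesis using True by simp
next
  case False
  have "(\<Sum>j<h. unity_root h (j * m)) = (\<Sum>j<h. unity_root h m ^ j)"
    by (simp add: unity_root_power mult.commute)
  also have "\<dots> = 0"
    using False assms by (subst geometric_sum) (simp_all add: unity_root_eq_1_iff unity_root_power)
  finally show ?thesis using False by simp
qed

subsection \<open>The order of an isometry from its eigenvalues\<close>

definition cplx :: "real ^ 'n \<Rightarrow> real ^ 'n \<Rightarrow> complex ^ 'n" where
  "cplx a b = (\<chi> i. Complex (a $ i) (b $ i))"

lemma cmat_mult_cplx:
  assumes "linear c"
  shows "cmat (matrix c) *v cplx a b = cplx (c a) (c b)"
proof -
  have "c x $ i = (matrix c *v x) $ i" for x i using assms by (simp add: matrix_works)
  then have "c x $ i = (\<Sum>k\<in>UNIV. matrix c $ i $ k * x $ k)" for x i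
    by (simp only: matrix_vector_mult_def vec_lambda_beta)
  then show ?thesis
    by (simp add: vec_eq_iff cplx_def matrix_vector_mult_def complex_eq_iff)
qed

lemma det_zero_imp_kernel:
  fixes A :: "'a::field ^ 'n ^ 'n"
  assumes "det A = 0"
  obtains v where "v \<noteq> 0" "A *v v = 0"
  using assms invertible_det_nz[of A] invertible_left_inverse[of A] matrix_left_invertible_ker[of A]
  by auto

lemma mat_vector_mult: "mat z *v v = (z :: 'a::comm_semiring_1) *s v"
  by (simp add: vec_eq_iff matrix_vector_mult_def mat_def if_distrib[where f="\<lambda>x. x * _"] cong: if_cong)

lemma matrix_vector_mult_sum: "A *v sum f S = (\<Sum>k\<in>S. A *v (f k :: 'a::comm_semiring_1 ^ 'n))"
  by (induction S rule: infinite_finite_induct) (simp_all add: matrix_vector_right_distrib)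

text \<open>Since \<open>c\<^sup>N = 1\<close>, every vector is the average over the \<open>N\<close>-th roots of unity \<open>\<zeta>\<close> of the vectors
  \<open>Y x \<zeta> = \<Sum>\<^sub>k \<zeta>\<^sup>-\<^sup>k c\<^sup>k x\<close>, which are zero or eigenvectors for \<open>\<zeta>\<close>.\<close>

lemma funpow_order_eq:
  fixes c :: "real ^ 'n \<Rightarrow> real ^ 'n"
  assumes lin: "linear c" and N: "N > 0" "c ^^ N = id" and h: "h > 0"
    and eig: "\<And>z. det (mat z - cmat (matrix c)) = 0 \<Longrightarrow> z ^ h = 1"
    and prim: "det (mat (unity_root h 1) - cmat (matrix c)) = 0"
  shows "(LEAST n. 0 < n \<and> c ^^ n = id) = h"
proof (rule Least_equality)
  let ?C = "cmat (matrix c)"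
  have "(c ^^ h) x = x" for x
  proof -
    define Y where "Y x \<zeta> = (\<chi> i. \<Sum>k<N. (1 / \<zeta>) ^ k * complex_of_real ((c ^^ k) x $ i))"
      for x and \<zeta> :: complex
    \<comment> \<open>Both \<open>\<zeta>\<close> and \<open>c\<close> have period \<open>N\<close>,
      so the summand is periodic in \<open>k\<close> and shifting the index does not change the
      sum.\<close>
    have shift: "Y (c x) \<zeta> = \<zeta> *s Y x \<zeta>" if z: "\<zeta> ^ N = 1" "\<zeta> \<noteq> 0" for x \<zeta>
    proof -
      have "(\<Sum>k<N. (1 / \<zeta>) ^ k * complex_of_real ((c ^^ k) (c x) $ i))
          = \<zeta> * (\<Sum>k<N. (1 / \<zeta>) ^ k * complex_of_real ((c ^^ k) x $ i))" for i
      proof -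
        let ?f = "\<lambda>k. (1 / \<zeta>) ^ k * complex_of_real ((c ^^ k) x $ i)"
        have "(\<Sum>k<N. (1 / \<zeta>) ^ k * complex_of_real ((c ^^ k) (c x) $ i)) = (\<Sum>k<N. \<zeta> * ?f (Suc k))"
          using z by (intro sum.cong) (auto simp: funpow_swap1)
        also have "\<dots> = \<zeta> * (\<Sum>k<N. ?f (Suc k))" by (simp add: sum_distrib_left)
        also have "(\<Sum>k<N. ?f (Suc k)) = (\<Sum>k<N. ?f k) + ?f N - ?f 0"
          using sum.lessThan_Suc_shift[of ?f N] sum.lessThan_Suc[of ?f N] by (simp add: algebra_simps)
        also have "\<dots> = (\<Sum>k<N. ?f k)" using N z by (simp add: power_divide)
        finally show ?thesis .
      qed
      then show ?thesis by (simp add: Y_def vec_eq_iff)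
    qed
    have app: "?C *v Y x \<zeta> = Y (c x) \<zeta>" for x \<zeta>
    proof -
      have "Y x \<zeta> = (\<Sum>k<N. (1 / \<zeta>) ^ k *s cplx ((c ^^ k) x) 0)" for x
        by (simp add: Y_def vec_eq_iff cplx_def complex_of_real_def)
      moreover have "c ((c ^^ k) x) = (c ^^ k) (c x)" for k by (simp add: funpow_swap1)
      ultimately show ?thesis
        using linear_0[OF lin]
        by (simp add: matrix_vector_mult_sum vector_scalar_commute cmat_mult_cplx[OF lin])
    qed
    have "Y ((c ^^ h) x) \<zeta> = Y x \<zeta>" if z: "\<zeta> ^ N = 1" "\<zeta> \<noteq> 0" for \<zeta>
    proof -
      have iter: "Y ((c ^^ k) x) \<zeta> = \<zeta> ^ k *s Y x \<zeta>" for k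
        by (induction k) (simp_all add: shift[OF z] vector_smult_assoc)
      show ?thesis
      proof (cases "Y x \<zeta> = 0")
        case False
        have "(mat \<zeta> - ?C) *v Y x \<zeta> = 0"
          by (simp add: matrix_vector_mult_diff_rdistrib mat_vector_mult app shift[OF z])
        then have "\<not> invertible (mat \<zeta> - ?C)"
          using False invertible_left_inverse matrix_left_invertible_ker by blast
        then have "\<zeta> ^ h = 1" using eig invertible_det_nz by blast
        then show ?thesis by (simp add: iter)
      qed (simp add: iter)
    qed
    moreover have "unity_root N j ^ N = 1" for j using N by (simp add: unity_root_power_eq_1_iff)
    ultimately have "(\<Sum>j<N. Y ((c ^^ h) x) (unity_root N j)) = (\<Sum>j<N. Y x (unity_root N j))" by simp
    \<comment> \<open>Summing over all \<open>N\<close>-th roots of unity kills every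
      \<open>k\<close> except 0; hence the vectors \<open>Y x \<zeta>\<close> determine
      \<open>x\<close>.\<close>
    moreover have "(\<Sum>j<N. Y x (unity_root N j)) $ i = of_nat N * complex_of_real (x $ i)" for x i
    proof -
      have "(\<Sum>j<N. Y x (unity_root N j)) $ i
          = (\<Sum>j<N. \<Sum>k<N. (1 / unity_root N j) ^ k * complex_of_real ((c ^^ k) x $ i))"
        by (simp add: Y_def)
      also have "\<dots> = (\<Sum>k<N. (\<Sum>j<N. (1 / unity_root N j) ^ k) * complex_of_real ((c ^^ k) x $ i))"
        by (subst sum.swap) (simp add: sum_distrib_right)
      also have "\<dots> = (\<Sum>k<N. if k = 0 then of_nat N * complex_of_real (x $ i) else 0)"
      proof (rule sum.cong[OF refl])
        fix k assume k: "k \<in> {..<N}"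
        have "(1 / unity_root N j) ^ k = unity_root N (j * (N - k))" for j
        proof -
          have "unity_root N (j * (N - k)) * unity_root N j ^ k = unity_root N (j * N)"
            using k by (simp add: unity_root_power flip: unity_root_add)
              (simp flip: distrib_left)
          also have "\<dots> = 1" using N by (simp add: unity_root_eq_1_iff)
          finally show ?thesis by (simp add: field_simps)
        qed
        moreover have "N dvd N - k \<longleftrightarrow> k = 0"
          using k by (auto dest: dvd_imp_le)
        ultimately show "(\<Sum>j<N. (1 / unity_root N j) ^ k) * complex_of_real ((c ^^ k) x $ i) =
            (if k = 0 then of_nat N * complex_of_real (x $ i) else 0)"
          using sum_unity_root_powers[OF N(1), of "N - k"] by simp
      qed
      finally show ?thesis using N by simp
    qed
    ultimately have "of_nat N * complex_of_real ((c ^^ h) x $ i) = of_nat N * complex_of_real (x $ i)" for i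
      by metis
    then show ?thesis using N by (simp add: vec_eq_iff)
  qed
  then show "0 < h \<and> c ^^ h = id" using h by auto
  fix n assume n: "0 < n \<and> c ^^ n = id"
  obtain v where v: "v \<noteq> 0" "(mat (unity_root h 1) - ?C) *v v = 0"
    using det_zero_imp_kernel[OF prim] by blast
  then have Cv: "?C *v v = unity_root h 1 *s v"
    by (simp add: matrix_vector_mult_diff_rdistrib mat_vector_mult)
  \<comment> \<open>Through real and imaginary parts, \<open>c^n = id\<close> carries over to the
    complex matrix, where the eigenvalue \<open>unity_root h 1\<close> has exact order
    \<open>h\<close>.\<close>
  have "((*v) ?C ^^ k) v = unity_root h 1 ^ k *s v" for k
    by (induction k) (simp_all add: vector_scalar_commute Cv vector_smult_assoc mult.commute)
  moreover have "((*v) ?C ^^ k) (cplx a b) = cplx ((c ^^ k) a) ((c ^^ k) b)" for k a b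
    by (induction k) (simp_all add: cmat_mult_cplx[OF lin])
  moreover have "v = cplx (\<chi> i. Re (v $ i)) (\<chi> i. Im (v $ i))"
    by (simp add: cplx_def vec_eq_iff)
  ultimately have "unity_root h 1 ^ n *s v = v" using n by (metis id_apply)
  then have "unity_root h 1 ^ n = 1"
    using v(1) by (auto simp: vec_eq_iff)
  then show "h \<le> n"
    using h n by (auto simp: unity_root_power_eq_1_iff dest: dvd_imp_le)
qed

subsection \<open>Exponents\<close>

text \<open>The roots of the polynomial, with multiplicity, are the values at the entries of the
  list, and \<open>unity_root h\<close> is injective below \<open>h\<close>. Multiplicity matters:
  type \<open>D_n\<close> with \<open>n\<close> even has a repeated exponent.\<close>

lemma exponent_list_unique:
  assumes "sorted ms" "sorted ms'" "\<forall>m\<in>set ms. m < h" "\<forall>m\<in>set ms'. m < h"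
    "\<And>z. (\<Prod>m\<leftarrow>ms. z - unity_root h m) = (\<Prod>m\<leftarrow>ms'. z - unity_root h m)"
  shows "ms = ms'"
proof -
  define p where "p ms = (\<Prod>m\<leftarrow>ms. [:- unity_root h m, 1:])" for ms
  have "poly (p ms) z = (\<Prod>m\<leftarrow>ms. z - unity_root h m)" for ms z
    unfolding p_def by (induction ms) (simp_all add: algebra_simps)
  then have "p ms = p ms'" using assms(5) by (simp add: poly_eq_poly_eq_iff[symmetric] fun_eq_iff)
  moreover have "p ms \<noteq> 0 \<and> proots (p ms) = image_mset (unity_root h) (mset ms)" for ms
    unfolding p_def
  proof (induction ms)
    case (Cons m ms)
    let ?l = "[:- unity_root h m, 1:]" and ?q = "\<Prod>m\<leftarrow>ms. [:- unity_root h m, 1:]"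
    have nz: "?l * ?q \<noteq> 0" using Cons by (intro no_zero_divisors) simp_all
    have "proots (?l * ?q) = proots ?l + proots ?q"
      using Cons by (intro proots_mult) simp_all
    then show ?case using Cons nz proots_linear_factor[of "- unity_root h m"]
      by (simp only: list.map prod_list.Cons mset.simps) simp
  qed simp
  ultimately have eq: "image_mset (unity_root h) (mset ms) = image_mset (unity_root h) (mset ms')"
    by metis
  have inv: "image_mset (inv_into {..<h} (unity_root h)) (image_mset (unity_root h) (mset ms)) = mset ms"
    if "\<forall>m\<in>set ms. m < h" for ms
  proof -
    have "image_mset (inv_into {..<h} (unity_root h) \<circ> unity_root h) (mset ms) = image_mset (\<lambda>m. m) (mset ms)"
      using that inj_on_unity_root[of h] by (intro image_mset_cong) (simp add: inv_into_f_f)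
    then show ?thesis by (simp add: multiset.map_comp)
  qed
  have "mset ms = mset ms'" using inv[OF assms(3)] inv[OF assms(4)] unfolding eq by (rule trans[OF sym])
  then show ?thesis using assms(1,2) by (metis properties_for_sort sorted_sort_id)
qed

lemma monic_eq_prod_roots:
  fixes p :: "'a::field poly"
  assumes "distinct rs" "degree p = length rs" "lead_coeff p = 1" "\<forall>r\<in>set rs. poly p r = 0"
  shows "poly p z = (\<Prod>r\<leftarrow>rs. z - r)"
  using assms
proof (induction rs arbitrary: p)
  case Nil
  then have "degree p = 0" by simp
  then obtain a where "p = [:a:]" by (rule degree_eq_zeroE)
  then show ?case using Nil by simp
next
  case (Cons r rs)
  from Cons.prems(4) have "[:- r, 1:] dvd p" by (simp add: poly_eq_0_iff_dvd)
  then obtain q where q: "p = [:- r, 1:] * q" by (rule dvdE)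
  have p0: "p \<noteq> 0" using Cons.prems(2) by (metis degree_0 length_Cons nat.distinct(1))
  then have q0: "q \<noteq> 0" "[:- r, 1:] \<noteq> 0" using q by (metis mult_zero_right) simp
  have "lead_coeff p = lead_coeff [:- r, 1:] * lead_coeff q"
    unfolding q by (rule lead_coeff_mult)
  then have "lead_coeff q = 1" using Cons.prems(3) by simp
  moreover have "degree q = length rs"
    using Cons.prems(2) unfolding q by (subst (asm) degree_mult_eq) (use q0 in simp_all)
  moreover have "\<forall>s\<in>set rs. poly q s = 0"
  proof
    fix s assume s: "s \<in> set rs"
    then have "poly p s = 0" "s \<noteq> r" using Cons.prems by auto
    then show "poly q s = 0" by (simp add: q)
  qed
  ultimately have "poly q z = (\<Prod>r\<leftarrow>rs. z - r)" using Cons by simp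
  then show ?case by (simp add: q algebra_simps)
qed

lemma prod_unity_roots:
  assumes "distinct ms" "\<forall>m\<in>set ms. m < h" "degree p = length ms" "lead_coeff p = 1"
    "\<And>m. m \<in> set ms \<Longrightarrow> poly p (unity_root h m) = 0"
  shows "(\<Prod>m\<leftarrow>ms. z - unity_root h m) = poly p z"
proof -
  have "distinct (map (unity_root h) ms)"
    using assms(1,2) inj_on_unity_root[of h] by (auto simp: distinct_map inj_on_def)
  then show ?thesis
    using monic_eq_prod_roots[of "map (unity_root h) ms" p z] assms by (simp add: comp_def)
qed

section \<open>Eigenvalues of Coxeter elements in types A, D and E\<close>

lemma path_det_sum: "path_det z n = (\<Sum>i\<le>n. z ^ i)"
proof (induction z n rule: path_det.induct)
  case (3 z n)
  have "z * (\<Sum>i\<le>Suc n. z ^ i) - z * (\<Sum>i\<le>n. z ^ i) = z ^ Suc (Suc n)"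
    by (simp add: algebra_simps)
  then show ?case unfolding path_det.simps 3 by (simp add: algebra_simps)
qed auto

text \<open>The entry 1 provides a primitive \<open>h\<close>-th root of unity among the
  eigenvalues; without it the order could be a proper divisor of \<open>h\<close>.\<close>

definition coxeter_data :: "nat \<Rightarrow> nat \<Rightarrow> nat \<Rightarrow> nat list \<Rightarrow> bool" where
  "coxeter_data k n h ms \<longleftrightarrow> sorted ms \<and> length ms = n \<and> 1 \<in> set ms \<and> (\<forall>m\<in>set ms. m < h) \<and>
     (\<forall>z. tree_det z k n = (\<Prod>m\<leftarrow>ms. z - unity_root h m))"

lemma tree_det_0: "n \<ge> 1 \<Longrightarrow> tree_det z 0 n = path_det z n"
  by (cases "(z, n)" rule: path_det.cases) (auto simp: tree_det_def)

text \<open>By \<open>path_det_closed\<close> the zeros are the \<open>(n+1)\<close>-th roots of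
  unity other than 1.\<close>

lemma coxeter_data_A:
  assumes "n \<ge> 1"
  shows "coxeter_data 0 n (Suc n) [1..<Suc n]"
proof -
  define p :: "complex poly" where "p = (\<Sum>i\<le>n. monom 1 i)"
  have p: "poly p z = path_det z n" for z
    by (simp add: p_def path_det_sum poly_sum poly_monom)
  have co: "coeff p i = (if i \<le> n then 1 else 0)" for i
    by (simp add: p_def coeff_sum)
  have deg: "degree p = n"
    by (rule antisym) (auto intro!: degree_le le_degree simp: co)
  have "(\<Prod>m\<leftarrow>[1..<Suc n]. z - unity_root (Suc n) m) = poly p z" for z
  proof (rule prod_unity_roots)
    fix m assume m: "m \<in> set [1..<Suc n]"
    then have "unity_root (Suc n) m \<noteq> 1"
      by (subst unity_root_eq_1_iff) (auto dest: dvd_imp_le)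
    moreover have "unity_root (Suc n) m ^ Suc n = 1"
      by (simp only: unity_root_power_eq_1_iff zero_less_Suc dvd_triv_right)
    ultimately show "poly p (unity_root (Suc n) m) = 0"
      using path_det_closed[of "unity_root (Suc n) m" n] by (simp add: p)
  qed (use deg co in auto)
  then show ?thesis using assms by (auto simp: coxeter_data_def tree_det_0 p simp del: upt_Suc)
qed

text \<open>The determinant is \<open>(z + 1) * (z^(n-1) + 1)\<close>. The second factor gives the
  odd exponents, the first one \<open>n - 1\<close>, which is a repetition when \<open>n\<close> is
  even. The case \<open>n = 3\<close> is \<open>A_3\<close> in another labelling; it occurs as a
  component for \<open>D_5\<close>.\<close>

lemma coxeter_data_D:
  assumes "n \<ge> 3"
  shows "coxeter_data 1 n (2 * (n - 1)) (insort (n - 1) (map (\<lambda>i. 2 * i + 1) [0..<n - 1]))"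
proof -
  define m where "m = n - 1"
  have m: "n = Suc m" "m \<ge> 2" using assms by (auto simp: m_def)
  let ?os = "map (\<lambda>i. 2 * i + 1) [0..<m]" and ?h = "2 * m"
  define p :: "complex poly" where "p = monom 1 m + 1"
  have co: "coeff p i = (if i = m then 1 else if i = 0 then 1 else 0)" for i
    using m by (auto simp: p_def)
  have deg: "degree p = m"
    using m by (intro antisym degree_le le_degree) (auto simp: co)
  have odds: "(\<Prod>i\<leftarrow>?os. z - unity_root ?h i) = poly p z" for z
  proof (rule prod_unity_roots)
    fix i assume "i \<in> set ?os"
    then have "odd i" by auto
    then show "poly p (unity_root ?h i) = 0"
      using unity_root_half_power[of i m] m by (simp add: p_def poly_monom)
  qed (use deg co in \<open>auto simp: distinct_map inj_on_def\<close>)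
  have "(unity_root ?h m)\<^sup>2 = 1" "unity_root ?h m \<noteq> 1"
    using m by (auto simp: unity_root_power_eq_1_iff unity_root_eq_1_iff dest: dvd_imp_le)
  then have minus: "unity_root ?h m = -1" by (metis power2_eq_1_iff)
  have tree: "tree_det z 1 n = (z + 1) * (z ^ m + 1)" for z
  proof -
    have "m = Suc (Suc (m - 2))" using m by simp
    then obtain l where l: "m = Suc (Suc l)" by blast
    have "path_det z m - z * path_det z l = z ^ m + 1"
      unfolding path_det_sum l
      by (subst sum.atMost_Suc_shift) (simp add: sum_distrib_left)
    moreover have "tree_det z 1 n = (z + 1) * path_det z m - z * (z + 1) * path_det z l"
      by (simp add: tree_det_def m(1) l)
    moreover have "\<dots> = (z + 1) * (path_det z m - z * path_det z l)" by (simp add: algebra_simps)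
    ultimately show ?thesis by simp
  qed
  have "(\<Prod>i\<leftarrow>insort m ?os. z - unity_root ?h i) = (z - unity_root ?h m) * (\<Prod>i\<leftarrow>?os. z - unity_root ?h i)"
    for z
  proof -
    have "(\<Prod>i\<leftarrow>insort m ?os. z - unity_root ?h i)
        = prod_mset (image_mset (\<lambda>i. z - unity_root ?h i) (mset (insort m ?os)))"
      by (simp only: prod_mset_prod_list[symmetric] mset_map)
    also have "mset (insort m ?os) = add_mset m (mset ?os)" by (rule mset_insort)
    finally show ?thesis
      by (simp only: image_mset_add_mset prod_mset.add_mset prod_mset_prod_list[symmetric] mset_map)
  qed
  then have "tree_det z 1 n = (\<Prod>i\<leftarrow>insort m ?os. z - unity_root ?h i)" for z
    unfolding tree odds minus by (simp add: p_def poly_monom)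
  moreover have "sorted (insort m ?os)"
    by (intro sorted_insort[THEN iffD2]) (simp add: sorted_iff_nth_mono)
  moreover have "1 \<in> set (insort m ?os)" using m by (auto simp: set_insort_key image_iff)
  moreover have "\<forall>i\<in>set (insort m ?os). i < ?h" using m by (auto simp: set_insort_key)
  ultimately show ?thesis using m by (simp add: coxeter_data_def)
qed

text \<open>These are products of cyclotomic polynomials: of orders 3 and 12 for \<open>E_6\<close>,
  of orders 2 and 18 for \<open>E_7\<close>, and of order 30 for \<open>E_8\<close>. The exponents
  below are the numerators of the corresponding primitive roots of unity.\<close>

lemma tree_det_E:
  "tree_det z 2 6 = 1 + z - z ^ 3 + z ^ 5 + z ^ 6"
  "tree_det z 2 7 = 1 + z - z ^ 3 - z ^ 4 + z ^ 6 + z ^ 7"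
  "tree_det z 2 8 = 1 + z - z ^ 3 - z ^ 4 - z ^ 5 + z ^ 7 + z ^ 8"
  by (simp_all add: tree_det_def path_det_sum eval_nat_numeral algebra_simps)

lemma coxeter_data_E6: "coxeter_data 2 6 12 [1, 4, 5, 7, 8, 11]"
proof -
  have "(\<Prod>m\<leftarrow>[1, 4, 5, 7, 8, 11]. z - unity_root 12 m) = poly [:1, 1, 0, -1, 0, 1, 1:] z" for z
  proof (rule prod_unity_roots)
    fix m :: nat assume m: "m \<in> set [1, 4, 5, 7, 8, 11]"
    let ?z = "unity_root 12 m"
    have q: "poly [:1, 1, 0, -1, 0, 1, 1:] ?z = (?z\<^sup>2 + ?z + 1) * (?z ^ 4 - ?z\<^sup>2 + 1)"
      by (simp add: eval_nat_numeral algebra_simps)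
    show "poly [:1, 1, 0, -1, 0, 1, 1:] ?z = 0"
    \<comment> \<open>The odd \<open>m\<close> give primitive 12th roots of unity, the even ones
      primitive cube roots; each kind is annihilated by one factor of \<open>q\<close>.\<close>
    proof (cases "odd m")
      case True
      then have "?z ^ 6 = -1" using unity_root_half_power[of m 6] by simp
      moreover have "(?z\<^sup>2 + 1) * (?z ^ 4 - ?z\<^sup>2 + 1) = ?z ^ 6 + 1"
        by (simp add: eval_nat_numeral algebra_simps)
      moreover have "?z\<^sup>2 \<noteq> -1"
      proof
        assume "?z\<^sup>2 = -1"
        then have "(?z\<^sup>2)\<^sup>2 = 1" by simp
        then have "12 dvd m * 4" by (simp add: unity_root_power_eq_1_iff flip: power_mult)
        then show False using m True by auto
      qed
      ultimately have "?z ^ 4 - ?z\<^sup>2 + 1 = 0" by (auto simp: add_eq_0_iff2)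
      then show ?thesis by (simp only: q mult_zero_right)
    next
      case False
      then have m': "m = 4 \<or> m = 8" using m by auto
      then have "?z ^ 3 = 1" "?z \<noteq> 1"
        by (auto simp: unity_root_power_eq_1_iff unity_root_eq_1_iff)
      moreover have "(?z - 1) * (?z\<^sup>2 + ?z + 1) = ?z ^ 3 - 1"
        by (simp add: eval_nat_numeral algebra_simps)
      ultimately have "?z\<^sup>2 + ?z + 1 = 0" by auto
      then show ?thesis by (simp only: q mult_zero_left)
    qed
  qed auto
  then have "tree_det z 2 6 = (\<Prod>m\<leftarrow>[1, 4, 5, 7, 8, 11]. z - unity_root 12 m)" for z
    by (simp only: tree_det_E) (simp add: eval_nat_numeral algebra_simps)
  then show ?thesis
    unfolding coxeter_data_def by (intro conjI allI) (assumption | simp)+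
qed

lemma coxeter_data_E7: "coxeter_data 2 7 18 [1, 5, 7, 9, 11, 13, 17]"
proof -
  have "(\<Prod>m\<leftarrow>[1, 5, 7, 9, 11, 13, 17]. z - unity_root 18 m) = poly [:1, 1, 0, -1, -1, 0, 1, 1:] z" for z
  proof (rule prod_unity_roots)
    fix m :: nat assume m: "m \<in> set [1, 5, 7, 9, 11, 13, 17]"
    let ?z = "unity_root 18 m"
    have q: "poly [:1, 1, 0, -1, -1, 0, 1, 1:] ?z = (?z + 1) * (?z ^ 6 - ?z ^ 3 + 1)"
      by (simp add: eval_nat_numeral algebra_simps)
    show "poly [:1, 1, 0, -1, -1, 0, 1, 1:] ?z = 0"
    proof (cases "m = 9")
      case True
      then have "?z\<^sup>2 = 1" "?z \<noteq> 1" by (auto simp: unity_root_power_eq_1_iff unity_root_eq_1_iff)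
      then have "?z = -1" by (metis power2_eq_1_iff)
      then show ?thesis by (simp add: q)
    next
      case False
      have "?z ^ 9 = -1" using unity_root_half_power[of m 9] m by auto
      moreover have "(?z ^ 3 + 1) * (?z ^ 6 - ?z ^ 3 + 1) = ?z ^ 9 + 1"
        by (simp add: eval_nat_numeral algebra_simps)
      moreover have "?z ^ 3 \<noteq> -1"
      proof
        assume "?z ^ 3 = -1"
        then have "(?z ^ 3)\<^sup>2 = 1" by simp
        then have "18 dvd m * 6" by (simp add: unity_root_power_eq_1_iff flip: power_mult)
        then show False using m False by auto
      qed
      ultimately have "?z ^ 6 - ?z ^ 3 + 1 = 0" by (auto simp: add_eq_0_iff2)
      then show ?thesis by (simp only: q mult_zero_right)
    qed
  qed auto
  then have "tree_det z 2 7 = (\<Prod>m\<leftarrow>[1, 5, 7, 9, 11, 13, 17]. z - unity_root 18 m)" for z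
    by (simp only: tree_det_E) (simp add: eval_nat_numeral algebra_simps)
  then show ?thesis
    unfolding coxeter_data_def by (intro conjI allI) (assumption | simp)+
qed

lemma coxeter_data_E8: "coxeter_data 2 8 30 [1, 7, 11, 13, 17, 19, 23, 29]"
proof -
  have "(\<Prod>m\<leftarrow>[1, 7, 11, 13, 17, 19, 23, 29]. z - unity_root 30 m) = poly [:1, 1, 0, -1, -1, -1, 0, 1, 1:] z" for z
  proof (rule prod_unity_roots)
    fix m :: nat assume m: "m \<in> set [1, 7, 11, 13, 17, 19, 23, 29]"
    let ?z = "unity_root 30 m"
    have "?z ^ 15 = -1" using unity_root_half_power[of m 15] m by auto
    \<comment> \<open>\<open>z^15 + 1\<close> collects the cyclotomic factors of orders 2, 6, 10 and
      30. Dividing by \<open>z^3 + 1\<close> and \<open>z^5 + 1\<close> removes the first three, but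
      order 2 twice, whence the extra \<open>z + 1\<close>.\<close>
    moreover have "(?z ^ 5 + 1) * (?z ^ 3 + 1) * poly [:1, 1, 0, -1, -1, -1, 0, 1, 1:] ?z
        = (?z ^ 15 + 1) * (?z + 1)"
      by (simp add: eval_nat_numeral algebra_simps)
    moreover have "?z ^ 3 \<noteq> -1"
    proof
      assume "?z ^ 3 = -1"
      then have "(?z ^ 3)\<^sup>2 = 1" by simp
      then have "30 dvd m * 6" by (simp add: unity_root_power_eq_1_iff flip: power_mult)
      then show False using m by auto
    qed
    moreover have "?z ^ 5 \<noteq> -1"
    proof
      assume "?z ^ 5 = -1"
      then have "(?z ^ 5)\<^sup>2 = 1" by simp
      then have "30 dvd m * 10" by (simp add: unity_root_power_eq_1_iff flip: power_mult)
      then show False using m by auto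
    qed
    ultimately show "poly [:1, 1, 0, -1, -1, -1, 0, 1, 1:] ?z = 0" by (auto simp: add_eq_0_iff2)
  qed auto
  then have "tree_det z 2 8 = (\<Prod>m\<leftarrow>[1, 7, 11, 13, 17, 19, 23, 29]. z - unity_root 30 m)" for z
    by (simp only: tree_det_E) (simp add: eval_nat_numeral algebra_simps)
  then show ?thesis
    unfolding coxeter_data_def by (intro conjI allI) (assumption | simp)+
qed

subsection \<open>Simply laced root systems\<close>

definition icomb :: "'a::euclidean_space set \<Rightarrow> ('a \<Rightarrow> int) \<Rightarrow> 'a" where
  "icomb \<Delta> k = (\<Sum>\<alpha>\<in>\<Delta>. of_int (k \<alpha>) *\<^sub>R \<alpha>)"

lemma icomb_cong: "(\<And>\<alpha>. \<alpha> \<in> \<Delta> \<Longrightarrow> k \<alpha> = l \<alpha>) \<Longrightarrow> icomb \<Delta> k = icomb \<Delta> l"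
  by (simp add: icomb_def)

lemma icomb_diff: "icomb \<Delta> k - icomb \<Delta> l = icomb \<Delta> (\<lambda>\<alpha>. k \<alpha> - l \<alpha>)"
  by (simp add: icomb_def sum_subtractf scaleR_left_diff_distrib)

lemma icomb_uminus: "- icomb \<Delta> k = icomb \<Delta> (\<lambda>\<alpha>. - k \<alpha>)"
  by (simp add: icomb_def sum_negf)

lemma icomb_single: "finite \<Delta> \<Longrightarrow> \<alpha> \<in> \<Delta> \<Longrightarrow> icomb \<Delta> (\<lambda>\<beta>. if \<beta> = \<alpha> then j else 0) = of_int j *\<^sub>R \<alpha>"
  by (simp add: icomb_def if_distrib[where f="\<lambda>x. of_int x *\<^sub>R _"] cong: if_cong)

lemma icomb_in_span: "icomb \<Delta> k \<in> span \<Delta>"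
  unfolding icomb_def by (intro span_sum span_scale span_base)

lemma icomb_eq_0D:
  assumes "independent \<Delta>" "icomb \<Delta> k = 0" "\<alpha> \<in> \<Delta>"
  shows "k \<alpha> = 0"
proof -
  have "real_of_int (k \<alpha>) = 0"
    using independentD[OF assms(1) independent_imp_finite[OF assms(1)] order_refl _ assms(3),
        where u = "\<lambda>\<alpha>. real_of_int (k \<alpha>)"] assms(2)
    by (simp add: icomb_def)
  then show ?thesis by simp
qed

lemma icomb_inject:
  assumes "independent \<Delta>" "icomb \<Delta> k = icomb \<Delta> l" "\<alpha> \<in> \<Delta>"
  shows "k \<alpha> = l \<alpha>"
  using icomb_eq_0D[OF assms(1) _ assms(3), of "\<lambda>\<alpha>. k \<alpha> - l \<alpha>"] assms(2)
  by (simp add: icomb_diff[symmetric])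

text \<open>Cross terms occur in pairs, so it is enough that twice each inner product is a multiple
  of \<open>N\<close>.\<close>

lemma icomb_norm:
  assumes "finite F" "\<forall>\<alpha>\<in>F. \<alpha> \<bullet> \<alpha> = N" "\<forall>\<alpha>\<in>F. \<forall>\<beta>\<in>F. \<exists>j::int. 2 * (\<alpha> \<bullet> \<beta>) = of_int j * N"
  shows "\<exists>j::int. icomb F k \<bullet> icomb F k = of_int j * N"
  using assms
proof (induction F rule: finite_induct)
  case (insert x F)
  obtain j where j: "icomb F k \<bullet> icomb F k = of_int j * N" using insert by auto
  have "\<exists>i::int. 2 * (x \<bullet> icomb F k) = of_int i * N"
  proof -
    have "\<forall>\<beta>\<in>F. \<exists>j::int. 2 * (x \<bullet> \<beta>) = of_int j * N" using insert.prems by auto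
    then obtain f where f: "\<forall>\<beta>\<in>F. 2 * (x \<bullet> \<beta>) = of_int (f \<beta>) * N" by metis
    have "2 * (x \<bullet> icomb F k) = (\<Sum>\<beta>\<in>F. of_int (k \<beta>) * (2 * (x \<bullet> \<beta>)))"
      by (simp add: icomb_def inner_sum_right sum_distrib_left mult_ac)
    also have "\<dots> = of_int (\<Sum>\<beta>\<in>F. k \<beta> * f \<beta>) * N"
      using f by (simp add: sum_distrib_left mult_ac)
    finally show ?thesis by blast
  qed
  then obtain i :: int where i: "2 * (x \<bullet> icomb F k) = of_int i * N" by blast
  have "icomb (insert x F) k = of_int (k x) *\<^sub>R x + icomb F k"
    using insert by (simp add: icomb_def)
  then have "icomb (insert x F) k \<bullet> icomb (insert x F) k =
      of_int (k x * k x) * (x \<bullet> x) + of_int (k x) * (2 * (x \<bullet> icomb F k)) + icomb F k \<bullet> icomb F k"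
    by (simp add: inner_add_left inner_add_right inner_commute algebra_simps)
  also have "\<dots> = of_int (k x * k x + k x * i + j) * N"
    unfolding i j using insert.prems by (simp add: algebra_simps)
  finally show ?case by blast
qed (simp add: icomb_def exI[of _ 0])

lemma inner_bound:
  fixes x y :: "'a::real_inner"
  assumes "x \<bullet> x = N" "y \<bullet> y = N"
  shows "x \<bullet> y \<le> N" "x \<bullet> y = N \<Longrightarrow> x = y"
proof -
  have "0 \<le> (x - y) \<bullet> (x - y)" by (rule inner_ge_zero)
  moreover have sq: "(x - y) \<bullet> (x - y) = 2 * N - 2 * (x \<bullet> y)"
    using assms by (simp add: inner_diff_left inner_diff_right inner_commute)
  ultimately show "x \<bullet> y \<le> N" by linarith
  assume "x \<bullet> y = N"
  then have "(x - y) \<bullet> (x - y) = 0" using sq by simp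
  then show "x = y" by simp
qed

text \<open>The common squared length is a parameter because the locale is used for \<Phi> and, with
  the same \<open>N\<close>, for the component \<Omega>.\<close>

locale sl_system =
  fixes \<Phi> :: "'a::euclidean_space set" and N :: real
  assumes fin: "finite \<Phi>" and N: "N > 0"
    and norm: "\<alpha> \<in> \<Phi> \<Longrightarrow> \<alpha> \<bullet> \<alpha> = N"
    and refl: "\<alpha> \<in> \<Phi> \<Longrightarrow> \<beta> \<in> \<Phi> \<Longrightarrow> root_reflection \<alpha> \<beta> \<in> \<Phi>"
    and int: "\<alpha> \<in> \<Phi> \<Longrightarrow> \<beta> \<in> \<Phi> \<Longrightarrow> \<exists>j::int. 2 * (\<alpha> \<bullet> \<beta>) = of_int j * N"
begin

lemma reflection_eq: "\<alpha> \<in> \<Phi> \<Longrightarrow> 2 * (\<alpha> \<bullet> x) = j * N \<Longrightarrow> root_reflection \<alpha> x = x - j *\<^sub>R \<alpha>"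
  using N by (simp add: root_reflection_def norm inner_commute field_simps)

lemma reflection_self: "\<alpha> \<in> \<Phi> \<Longrightarrow> root_reflection \<alpha> \<alpha> = - \<alpha>"
  using reflection_eq[of \<alpha> \<alpha> 2] by (simp add: norm scaleR_2)

lemma uminus_root: "\<alpha> \<in> \<Phi> \<Longrightarrow> - \<alpha> \<in> \<Phi>"
  using refl[of \<alpha> \<alpha>] by (simp add: reflection_self)

lemma reflection_involution: "\<alpha> \<in> \<Phi> \<Longrightarrow> root_reflection \<alpha> (root_reflection \<alpha> x) = x"
  using N by (simp add: root_reflection_def norm inner_diff_left field_simps)

lemma orthogonal_reflection:
  assumes "\<alpha> \<in> \<Phi>"
  shows "orthogonal_transformation (root_reflection \<alpha>)"
  unfolding orthogonal_transformation_def
proof (intro conjI allI)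
  show "linear (root_reflection \<alpha>)" by (rule linear_root_reflection)
  show "root_reflection \<alpha> v \<bullet> root_reflection \<alpha> w = v \<bullet> w" for v w
    using N assms by (simp add: root_reflection_def norm inner_diff_left inner_diff_right
        inner_commute field_simps)
qed

lemma root_ne_0: "\<alpha> \<in> \<Phi> \<Longrightarrow> \<alpha> \<noteq> 0"
  using norm[of \<alpha>] N by auto

section \<open>Simple systems and the lattice they generate\<close>

context
  fixes \<Delta>
  assumes simple: "simple_system \<Phi> \<Delta>"
begin

lemma simple_roots: "\<Delta> \<subseteq> \<Phi>" and simple_independent: "independent \<Delta>"
  using simple by (auto simp: simple_system_def)

lemma simple_finite: "finite \<Delta>"
  using simple_independent by (rule independent_imp_finite)

lemma root_icomb:
  assumes "\<beta> \<in> \<Phi>"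
  obtains k where "\<beta> = icomb \<Delta> k" "(\<forall>\<alpha>\<in>\<Delta>. k \<alpha> \<ge> 0) \<or> (\<forall>\<alpha>\<in>\<Delta>. k \<alpha> \<le> 0)"
  using simple assms by (auto simp: simple_system_def icomb_def)

lemma icomb_root_sign:
  assumes "icomb \<Delta> k \<in> \<Phi>"
  shows "(\<forall>\<alpha>\<in>\<Delta>. k \<alpha> \<ge> 0) \<or> (\<forall>\<alpha>\<in>\<Delta>. k \<alpha> \<le> 0)"
proof -
  obtain l where "icomb \<Delta> k = icomb \<Delta> l" "(\<forall>\<alpha>\<in>\<Delta>. l \<alpha> \<ge> 0) \<or> (\<forall>\<alpha>\<in>\<Delta>. l \<alpha> \<le> 0)"
    using root_icomb[OF assms] by metis
  then show ?thesis using icomb_inject[OF simple_independent] by metis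
qed

text \<open>Reflecting \<beta> in \<alpha> gives a root with coefficients 1 and \<open>- j\<close>,
  so \<open>j \<le> 0\<close>. Cauchy-Schwarz gives \<open>j \<ge> -2\<close>, and
  \<open>j = -2\<close> would make \<alpha> = -\<beta>, against independence.\<close>

lemma simple_inner:
  assumes "\<alpha> \<in> \<Delta>" "\<beta> \<in> \<Delta>" "\<alpha> \<noteq> \<beta>"
  shows "2 * (\<alpha> \<bullet> \<beta>) = 0 \<or> 2 * (\<alpha> \<bullet> \<beta>) = - N"
proof -
  have r: "\<alpha> \<in> \<Phi>" "\<beta> \<in> \<Phi>" using assms simple_roots by auto
  then obtain j :: int where j: "2 * (\<alpha> \<bullet> \<beta>) = of_int j * N" using int by blast
  define k where "k \<gamma> = (if \<gamma> = \<beta> then 1 else 0) - (if \<gamma> = \<alpha> then j else (0::int))" for \<gamma>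
  have "icomb \<Delta> k = \<beta> - of_int j *\<^sub>R \<alpha>"
    unfolding k_def icomb_diff[symmetric] using assms simple_finite by (simp add: icomb_single)
  also have "\<dots> \<in> \<Phi>" using refl[OF r] reflection_eq[OF r(1) j] by simp
  finally have "k \<alpha> \<ge> 0 \<and> k \<beta> \<ge> 0 \<or> k \<alpha> \<le> 0 \<and> k \<beta> \<le> 0"
    using icomb_root_sign assms by blast
  then have "j \<le> 0" using assms by (auto simp: k_def)
  moreover have "j \<ge> -2"
  proof -
    have "\<alpha> \<bullet> - \<beta> \<le> N" using inner_bound(1)[of \<alpha> N "- \<beta>"] r by (simp add: norm)
    then have "of_int (- j) * N \<le> 2 * N" using j by simp
    then have "real_of_int (- j) \<le> 2" using N by (simp only: mult_le_cancel_right_pos)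
    then show ?thesis by linarith
  qed
  moreover have "j \<noteq> -2"
  proof
    assume "j = -2"
    then have "\<alpha> \<bullet> - \<beta> = N" using j by simp
    then have "\<alpha> = - \<beta>" using inner_bound(2)[of \<alpha> N "- \<beta>"] r by (simp add: norm)
    then have "icomb \<Delta> (\<lambda>\<gamma>. if \<gamma> = \<alpha> then 1 else 0) = icomb \<Delta> (\<lambda>\<gamma>. if \<gamma> = \<beta> then -1 else 0)"
      using assms simple_finite by (simp add: icomb_single)
    from icomb_inject[OF simple_independent this assms(1)] assms show False by simp
  qed
  ultimately have "j = 0 \<or> j = -1" by auto
  then show ?thesis using j by auto
qed

lemma icomb_simple_norm: "\<exists>j::int. icomb \<Delta> k \<bullet> icomb \<Delta> k = of_int j * N"
  using simple_roots by (intro icomb_norm simple_finite) (auto simp: norm intro: int)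

text \<open>The squared norm is a positive integral multiple of \<open>N\<close>. Thus no nonzero
  lattice vector is shorter than a root, and a root is not a sum of two nonzero orthogonal lattice
  vectors.\<close>

lemma icomb_subset_norm:
  assumes "F \<subseteq> \<Delta>" "icomb F k \<noteq> 0"
  shows "icomb F k \<bullet> icomb F k \<ge> N"
proof -
  have "finite F" using assms simple_finite finite_subset by blast
  then obtain j :: int where j: "icomb F k \<bullet> icomb F k = of_int j * N"
    using icomb_norm[of F N k] assms simple_roots int norm by (meson subsetD)
  moreover have "icomb F k \<bullet> icomb F k > 0" using assms(2) by simp
  ultimately have "j \<ge> 1" using N by (simp add: zero_less_mult_iff)
  then show ?thesis using j N by simp
qed

text \<open>Descent on the sum of coefficients. From \<open>v \<bullet> v > 0\<close>, some simple
  \<alpha> with positive coefficient has positive inner product with \<open>v\<close>. Unless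
  \<open>v\<close> is \<alpha>, the vector \<open>v - \<alpha>\<close> again has squared norm
  \<open>N\<close>, and \<open>v\<close> is its reflection in \<alpha>.\<close>

lemma nonneg_icomb_root:
  assumes "\<forall>\<alpha>\<in>\<Delta>. k \<alpha> \<ge> 0" "icomb \<Delta> k \<bullet> icomb \<Delta> k = N"
  shows "icomb \<Delta> k \<in> \<Phi>"
  using assms
proof (induction "nat (\<Sum>\<alpha>\<in>\<Delta>. k \<alpha>)" arbitrary: k rule: less_induct)
  case less
  let ?v = "icomb \<Delta> k"
  have "?v \<bullet> ?v = (\<Sum>\<alpha>\<in>\<Delta>. of_int (k \<alpha>) * (\<alpha> \<bullet> ?v))"
    by (subst (1) icomb_def) (simp add: inner_sum_left)
  then have "(\<Sum>\<alpha>\<in>\<Delta>. of_int (k \<alpha>) * (\<alpha> \<bullet> ?v)) > 0" using less.prems N by simp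
  then obtain \<alpha> where \<alpha>: "\<alpha> \<in> \<Delta>" "of_int (k \<alpha>) * (\<alpha> \<bullet> ?v) > 0"
    by (meson not_le sum_nonpos)
  then have k1: "k \<alpha> \<ge> 1" and pos: "\<alpha> \<bullet> ?v > 0"
    using less.prems(1) by (force simp: zero_less_mult_iff)+
  have r: "\<alpha> \<in> \<Phi>" using \<alpha> simple_roots by auto
  define l where "l \<gamma> = k \<gamma> - (if \<gamma> = \<alpha> then 1 else 0)" for \<gamma>
  have l: "icomb \<Delta> l = ?v - \<alpha>"
    unfolding l_def icomb_diff[symmetric] using \<alpha> simple_finite by (simp add: icomb_single)
  have ul: "(?v - \<alpha>) \<bullet> (?v - \<alpha>) = 2 * N - 2 * (\<alpha> \<bullet> ?v)"
    using less.prems norm[OF r] by (simp add: inner_diff_left inner_diff_right inner_commute)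
  show ?case
  proof (cases "?v = \<alpha>")
    case True
    then show ?thesis using r by simp
  next
    case False
    then have "icomb \<Delta> l \<noteq> 0" using l by simp
    then have ge: "2 * N - 2 * (\<alpha> \<bullet> ?v) \<ge> N" using icomb_subset_norm[of \<Delta> l] l ul by simp
    obtain j :: int where j: "icomb \<Delta> l \<bullet> icomb \<Delta> l = of_int j * N" using icomb_simple_norm by blast
    have "of_int j * N = 2 * N - 2 * (\<alpha> \<bullet> ?v)" using j l ul by simp
    then have "of_int j * N < 2 * N" "of_int j * N \<ge> 1 * N" using pos ge by linarith+
    then have "real_of_int j < 2" "real_of_int j \<ge> 1"
      using N by (simp_all only: mult_less_cancel_right_pos mult_le_cancel_right_pos)
    then have "j = 1" by linarith
    then have nl: "icomb \<Delta> l \<bullet> icomb \<Delta> l = N" using j by simp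
    have "(\<Sum>\<gamma>\<in>\<Delta>. l \<gamma>) = (\<Sum>\<gamma>\<in>\<Delta>. k \<gamma>) - 1"
      using \<alpha> simple_finite by (simp add: l_def sum_subtractf)
    moreover have "(\<Sum>\<gamma>\<in>\<Delta>. k \<gamma>) \<ge> k \<alpha>"
      using less.prems(1) \<alpha> simple_finite by (intro member_le_sum) auto
    ultimately have "nat (\<Sum>\<gamma>\<in>\<Delta>. l \<gamma>) < nat (\<Sum>\<gamma>\<in>\<Delta>. k \<gamma>)" using k1 by simp
    moreover have "\<forall>\<gamma>\<in>\<Delta>. l \<gamma> \<ge> 0" using less.prems k1 by (simp add: l_def)
    ultimately have u: "?v - \<alpha> \<in> \<Phi>" using less.hyps nl l by metis
    have "2 * (\<alpha> \<bullet> (?v - \<alpha>)) = -1 * N"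
      using nl l ul norm[OF r] by (simp add: inner_diff_right)
    then have "root_reflection \<alpha> (?v - \<alpha>) = ?v"
      using reflection_eq[OF r, of "?v - \<alpha>" "-1"] by simp
    then show ?thesis using refl[OF r u] by simp
  qed
qed

text \<open>The positive and negative parts have nonpositive inner product, so squared norm
  \<open>N\<close> leaves room for only one of them. This is how an explicitly given vector is
  recognised as a root.\<close>

lemma icomb_root:
  assumes "icomb \<Delta> k \<bullet> icomb \<Delta> k = N"
  shows "icomb \<Delta> k \<in> \<Phi>"
proof -
  define p n where "p = icomb \<Delta> (\<lambda>\<alpha>. max 0 (k \<alpha>))" and "n = icomb \<Delta> (\<lambda>\<alpha>. max 0 (- k \<alpha>))"
  have pn: "icomb \<Delta> k = p - n"
    unfolding p_def n_def icomb_diff by (rule icomb_cong) auto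
  have "p \<bullet> n = (\<Sum>\<beta>\<in>\<Delta>. \<Sum>\<alpha>\<in>\<Delta>. of_int (max 0 (- k \<beta>)) * (of_int (max 0 (k \<alpha>)) * (\<alpha> \<bullet> \<beta>)))"
    by (simp add: p_def n_def icomb_def inner_sum_left inner_sum_right)
      (simp add: sum_distrib_left)
  also have "\<dots> \<le> 0"
  proof (intro sum_nonpos)
    fix \<beta> \<alpha> assume ab: "\<beta> \<in> \<Delta>" "\<alpha> \<in> \<Delta>"
    show "of_int (max 0 (- k \<beta>)) * (of_int (max 0 (k \<alpha>)) * (\<alpha> \<bullet> \<beta>)) \<le> 0"
    proof (cases "\<alpha> = \<beta>")
      case False
      then have "\<alpha> \<bullet> \<beta> \<le> 0" using simple_inner[OF ab(2,1)] N by auto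
      then show ?thesis by (intro mult_nonneg_nonpos) auto
    qed (cases "k \<alpha> \<ge> 0", auto)
  qed
  finally have le: "p \<bullet> n \<le> 0" .
  have "(p - n) \<bullet> (p - n) = p \<bullet> p + n \<bullet> n - 2 * (p \<bullet> n)"
    by (simp add: inner_diff_left inner_diff_right inner_commute)
  then have "p \<bullet> p + n \<bullet> n \<le> N" using assms pn le by simp
  moreover have "p \<bullet> p \<ge> N" if "p \<noteq> 0" using icomb_subset_norm[of \<Delta>] that by (simp add: p_def)
  moreover have "n \<bullet> n \<ge> N" if "n \<noteq> 0" using icomb_subset_norm[of \<Delta>] that by (simp add: n_def)
  ultimately have "p = 0 \<or> n = 0" using N by fastforce
  then show ?thesis
  proof
    assume "n = 0"
    then have "max 0 (- k \<alpha>) = 0" if "\<alpha> \<in> \<Delta>" for \<alpha>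
      using icomb_eq_0D[OF simple_independent _ that] by (simp add: n_def)
    then have "\<forall>\<alpha>\<in>\<Delta>. k \<alpha> \<ge> 0" by (force simp: max_def split: if_splits)
    then show ?thesis using nonneg_icomb_root assms by blast
  next
    assume "p = 0"
    then have "max 0 (k \<alpha>) = 0" if "\<alpha> \<in> \<Delta>" for \<alpha>
      using icomb_eq_0D[OF simple_independent _ that] by (simp add: p_def)
    then have "\<forall>\<alpha>\<in>\<Delta>. - k \<alpha> \<ge> 0" by (force simp: max_def split: if_splits)
    moreover have "icomb \<Delta> (\<lambda>\<alpha>. - k \<alpha>) \<bullet> icomb \<Delta> (\<lambda>\<alpha>. - k \<alpha>) = N"
      using assms by (simp add: icomb_uminus[symmetric])
    ultimately have "icomb \<Delta> (\<lambda>\<alpha>. - k \<alpha>) \<in> \<Phi>" by (rule nonneg_icomb_root)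
    then show ?thesis using uminus_root by (force simp: icomb_uminus[symmetric])
  qed
qed

text \<open>If the simple roots split orthogonally, so does each root, and one of its two parts must
  vanish for reasons of length; hence \<Phi> itself would split.\<close>

lemma simple_connected:
  assumes irr: "irreducible_roots \<Phi>" and AB: "A \<union> B = \<Delta>" "A \<inter> B = {}"
    and orth: "\<And>\<alpha> \<beta>. \<alpha> \<in> A \<Longrightarrow> \<beta> \<in> B \<Longrightarrow> \<alpha> \<bullet> \<beta> = 0"
  shows "A = {} \<or> B = {}"
proof (rule ccontr)
  assume "\<not> (A = {} \<or> B = {})"
  then have ne: "A \<noteq> {}" "B \<noteq> {}" by auto
  have finAB: "finite A" "finite B" using AB simple_finite by (metis finite_Un)+
  have orths: "x \<bullet> y = 0" if "x \<in> span A" "y \<in> span B" for x y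
  proof -
    have "orthogonal x b" if "b \<in> B" for b
      using orthogonal_to_span[of x A b] \<open>x \<in> span A\<close> that orth
      by (metis inner_commute orthogonal_commute orthogonal_def)
    then have "orthogonal x y" using orthogonal_to_span[OF \<open>y \<in> span B\<close>] by metis
    then show ?thesis by (simp add: orthogonal_def)
  qed
  have cases: "\<beta> \<in> span A \<or> \<beta> \<in> span B" if "\<beta> \<in> \<Phi>" for \<beta>
  proof -
    obtain k where k: "\<beta> = icomb \<Delta> k" using root_icomb[OF \<open>\<beta> \<in> \<Phi>\<close>] by metis
    have "\<beta> = icomb A k + icomb B k"
      using k AB finAB by (simp add: icomb_def flip: sum.union_disjoint)
    moreover have "icomb A k \<bullet> icomb B k = 0" using orths icomb_in_span by blast
    ultimately have "N = icomb A k \<bullet> icomb A k + icomb B k \<bullet> icomb B k"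
      using norm[OF \<open>\<beta> \<in> \<Phi>\<close>] by (simp add: inner_add_left inner_add_right inner_commute)
    moreover have "icomb A k \<bullet> icomb A k \<ge> N" if "icomb A k \<noteq> 0"
      using icomb_subset_norm[of A k] AB that by auto
    moreover have "icomb B k \<bullet> icomb B k \<ge> N" if "icomb B k \<noteq> 0"
      using icomb_subset_norm[of B k] AB that by auto
    ultimately have "icomb A k = 0 \<or> icomb B k = 0" using N by fastforce
    then show ?thesis using \<open>\<beta> = icomb A k + icomb B k\<close> icomb_in_span[of A k] icomb_in_span[of B k] by auto
  qed
  have "A \<subseteq> \<Phi> \<inter> span A" using AB simple_roots by (auto intro: span_base)
  moreover have "B \<subseteq> \<Phi> - span A"
  proof
    fix b assume b: "b \<in> B"
    then have "b \<in> \<Phi>" using AB simple_roots by auto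
    moreover have "b \<notin> span A" using orths[of b b] span_base[OF b] root_ne_0[OF \<open>b \<in> \<Phi>\<close>] by auto
    ultimately show "b \<in> \<Phi> - span A" by simp
  qed
  moreover have "\<forall>\<alpha>\<in>\<Phi> \<inter> span A. \<forall>\<beta>\<in>\<Phi> - span A. \<alpha> \<bullet> \<beta> = 0" using cases orths by blast
  moreover have "(\<Phi> \<inter> span A) \<union> (\<Phi> - span A) = \<Phi>" "(\<Phi> \<inter> span A) \<inter> (\<Phi> - span A) = {}" by auto
  ultimately show False using irr ne unfolding irreducible_roots_def
    by (metis subset_empty)
qed

text \<open>The positive roots are those of positive height.\<close>

lemma height_exists:
  obtains h where "linear h" "\<And>k. h (icomb \<Delta> k) = real_of_int (\<Sum>\<alpha>\<in>\<Delta>. k \<alpha>)"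
    "\<And>\<beta>. \<beta> \<in> \<Phi> \<Longrightarrow> \<bar>h \<beta>\<bar> \<ge> 1"
    "\<And>k. icomb \<Delta> k \<in> \<Phi> \<Longrightarrow> h (icomb \<Delta> k) > 0 \<Longrightarrow> \<forall>\<alpha>\<in>\<Delta>. k \<alpha> \<ge> 0"
proof -
  \<comment> \<open>The extension is arbitrary outside \<open>span \<Delta>\<close>; this is
    harmless since only heights of roots are ever compared.\<close>
  obtain h :: "'a \<Rightarrow> real" where h: "linear h" "\<forall>\<alpha>\<in>\<Delta>. h \<alpha> = 1"
    using linear_independent_extend[OF simple_independent, of "\<lambda>_. 1"] by auto
  have hk: "h (icomb \<Delta> k) = real_of_int (\<Sum>\<alpha>\<in>\<Delta>. k \<alpha>)" for k
    using h by (simp add: icomb_def linear_sum linear_cmul)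
  have s: "\<bar>h \<beta>\<bar> \<ge> 1" if \<beta>: "\<beta> \<in> \<Phi>" for \<beta>
  proof -
    obtain k where k: "\<beta> = icomb \<Delta> k" "(\<forall>\<alpha>\<in>\<Delta>. k \<alpha> \<ge> 0) \<or> (\<forall>\<alpha>\<in>\<Delta>. k \<alpha> \<le> 0)"
      using root_icomb[OF \<beta>] by metis
    have "(\<Sum>\<alpha>\<in>\<Delta>. k \<alpha>) \<noteq> 0"
    proof
      assume 0: "(\<Sum>\<alpha>\<in>\<Delta>. k \<alpha>) = 0"
      from k(2) have "\<forall>\<alpha>\<in>\<Delta>. k \<alpha> = 0"
      proof
        assume "\<forall>\<alpha>\<in>\<Delta>. k \<alpha> \<ge> 0"
        then show ?thesis using 0 sum_nonneg_eq_0_iff[OF simple_finite, of k] by blast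
      next
        assume "\<forall>\<alpha>\<in>\<Delta>. k \<alpha> \<le> 0"
        moreover have "(\<Sum>\<alpha>\<in>\<Delta>. - k \<alpha>) = 0" using 0 by (simp add: sum_negf)
        ultimately show ?thesis using sum_nonneg_eq_0_iff[OF simple_finite, of "\<lambda>\<alpha>. - k \<alpha>"]
          by simp
      qed
      then have "\<beta> = 0" using k(1) by (simp add: icomb_def)
      then show False using root_ne_0 \<beta> by simp
    qed
    then have "\<bar>\<Sum>\<alpha>\<in>\<Delta>. k \<alpha>\<bar> \<ge> 1" by linarith
    then show ?thesis unfolding k(1) hk by (metis of_int_1_le_iff of_int_abs)
  qed
  have p: "\<forall>\<alpha>\<in>\<Delta>. k \<alpha> \<ge> 0" if "icomb \<Delta> k \<in> \<Phi>" "h (icomb \<Delta> k) > 0" for k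
    using icomb_root_sign[OF that(1)]
  proof
    assume "\<forall>\<alpha>\<in>\<Delta>. k \<alpha> \<le> 0"
    then have "(\<Sum>\<alpha>\<in>\<Delta>. k \<alpha>) \<le> 0" by (intro sum_nonpos) auto
    then have "\<not> h (icomb \<Delta> k) > 0" unfolding hk by linarith
    then show ?thesis using that(2) by contradiction
  qed
  show ?thesis by (rule that[OF h(1) hk s p])
qed

end

section \<open>Positive roots and conjugacy of simple systems\<close>

definition height :: "'a set \<Rightarrow> 'a \<Rightarrow> real" where
  "height \<Delta> = (SOME h. linear h \<and> (\<forall>k. h (icomb \<Delta> k) = real_of_int (\<Sum>\<alpha>\<in>\<Delta>. k \<alpha>)) \<and>
     (\<forall>\<beta>\<in>\<Phi>. \<bar>h \<beta>\<bar> \<ge> 1) \<and> (\<forall>k. icomb \<Delta> k \<in> \<Phi> \<longrightarrow> h (icomb \<Delta> k) > 0 \<longrightarrow> (\<forall>\<alpha>\<in>\<Delta>. k \<alpha> \<ge> 0)))"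

lemma height:
  assumes "simple_system \<Phi> \<Delta>"
  shows "linear (height \<Delta>)" "height \<Delta> (icomb \<Delta> k) = real_of_int (\<Sum>\<alpha>\<in>\<Delta>. k \<alpha>)"
    "\<beta> \<in> \<Phi> \<Longrightarrow> \<bar>height \<Delta> \<beta>\<bar> \<ge> 1"
    "icomb \<Delta> k \<in> \<Phi> \<Longrightarrow> height \<Delta> (icomb \<Delta> k) > 0 \<Longrightarrow> \<forall>\<alpha>\<in>\<Delta>. k \<alpha> \<ge> 0"
proof -
  let ?P = "\<lambda>h. linear h \<and> (\<forall>k. h (icomb \<Delta> k) = real_of_int (\<Sum>\<alpha>\<in>\<Delta>. k \<alpha>)) \<and>
     (\<forall>\<beta>\<in>\<Phi>. \<bar>h \<beta>\<bar> \<ge> 1) \<and> (\<forall>k. icomb \<Delta> k \<in> \<Phi> \<longrightarrow> h (icomb \<Delta> k) > 0 \<longrightarrow> (\<forall>\<alpha>\<in>\<Delta>. k \<alpha> \<ge> 0))"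
  have "\<exists>h. ?P h" by (rule height_exists[OF assms]) blast
  then have "?P (height \<Delta>)" unfolding height_def by (rule someI_ex)
  then show "linear (height \<Delta>)" "height \<Delta> (icomb \<Delta> k) = real_of_int (\<Sum>\<alpha>\<in>\<Delta>. k \<alpha>)"
    "\<beta> \<in> \<Phi> \<Longrightarrow> \<bar>height \<Delta> \<beta>\<bar> \<ge> 1"
    "icomb \<Delta> k \<in> \<Phi> \<Longrightarrow> height \<Delta> (icomb \<Delta> k) > 0 \<Longrightarrow> \<forall>\<alpha>\<in>\<Delta>. k \<alpha> \<ge> 0"
    by blast+
qed

lemma height_simple:
  assumes "simple_system \<Phi> \<Delta>" "\<alpha> \<in> \<Delta>"
  shows "height \<Delta> \<alpha> = 1"
proof -
  have "finite \<Delta>" using assms simple_finite by blast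
  then show ?thesis
    using height(2)[OF assms(1), of "\<lambda>\<beta>. if \<beta> = \<alpha> then 1 else 0"] assms(2)
    by (simp add: icomb_single)
qed

lemma height_uminus: "simple_system \<Phi> \<Delta> \<Longrightarrow> height \<Delta> (- x) = - height \<Delta> x"
  using linear_neg[OF height(1)] by blast

text \<open>A positive root other than \<alpha> has a positive coefficient at some further simple
  root, because a multiple of \<alpha> of the same length is \<alpha> or its negative. The
  reflection changes only the coefficient at \<alpha>, so that other one keeps the sign.\<close>

lemma height_reflection_pos:
  assumes S: "simple_system \<Phi> \<Delta>" and \<alpha>: "\<alpha> \<in> \<Delta>" and \<beta>: "\<beta> \<in> \<Phi>" "height \<Delta> \<beta> > 0" "\<beta> \<noteq> \<alpha>"
  shows "height \<Delta> (root_reflection \<alpha> \<beta>) > 0"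
proof -
  note [simp] = simple_finite[OF S]
  have r: "\<alpha> \<in> \<Phi>" using simple_roots[OF S] \<alpha> by auto
  obtain k where k: "\<beta> = icomb \<Delta> k" using root_icomb[OF S \<beta>(1)] by metis
  have k0: "\<forall>\<gamma>\<in>\<Delta>. k \<gamma> \<ge> 0" using height(4)[OF S] \<beta> k by blast
  have "\<exists>\<gamma>\<in>\<Delta>. \<gamma> \<noteq> \<alpha> \<and> k \<gamma> > 0"
  proof (rule ccontr)
    assume "\<not> ?thesis"
    then have "\<beta> = icomb \<Delta> (\<lambda>\<gamma>. if \<gamma> = \<alpha> then k \<alpha> else 0)"
      unfolding k using k0 by (intro icomb_cong) force
    then have b: "\<beta> = of_int (k \<alpha>) *\<^sub>R \<alpha>" using \<alpha> by (simp add: icomb_single)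
    then have "N = of_int (k \<alpha> * k \<alpha>) * N" using norm[OF \<beta>(1)] norm[OF r] by simp
    then have "k \<alpha> * k \<alpha> = 1" using N by (simp del: of_int_mult)
    then have "k \<alpha> = 1" using k0 \<alpha> by (auto simp: zmult_eq_1_iff)
    then show False using b \<beta>(3) by simp
  qed
  then obtain \<gamma> where \<gamma>: "\<gamma> \<in> \<Delta>" "\<gamma> \<noteq> \<alpha>" "k \<gamma> > 0" by blast
  obtain j :: int where j: "2 * (\<alpha> \<bullet> \<beta>) = of_int j * N" using int[OF r \<beta>(1)] by blast
  define l where "l \<gamma> = k \<gamma> - (if \<gamma> = \<alpha> then j else 0)" for \<gamma>
  have l: "icomb \<Delta> l = root_reflection \<alpha> \<beta>"
    unfolding l_def icomb_diff[symmetric] using \<alpha> reflection_eq[OF r j] k by (simp add: icomb_single)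
  have "icomb \<Delta> l \<in> \<Phi>" using l refl[OF r \<beta>(1)] by simp
  then have "\<forall>\<gamma>\<in>\<Delta>. l \<gamma> \<ge> 0" using icomb_root_sign[OF S, of l] \<gamma> by (force simp: l_def)
  then have "(\<Sum>\<gamma>\<in>\<Delta>. l \<gamma>) \<ge> l \<gamma>" using \<gamma> by (intro member_le_sum) auto
  then have "(\<Sum>\<gamma>\<in>\<Delta>. l \<gamma>) > 0" using \<gamma> by (simp add: l_def)
  then show ?thesis using height(2)[OF S, of l] l by (simp del: of_int_sum)
qed

lemma simple_system_reflect:
  assumes S: "simple_system \<Phi> \<Delta>" and \<alpha>: "\<alpha> \<in> \<Phi>"
  shows "simple_system \<Phi> (root_reflection \<alpha> ` \<Delta>)"
proof -
  let ?r = "root_reflection \<alpha>"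
  have inj: "inj ?r" by (rule inj_on_inverseI[where g = ?r]) (simp add: reflection_involution[OF \<alpha>])
  have lin: "linear ?r" by (rule linear_root_reflection)
  show ?thesis unfolding simple_system_def
  proof (intro conjI ballI)
    show "?r ` \<Delta> \<subseteq> \<Phi>" using simple_roots[OF S] refl[OF \<alpha>] by auto
    show "independent (?r ` \<Delta>)"
      using simple_independent[OF S] inj lin by (intro linear_independent_injective_image) (auto intro: inj_on_subset)
    fix \<beta> assume "\<beta> \<in> \<Phi>"
    then obtain k where k: "?r \<beta> = icomb \<Delta> k" "(\<forall>\<alpha>\<in>\<Delta>. k \<alpha> \<ge> 0) \<or> (\<forall>\<alpha>\<in>\<Delta>. k \<alpha> \<le> 0)"
      using root_icomb[OF S refl[OF \<alpha>]] by metis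
    have "\<beta> = ?r (icomb \<Delta> k)" using k(1) reflection_involution[OF \<alpha>] by metis
    also have "\<dots> = (\<Sum>\<gamma>\<in>?r ` \<Delta>. of_int (k (?r \<gamma>)) *\<^sub>R \<gamma>)"
      using inj by (subst sum.reindex)
        (auto simp: icomb_def linear_sum[OF lin] linear_cmul[OF lin] reflection_involution[OF \<alpha>] inj_on_def)
    finally show "\<exists>k. \<beta> = (\<Sum>\<gamma>\<in>?r ` \<Delta>. of_int (k \<gamma>) *\<^sub>R \<gamma>) \<and>
        ((\<forall>\<gamma>\<in>?r ` \<Delta>. k \<gamma> \<ge> 0) \<or> (\<forall>\<gamma>\<in>?r ` \<Delta>. k \<gamma> \<le> 0))"
      using k(2) reflection_involution[OF \<alpha>] by (intro exI[of _ "\<lambda>\<gamma>. k (?r \<gamma>)"]) auto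
  qed
qed

lemma height_reflect:
  assumes S: "simple_system \<Phi> \<Delta>" and \<alpha>: "\<alpha> \<in> \<Phi>" and \<beta>: "\<beta> \<in> \<Phi>"
  shows "height (root_reflection \<alpha> ` \<Delta>) \<beta> = height \<Delta> (root_reflection \<alpha> \<beta>)"
proof -
  let ?r = "root_reflection \<alpha>"
  note S' = simple_system_reflect[OF S \<alpha>]
  obtain k where k: "?r \<beta> = icomb \<Delta> k" using root_icomb[OF S refl[OF \<alpha> \<beta>]] by metis
  have lin: "linear ?r" by (rule linear_root_reflection)
  have "\<beta> = ?r (icomb \<Delta> k)" using k reflection_involution[OF \<alpha>] by metis
  then have "height (?r ` \<Delta>) \<beta> = (\<Sum>\<gamma>\<in>\<Delta>. of_int (k \<gamma>) * height (?r ` \<Delta>) (?r \<gamma>))"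
    by (simp add: icomb_def linear_sum[OF lin] linear_cmul[OF lin]
        linear_sum[OF height(1)[OF S']] linear_cmul[OF height(1)[OF S']])
  also have "\<dots> = height \<Delta> (?r \<beta>)"
    unfolding k height(2)[OF S] by (simp add: height_simple[OF S'])
  finally show ?thesis .
qed

text \<open>Simple roots are the indecomposable positive roots: \<open>\<delta>\<close> has
  \<Delta>-height 1, and every member of \<open>\<Delta>'\<close> has \<Delta>-height at least 1, so
  the expansion of \<open>\<delta>\<close> in \<open>\<Delta>'\<close> has a single term with
  coefficient 1.\<close>

lemma simple_subset_if_positive_subset:
  assumes S: "simple_system \<Phi> \<Delta>" "simple_system \<Phi> \<Delta>'"
    and pos: "\<And>\<beta>. \<beta> \<in> \<Phi> \<Longrightarrow> height \<Delta> \<beta> > 0 \<longleftrightarrow> height \<Delta>' \<beta> > 0"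
  shows "\<Delta> \<subseteq> \<Delta>'"
proof
  fix \<delta> assume \<delta>: "\<delta> \<in> \<Delta>"
  then have r: "\<delta> \<in> \<Phi>" using simple_roots[OF S(1)] by auto
  have h1: "height \<Delta> \<delta> = 1" using height_simple[OF S(1) \<delta>] .
  obtain k where k: "\<delta> = icomb \<Delta>' k" using root_icomb[OF S(2) r] by metis
  have k0: "\<forall>\<gamma>\<in>\<Delta>'. k \<gamma> \<ge> 0" using height(4)[OF S(2), of k] r k pos[OF r] h1 by simp
  have ge: "height \<Delta> \<gamma> \<ge> 1" if "\<gamma> \<in> \<Delta>'" for \<gamma>
  proof -
    have "\<gamma> \<in> \<Phi>" using that simple_roots[OF S(2)] by auto
    moreover have "height \<Delta> \<gamma> > 0" using pos[OF \<open>\<gamma> \<in> \<Phi>\<close>] height_simple[OF S(2) that] by simp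
    ultimately show ?thesis using height(3)[OF S(1), of \<gamma>] by simp
  qed
  have fin': "finite \<Delta>'" using simple_finite[OF S(2)] .
  have "1 = (\<Sum>\<gamma>\<in>\<Delta>'. of_int (k \<gamma>) * height \<Delta> \<gamma>)"
    using h1 k by (simp add: icomb_def linear_sum[OF height(1)[OF S(1)]] linear_cmul[OF height(1)[OF S(1)]])
  also have "\<dots> \<ge> (\<Sum>\<gamma>\<in>\<Delta>'. of_int (k \<gamma>) * 1)"
    using k0 ge by (intro sum_mono mult_left_mono) auto
  finally have "real_of_int (\<Sum>\<gamma>\<in>\<Delta>'. k \<gamma>) \<le> 1" by simp
  then have sum_le: "(\<Sum>\<gamma>\<in>\<Delta>'. k \<gamma>) \<le> 1" by linarith
  have "\<exists>\<gamma>\<in>\<Delta>'. k \<gamma> \<noteq> 0"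
  proof (rule ccontr)
    assume "\<not> ?thesis"
    then have "\<delta> = 0" unfolding k by (simp add: icomb_def)
    then show False using root_ne_0[OF r] by simp
  qed
  then obtain \<gamma> where \<gamma>: "\<gamma> \<in> \<Delta>'" "k \<gamma> \<ge> 1" using k0 by (metis int_one_le_iff_zero_less order_le_less)
  have "(\<Sum>\<gamma>\<in>\<Delta>'. k \<gamma>) = k \<gamma> + (\<Sum>\<gamma>\<in>\<Delta>' - {\<gamma>}. k \<gamma>)"
    using \<gamma> fin' by (simp add: sum.remove)
  moreover have "(\<Sum>\<gamma>\<in>\<Delta>' - {\<gamma>}. k \<gamma>) \<ge> 0" using k0 by (intro sum_nonneg) auto
  ultimately have "k \<gamma> = 1" "(\<Sum>\<gamma>\<in>\<Delta>' - {\<gamma>}. k \<gamma>) = 0" using \<gamma> sum_le by linarith+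
  then have "\<forall>\<beta>\<in>\<Delta>' - {\<gamma>}. k \<beta> = 0" using k0 fin' by (subst (asm) sum_nonneg_eq_0_iff) auto
  then have "\<delta> = icomb \<Delta>' (\<lambda>\<beta>. if \<beta> = \<gamma> then 1 else 0)"
    unfolding k using \<open>k \<gamma> = 1\<close> by (intro icomb_cong) auto
  then show "\<delta> \<in> \<Delta>'" using \<gamma> fin' by (simp add: icomb_single)
qed

text \<open>Induction on the number of roots that are positive for \<Delta> and negative for
  \<open>\<Delta>'\<close>. Reflecting \<Delta> in a simple \<alpha> that is negative for
  \<open>\<Delta>'\<close> removes \<alpha> from this set and adds nothing. Orthogonality of
  \<open>w\<close> is recorded because it preserves the Gram matrix.\<close>

theorem simple_systems_conjugate:
  assumes "simple_system \<Phi> \<Delta>" and S': "simple_system \<Phi> \<Delta>'"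
  shows "\<exists>w. orthogonal_transformation w \<and> w ` \<Delta> = \<Delta>'"
  using assms(1)
proof (induction "card {\<beta>\<in>\<Phi>. height \<Delta> \<beta> > 0 \<and> height \<Delta>' \<beta> < 0}" arbitrary: \<Delta> rule: less_induct)
  case less
  note S = less.prems
  have sgn: "height D \<beta> > 0 \<or> height D \<beta> < 0" if "simple_system \<Phi> D" "\<beta> \<in> \<Phi>" for D \<beta>
    using height(3)[OF that] by linarith
  show ?case
  proof (cases "\<exists>\<alpha>\<in>\<Delta>. height \<Delta>' \<alpha> < 0")
    case False
    have P: "height \<Delta>' \<beta> > 0" if \<beta>: "\<beta> \<in> \<Phi>" "height \<Delta> \<beta> > 0" for \<beta>
    proof -
      obtain k where k: "\<beta> = icomb \<Delta> k" using root_icomb[OF S \<beta>(1)] by metis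
      have "\<forall>\<alpha>\<in>\<Delta>. k \<alpha> \<ge> 0" using height(4)[OF S] k \<beta> by blast
      then have "(\<Sum>\<gamma>\<in>\<Delta>. of_int (k \<gamma>) * height \<Delta>' \<gamma>) \<ge> 0"
        using False by (intro sum_nonneg mult_nonneg_nonneg) (auto simp: not_less)
      then have "height \<Delta>' \<beta> \<ge> 0"
        by (simp add: k icomb_def linear_sum[OF height(1)[OF S']] linear_cmul[OF height(1)[OF S']])
      then show ?thesis using sgn[OF S' \<beta>(1)] by linarith
    qed
    have "height \<Delta> \<beta> > 0 \<longleftrightarrow> height \<Delta>' \<beta> > 0" if \<beta>: "\<beta> \<in> \<Phi>" for \<beta>
      using P[OF \<beta>] P[OF uminus_root[OF \<beta>]] sgn[OF S \<beta>]
      by (auto simp: height_uminus[OF S] height_uminus[OF S'])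
    then have "\<Delta> = \<Delta>'"
      using simple_subset_if_positive_subset[OF S S'] simple_subset_if_positive_subset[OF S' S] by blast
    then show ?thesis by (intro exI[of _ id]) (simp add: orthogonal_transformation_def linear_id)
  next
    case True
    then obtain \<alpha> where \<alpha>: "\<alpha> \<in> \<Delta>" "height \<Delta>' \<alpha> < 0" by blast
    let ?r = "root_reflection \<alpha>"
    have r: "\<alpha> \<in> \<Phi>" using simple_roots[OF S] \<alpha> by auto
    note S1 = simple_system_reflect[OF S r]
    have "{\<beta>\<in>\<Phi>. height (?r ` \<Delta>) \<beta> > 0 \<and> height \<Delta>' \<beta> < 0}
        \<subseteq> {\<beta>\<in>\<Phi>. height \<Delta> \<beta> > 0 \<and> height \<Delta>' \<beta> < 0} - {\<alpha>}"
    proof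
      fix \<beta> assume "\<beta> \<in> {\<beta>\<in>\<Phi>. height (?r ` \<Delta>) \<beta> > 0 \<and> height \<Delta>' \<beta> < 0}"
      then have \<beta>: "\<beta> \<in> \<Phi>" "height \<Delta> (?r \<beta>) > 0" "height \<Delta>' \<beta> < 0"
        using height_reflect[OF S r] by auto
      have "\<beta> \<noteq> \<alpha>"
        using \<beta>(2) reflection_self[OF r] height_simple[OF S \<alpha>(1)] by (auto simp: height_uminus[OF S])
      moreover have "?r \<beta> \<noteq> \<alpha>"
      proof
        assume "?r \<beta> = \<alpha>"
        then have "\<beta> = - \<alpha>" using reflection_involution[OF r] reflection_self[OF r] by metis
        then show False using \<beta>(3) \<alpha>(2) by (simp add: height_uminus[OF S'])
      qed
      then have "height \<Delta> \<beta> > 0"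
        using height_reflection_pos[OF S \<alpha>(1) refl[OF r \<beta>(1)] \<beta>(2)] by (simp add: reflection_involution[OF r])
      ultimately show "\<beta> \<in> {\<beta>\<in>\<Phi>. height \<Delta> \<beta> > 0 \<and> height \<Delta>' \<beta> < 0} - {\<alpha>}" using \<beta> by simp
    qed
    moreover have "\<alpha> \<in> {\<beta>\<in>\<Phi>. height \<Delta> \<beta> > 0 \<and> height \<Delta>' \<beta> < 0}"
      using \<alpha> r height_simple[OF S \<alpha>(1)] by simp
    ultimately have "card {\<beta>\<in>\<Phi>. height (?r ` \<Delta>) \<beta> > 0 \<and> height \<Delta>' \<beta> < 0}
        < card {\<beta>\<in>\<Phi>. height \<Delta> \<beta> > 0 \<and> height \<Delta>' \<beta> < 0}"
      using fin by (intro psubset_card_mono) auto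
    from less.hyps[OF this S1] obtain w where "orthogonal_transformation w" "w ` ?r ` \<Delta> = \<Delta>'" by blast
    then show ?thesis
      using orthogonal_reflection[OF r]
      by (intro exI[of _ "w \<circ> ?r"]) (auto intro: orthogonal_transformation_compose simp: image_comp)
  qed
qed

end

subsection \<open>Classification of the simply laced diagrams\<close>

definition sl_basis :: "real \<Rightarrow> 'a::euclidean_space set \<Rightarrow> bool" where
  "sl_basis N \<Delta> \<longleftrightarrow> N > 0 \<and> independent \<Delta> \<and> (\<forall>\<alpha>\<in>\<Delta>. \<alpha> \<bullet> \<alpha> = N) \<and>
     (\<forall>\<alpha>\<in>\<Delta>. \<forall>\<beta>\<in>\<Delta>. \<alpha> \<noteq> \<beta> \<longrightarrow> 2 * (\<alpha> \<bullet> \<beta>) = 0 \<or> 2 * (\<alpha> \<bullet> \<beta>) = - N)"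

text \<open>In contrast to \<open>dynkin\<close>, the list may exhaust only a part of \<Delta>, and
  only the vanishing of inner products is prescribed: this is the form in which a diagram grows node
  by node.\<close>

definition labelled :: "'a::euclidean_space set \<Rightarrow> nat \<Rightarrow> 'a list \<Rightarrow> bool" where
  "labelled \<Delta> k zs \<longleftrightarrow> distinct zs \<and> set zs \<subseteq> \<Delta> \<and> (length zs = 1 \<or> Suc k < length zs) \<and>
     (\<forall>j<length zs. \<forall>i<j. zs ! i \<bullet> zs ! j \<noteq> 0 \<longleftrightarrow> (if i = 0 then j = Suc k else j = Suc i))"

lemma labelled_adj:
  assumes "labelled \<Delta> k zs" "i < j" "j < length zs"
  shows "zs ! i \<bullet> zs ! j \<noteq> 0 \<longleftrightarrow> (if i = 0 then j = Suc k else j = Suc i)"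
  using assms unfolding labelled_def by blast

lemma labelled_dynkin:
  assumes B: "sl_basis N \<Delta>" and L: "labelled \<Delta> k zs"
  shows "dynkin N k zs"
  unfolding dynkin_def
proof (intro conjI allI impI)
  have adj: "zs ! i \<bullet> zs ! j \<noteq> 0 \<longleftrightarrow> edge k i j" if "i < j" "j < length zs" for i j
    using L that by (auto simp: labelled_def edge_def)
  have inn: "2 * (zs ! i \<bullet> zs ! j) = N * cartan k i j" if "i < j" "j < length zs" for i j
  proof -
    have "zs ! i \<in> \<Delta>" "zs ! j \<in> \<Delta>" "zs ! i \<noteq> zs ! j"
      using L that by (auto simp: labelled_def nth_eq_iff_index_eq subset_iff)
    then have "2 * (zs ! i \<bullet> zs ! j) = 0 \<or> 2 * (zs ! i \<bullet> zs ! j) = - N"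
      using B by (auto simp: sl_basis_def)
    then show ?thesis using adj[OF that] that B by (auto simp: cartan_def sl_basis_def)
  qed
  have sym: "cartan k i j = cartan k j i" for i j by (auto simp: cartan_def edge_def)
  fix i j assume ij: "i < length zs" "j < length zs"
  consider "i < j" | "i = j" | "j < i" by linarith
  then show "2 * (zs ! i \<bullet> zs ! j) = N * cartan k i j"
  proof cases
    case 2
    have "zs ! i \<in> \<Delta>" using L ij by (auto simp: labelled_def subset_iff)
    then show ?thesis using B 2 by (auto simp: sl_basis_def cartan_def)
  qed (use inn[of i j] inn[of j i] ij sym in \<open>auto simp: inner_commute\<close>)
next
  show "independent (set zs)" using B L independent_mono by (auto simp: sl_basis_def labelled_def)
qed (use B L in \<open>auto simp: sl_basis_def labelled_def\<close>)

section \<open>Enlarging and relabelling diagrams\<close>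

lemma labelled_snoc:
  assumes L: "labelled \<Delta> k zs" and v: "v \<in> \<Delta> - set zs" and k: "k = 0 \<or> Suc k < length zs"
    and att: "\<And>i. i < length zs \<Longrightarrow> zs ! i \<bullet> v \<noteq> 0 \<longleftrightarrow> i = length zs - 1"
  shows "labelled \<Delta> k (zs @ [v])"
proof -
  have "(zs @ [v]) ! i \<bullet> (zs @ [v]) ! j \<noteq> 0 \<longleftrightarrow> (if i = 0 then j = Suc k else j = Suc i)"
    if "i < j" "j < Suc (length zs)" for i j
  proof (cases "j = length zs")
    case True
    \<comment> \<open>The new last node is adjacent to node 0 only if \<open>zs\<close> has a single
      node, and then \<open>k = 0\<close>.\<close>
    have "length zs = 1 \<or> Suc k < length zs" using L by (simp add: labelled_def)
    then show ?thesis using True att[of i] that k by (auto simp: nth_append)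
  next
    case False
    then show ?thesis using that labelled_adj[OF L, of i j] by (simp add: nth_append)
  qed
  then show ?thesis using L v k by (auto simp: labelled_def)
qed

lemma labelled_rev:
  assumes L: "labelled \<Delta> 0 zs"
  shows "labelled \<Delta> 0 (rev zs)"
proof -
  have "rev zs ! i \<bullet> rev zs ! j \<noteq> 0 \<longleftrightarrow> (if i = 0 then j = Suc 0 else j = Suc i)"
    if "i < j" "j < length zs" for i j
  proof -
    let ?i = "length zs - Suc j" and ?j = "length zs - Suc i"
    have "zs ! ?i \<bullet> zs ! ?j \<noteq> 0 \<longleftrightarrow> ?j = Suc ?i"
      using labelled_adj[OF L, of ?i ?j] that by (simp split: if_splits)
    then show ?thesis using that by (auto simp: rev_nth inner_commute)
  qed
  then show ?thesis using L by (auto simp: labelled_def)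
qed

text \<open>The new node becomes node 0, and the place where it hangs on the path becomes the
  parameter of the diagram; this is how \<open>A_n\<close> turns into types D and E.\<close>

lemma labelled_Cons:
  assumes L: "labelled \<Delta> 0 zs" and v: "v \<in> \<Delta> - set zs" and s: "s < length zs"
    and att: "\<And>i. i < length zs \<Longrightarrow> zs ! i \<bullet> v \<noteq> 0 \<longleftrightarrow> i = s"
  shows "labelled \<Delta> s (v # zs)"
proof -
  have "(v # zs) ! i \<bullet> (v # zs) ! j \<noteq> 0 \<longleftrightarrow> (if i = 0 then j = Suc s else j = Suc i)"
    if ij: "i < j" "j < Suc (length zs)" for i j
  proof -
    from ij obtain j' where j: "j = Suc j'" by (cases j) auto
    show ?thesis
    proof (cases i)
      case 0
      then show ?thesis using att[of j'] ij j by (auto simp: inner_commute)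
    next
      case (Suc i')
      then show ?thesis using labelled_adj[OF L, of i' j'] ij j by auto
    qed
  qed
  then show ?thesis using L v s by (auto simp: labelled_def)
qed

lemma labelled_tl:
  assumes L: "labelled \<Delta> k (e # xs)" and "xs \<noteq> []"
  shows "labelled \<Delta> 0 xs"
proof -
  have "xs ! i \<bullet> xs ! j \<noteq> 0 \<longleftrightarrow> j = Suc i" if "i < j" "j < length xs" for i j
    using labelled_adj[OF L, of "Suc i" "Suc j"] that by simp
  then show ?thesis using L assms(2) by (cases xs) (auto simp: labelled_def)
qed

lemma labelled_adj_first:
  assumes "labelled \<Delta> k (e # xs)" "i < length xs"
  shows "xs ! i \<bullet> e \<noteq> 0 \<longleftrightarrow> i = k"
  using labelled_adj[OF assms(1), of 0 "Suc i"] assms(2) by (simp add: inner_commute)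

lemma labelled_first:
  assumes "labelled \<Delta> k (e # xs)" 
  shows "e \<in> \<Delta>" "e \<notin> set xs"
  using assms by (auto simp: labelled_def)

text \<open>The new node prolongs the leg that starts at node 1, which moves the branch node one
  place further: type D becomes type E.\<close>

lemma labelled_cons_chain:
  assumes L: "labelled \<Delta> k (e # xs)" and v: "v \<in> \<Delta> - set (e # xs)" and k: "k < length xs"
    and att: "\<And>i. i < length (e # xs) \<Longrightarrow> (e # xs) ! i \<bullet> v \<noteq> 0 \<longleftrightarrow> i = 1"
  shows "labelled \<Delta> (Suc k) (e # v # xs)"
proof (rule labelled_Cons)
  have xs: "xs \<noteq> []" using k by auto
  have attx: "xs ! i \<bullet> v \<noteq> 0 \<longleftrightarrow> i = 0" if "i < length xs" for i
    using att[of "Suc i"] that by auto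
  have "labelled \<Delta> 0 (v # xs)"
    using labelled_Cons[OF labelled_tl[OF L xs], of v 0] v xs attx by auto
  then show "labelled \<Delta> 0 (v # xs)" .
  show "e \<in> \<Delta> - set (v # xs)" using labelled_first[OF L] v by auto
  fix i assume "i < length (v # xs)"
  then show "(v # xs) ! i \<bullet> e \<noteq> 0 \<longleftrightarrow> i = Suc k"
    using att[of 0] labelled_adj_first[OF L] by (cases i) (auto simp: inner_commute)
qed (use k in simp)

text \<open>Exchanges the two legs of the path on either side of the branch node.\<close>

lemma labelled_rev_chain:
  assumes L: "labelled \<Delta> k (e # xs)" and k: "k < length xs"
  shows "labelled \<Delta> (length xs - 1 - k) (e # rev xs)"
proof (rule labelled_Cons)
  have "xs \<noteq> []" using k by auto
  then show "labelled \<Delta> 0 (rev xs)" by (intro labelled_rev labelled_tl[OF L])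
  show "e \<in> \<Delta> - set (rev xs)" using labelled_first[OF L] by auto
  fix i assume "i < length (rev xs)"
  then show "rev xs ! i \<bullet> e \<noteq> 0 \<longleftrightarrow> i = length xs - 1 - k"
    using labelled_adj_first[OF L, of "length xs - Suc i"] k by (auto simp: rev_nth)
qed (use k in simp)

text \<open>For \<open>k = 1\<close>, nodes 0 and 1 are the two short legs at node 2 and play
  symmetric roles.\<close>

lemma labelled_swap:
  assumes L: "labelled \<Delta> 1 (a # b # xs)"
  shows "labelled \<Delta> 1 (b # a # xs)"
proof (rule labelled_Cons)
  have n: "xs \<noteq> []" using L by (auto simp: labelled_def)
  have Lbx: "labelled \<Delta> 0 (b # xs)" using labelled_tl[OF L] by simp
  have ab: "a \<bullet> b = 0" "\<And>i. i < length xs \<Longrightarrow> xs ! i \<bullet> a \<noteq> 0 \<longleftrightarrow> i = 0"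
    using labelled_adj_first[OF L, of 0] labelled_adj_first[OF L, of "Suc i" for i]
    by (auto simp: inner_commute)
  show "labelled \<Delta> 0 (a # xs)"
    using labelled_Cons[OF labelled_tl[OF Lbx n], of a 0] labelled_first[OF L] ab n by auto
  show "b \<in> \<Delta> - set (a # xs)" using labelled_first[OF Lbx] labelled_first[OF L] by auto
  fix i assume "i < length (a # xs)"
  then show "(a # xs) ! i \<bullet> b \<noteq> 0 \<longleftrightarrow> i = 1"
    using ab labelled_adj_first[OF Lbx] by (cases i) auto
next
  show "1 < length (a # xs)" using L by (auto simp: labelled_def)
qed

lemma labelled_take:
  assumes "labelled \<Delta> k zs" "Suc k < m" "m \<le> length zs"
  shows "labelled \<Delta> k (take m zs)"
  using assms by (auto simp: labelled_def dest: in_set_takeD)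

lemma labelled_chain_segment:
  assumes L: "labelled \<Delta> 0 xs" and "a + l \<le> length xs" "l > 0"
  shows "labelled \<Delta> 0 (take l (drop a xs))"
proof -
  have "xs ! (a + i) \<bullet> xs ! (a + j) \<noteq> 0 \<longleftrightarrow> j = Suc i" if "i < j" "j < l" for i j
  proof -
    have "xs ! (a + i) \<bullet> xs ! (a + j) \<noteq> 0 \<longleftrightarrow> a + j = Suc (a + i)"
      using labelled_adj[OF L, of "a + i" "a + j"] that assms(2) by (auto split: if_splits)
    then show ?thesis by simp
  qed
  moreover have "set (take l (drop a xs)) \<subseteq> set xs"
    by (meson set_drop_subset set_take_subset subset_trans)
  ultimately show ?thesis
    using L assms(2,3) by (auto simp: labelled_def)
qed

text \<open>The coefficients of the highest root.\<close>

definition admissible :: "nat \<Rightarrow> nat \<Rightarrow> bool" where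
  "admissible k n \<longleftrightarrow> (k = 0 \<and> n \<ge> 1) \<or> (k = 1 \<and> n \<ge> 4) \<or> (k = 2 \<and> n \<in> {6, 7, 8})"

definition mark :: "nat \<Rightarrow> nat \<Rightarrow> nat \<Rightarrow> nat" where
  "mark k n i = (if k = 0 then 1
     else if k = 1 then (if i \<le> 1 \<or> i = n - 1 then 1 else 2)
     else if n = 6 then [2, 1, 2, 3, 2, 1] ! i
     else if n = 7 then [2, 2, 3, 4, 3, 2, 1] ! i
     else [3, 2, 4, 6, 5, 4, 3, 2] ! i)"

text \<open>For \<open>k > 0\<close>, the node to which the affine node is attached.\<close>

definition affine_node :: "nat \<Rightarrow> nat \<Rightarrow> nat" where
  "affine_node k n = (if k = 1 then n - 2 else if n = 6 then 0 else if n = 7 then 1 else 7)"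

text \<open>The number \<open>2 (\<theta>, \<alpha>_i) / N\<close>. In type A the affine node is
  joined to both ends of the path; for \<open>n = 1\<close> the ends coincide and the value is
  2.\<close>

definition mark_pairing :: "nat \<Rightarrow> nat \<Rightarrow> nat \<Rightarrow> nat" where
  "mark_pairing k n i = (if k = 0 then of_bool (i = 0) + of_bool (i = n - 1)
     else of_bool (i = affine_node k n))"

section \<open>The highest root in coordinates\<close>

lemma sum_cartan:
  fixes f :: "nat \<Rightarrow> real"
  assumes "i < n"
  shows "(\<Sum>j<n. f j * cartan k i j) = 2 * f i - (\<Sum>j | j < n \<and> edge k i j. f j)"
proof -
  have nii: "\<not> edge k i i" by (auto simp: edge_def)
  have "(\<Sum>j<n. f j * cartan k i j) =
      (\<Sum>j<n. (if j = i then 2 * f j else 0) - (if edge k i j then f j else 0))"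
    by (rule sum.cong) (auto simp: cartan_def nii)
  also have "\<dots> = 2 * f i - (\<Sum>j<n. if edge k i j then f j else 0)"
    using assms by (simp add: sum_subtractf)
  also have "(\<Sum>j<n. if edge k i j then f j else 0) = (\<Sum>j | j < n \<and> edge k i j. f j)"
    by (simp add: sum.inter_filter[symmetric])
  finally show ?thesis .
qed

text \<open>With mark 1 at the affine node, the marks form a null vector of the extended Cartan
  matrix: twice each mark is the sum of the neighbouring marks. Omitting the affine node leaves a
  defect exactly where it is attached.\<close>

lemma mark_cartan:
  assumes "admissible k n" "i < n"
  shows "(\<Sum>j<n. real (mark k n j) * cartan k i j) = real (mark_pairing k n i)"
proof -
  consider "k = 0" | "k = 1" "n \<ge> 4" | "k = 2" "n = 6" | "k = 2" "n = 7" | "k = 2" "n = 8"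
    using assms(1) by (auto simp: admissible_def)
  then show ?thesis
  proof cases
    case 1
    have "{j. j < n \<and> edge 0 i j} = (if i = 0 then {} else {i - 1}) \<union> (if Suc i < n then {Suc i} else {})"
      using assms(2) by (auto simp: edge_def)
    then have "card {j. j < n \<and> edge 0 i j} = of_bool (i \<noteq> 0) + of_bool (Suc i < n)"
      by simp
    moreover have "(\<Sum>j | j < n \<and> edge k i j. real (mark k n j)) = real (card {j. j < n \<and> edge 0 i j})"
      using 1 by (simp add: mark_def)
    moreover have "2 * real (mark k n i) = 2" using 1 by (simp add: mark_def)
    moreover have "Suc i < n \<longleftrightarrow> i \<noteq> n - 1" using assms(2) by linarith
    ultimately show ?thesis unfolding sum_cartan[OF assms(2)]
      using 1 by (simp only: mark_pairing_def) (simp add: of_bool_def)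
  next
    case 2
    have m: "mark k n j = (if j \<le> 1 \<or> Suc j = n then 1 else 2)" for j
      using 2 by (simp add: mark_def) linarith
    have p: "mark_pairing k n i = of_bool (i + 2 = n)"
      using 2 by (simp add: mark_pairing_def affine_node_def) linarith
    consider "i \<le> 1" | "i = 2" | "i > 2" "Suc i < n" | "i > 2" "Suc i = n" using assms(2) by linarith
    then show ?thesis
    proof cases
      case 1
      then have "{j. j < n \<and> edge k i j} = {2}" using 2 by (auto simp: edge_def)
      then show ?thesis using 2(2) 1 unfolding sum_cartan[OF assms(2)] by (simp add: m p)
    next
      case 2
      then have "{j. j < n \<and> edge k i j} = {0, 1, 3}"
        using \<open>k = 1\<close> \<open>n \<ge> 4\<close> by (auto simp: edge_def)
      then show ?thesis using p 2 \<open>n \<ge> 4\<close> unfolding sum_cartan[OF assms(2)]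
        by (simp add: m of_bool_def split: if_splits)
    next
      case 3
      then have "{j. j < n \<and> edge k i j} = {i - 1, Suc i}" using 2 by (auto simp: edge_def)
      moreover have "i - 1 \<noteq> Suc i" "\<not> i - 1 \<le> 1" "Suc (i - 1) \<noteq> n" using 3 by auto
      ultimately show ?thesis using 3 unfolding sum_cartan[OF assms(2)] by (simp add: m p)
    next
      case 4
      then have "{j. j < n \<and> edge k i j} = {i - 1}" using 2 by (auto simp: edge_def)
      moreover have "\<not> i - 1 \<le> 1" "Suc (i - 1) \<noteq> n" using 4 by auto
      ultimately show ?thesis using 4 unfolding sum_cartan[OF assms(2)] by (simp add: m p)
    qed
  qed (use assms(2) in \<open>auto simp: eval_nat_numeral less_Suc_eq lessThan_Suc cartan_def edge_def
      mark_def mark_pairing_def affine_node_def\<close>)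
qed

text \<open>This is \<open>2 (\<theta>, \<theta>) / N\<close>; the value 2 says that the vector of
  marks has the length of a root.\<close>

lemma mark_mark_pairing:
  assumes "admissible k n"
  shows "(\<Sum>i<n. mark k n i * mark_pairing k n i) = 2"
proof -
  consider "k = 0" "n \<ge> 1" | "k = 1" "n \<ge> 4" | "k = 2" "n = 6" | "k = 2" "n = 7" | "k = 2" "n = 8"
    using assms(1) by (auto simp: admissible_def)
  then show ?thesis
  proof cases
    case 1
    have "(\<Sum>i<n. mark k n i * mark_pairing k n i) = (\<Sum>i<n. if i = 0 then 1 else 0) + (\<Sum>i<n. if i = n - 1 then 1 else 0)"
      unfolding sum.distrib[symmetric] using 1 by (intro sum.cong) (auto simp: mark_def mark_pairing_def)
    then show ?thesis using 1 by simp
  next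
    case 2
    have "(\<Sum>i<n. mark k n i * mark_pairing k n i) = (\<Sum>i<n. if i = n - 2 then 2 else 0)"
      using 2 by (intro sum.cong) (auto simp: mark_def mark_pairing_def affine_node_def)
    then show ?thesis using 2 by simp
  qed (simp_all add: eval_nat_numeral lessThan_Suc mark_def mark_pairing_def affine_node_def)
qed

lemma mark_pos:
  assumes "admissible k n" "i < n"
  shows "mark k n i \<ge> 1"
  using assms by (auto simp: admissible_def mark_def eval_nat_numeral less_Suc_eq)

definition hroot :: "nat \<Rightarrow> 'a::euclidean_space list \<Rightarrow> 'a" where
  "hroot k zs = (\<Sum>i<length zs. real (mark k (length zs) i) *\<^sub>R zs ! i)"

lemma dynkin_sum_inner:
  assumes "dynkin N k zs" "i < length zs"
  shows "2 * ((\<Sum>j<length zs. f j *\<^sub>R zs ! j) \<bullet> zs ! i) = N * (\<Sum>j<length zs. f j * cartan k i j)"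
proof -
  have "2 * ((\<Sum>j<length zs. f j *\<^sub>R zs ! j) \<bullet> zs ! i) = (\<Sum>j<length zs. f j * (2 * (zs ! i \<bullet> zs ! j)))"
    by (simp add: inner_sum_left sum_distrib_left inner_commute[of "zs ! i"] mult_ac)
  also have "\<dots> = (\<Sum>j<length zs. N * (f j * cartan k i j))"
    using assms by (intro sum.cong) (auto simp: dynkin_def)
  finally show ?thesis by (simp add: sum_distrib_left)
qed

lemma hroot_inner:
  assumes "dynkin N k zs" "admissible k (length zs)" "i < length zs"
  shows "2 * (hroot k zs \<bullet> zs ! i) = N * mark_pairing k (length zs) i"
  unfolding hroot_def dynkin_sum_inner[OF assms(1,3)] mark_cartan[OF assms(2,3)] ..

lemma hroot_norm:
  assumes "dynkin N k zs" "admissible k (length zs)"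
  shows "hroot k zs \<bullet> hroot k zs = N"
proof -
  let ?n = "length zs"
  have "2 * (hroot k zs \<bullet> hroot k zs) = (\<Sum>i<?n. mark k ?n i * (2 * (hroot k zs \<bullet> zs ! i)))"
    by (subst (2) hroot_def) (simp add: inner_sum_right sum_distrib_left mult_ac)
  also have "\<dots> = (\<Sum>i<?n. N * real (mark k ?n i * mark_pairing k ?n i))"
    by (intro sum.cong) (simp_all add: hroot_inner[OF assms])
  also have "\<dots> = N * real (\<Sum>i<?n. mark k ?n i * mark_pairing k ?n i)"
    by (simp add: sum_distrib_left)
  also have "\<dots> = 2 * N" using mark_mark_pairing[OF assms(2)] by simp
  finally show ?thesis by simp
qed

lemma hroot_in_span: "hroot k zs \<in> span (set zs)"
  unfolding hroot_def by (intro span_sum span_scale span_base) simp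

section \<open>Excluded affine diagrams and the growth of a diagram\<close>

lemma dynkin_no_null:
  assumes D: "dynkin N k zs" and null: "\<And>i. i < length zs \<Longrightarrow> (\<Sum>j<length zs. f j * cartan k i j) = 0"
    and i: "i < length zs" "f i \<noteq> 0"
  shows False
proof -
  let ?w = "\<Sum>j<length zs. f j *\<^sub>R zs ! j"
  have wi: "?w \<bullet> zs ! i = 0" if "i < length zs" for i
    using dynkin_sum_inner[OF D that, of f] null[OF that] by simp
  \<comment> \<open>Being orthogonal to every node, \<open>?w\<close> is orthogonal to itself, so a
    null vector of the Cartan matrix would be a linear dependence.\<close>
  have "?w \<bullet> ?w = (\<Sum>j<length zs. f j * (?w \<bullet> zs ! j))"
    by (simp only: inner_sum_right inner_scaleR_right)
  also have "\<dots> = 0" using wi by (intro sum.neutral) simp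
  finally have "?w \<bullet> ?w = 0" .
  then have w0: "?w = 0" by simp
  have inj: "inj_on ((!) zs) {..<length zs}"
    using D by (auto simp: dynkin_def inj_on_def nth_eq_iff_index_eq)
  define g where "g x = f (inv_into {..<length zs} ((!) zs) x)" for x
  have g: "g (zs ! j) = f j" if "j < length zs" for j
    using that inv_into_f_f[OF inj] by (simp add: g_def)
  have "(\<Sum>x\<in>(!) zs ` {..<length zs}. g x *\<^sub>R x) = ?w"
    using inj by (subst sum.reindex) (auto simp: g)
  moreover have "(!) zs ` {..<length zs} = set zs" by (auto simp: set_conv_nth)
  ultimately have "(\<Sum>x\<in>set zs. g x *\<^sub>R x) = 0" using w0 by simp
  then have "g (zs ! i) = 0"
    using D i(1) by (intro independentD[of "set zs" "set zs" g]) (auto simp: dynkin_def)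
  then show False using g i by simp
qed

lemma not_labelled_E9:
  assumes B: "sl_basis N \<Delta>" and L: "labelled \<Delta> 2 zs" and "length zs \<ge> 9"
  shows False
proof -
  have len: "length (take 9 zs) = 9" using assms(3) by simp
  have "dynkin N 2 (take 9 zs)"
    using labelled_take[OF L, of 9] assms by (intro labelled_dynkin) auto
  \<comment> \<open>The diagram with nine nodes is the affine \<open>E_8\<close>; its null vector
    consists of the marks of \<open>E_8\<close> and a 1 at the affine node.\<close>
  then show False
    by (rule dynkin_no_null[of _ _ _ "(!) [3, 2, 4, 6, 5, 4, 3, 2, 1]" 0])
      (unfold len, auto simp: eval_nat_numeral less_Suc_eq lessThan_Suc cartan_def edge_def)
qed

lemma not_labelled_E7_affine:
  assumes B: "sl_basis N \<Delta>" and L: "labelled \<Delta> k (e # xs)" and "k \<ge> 3" "k + 3 < length xs"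
  shows False
proof -
  \<comment> \<open>Seven consecutive nodes of the path, centred at the branch node: together with
    \<open>e\<close> they form the affine \<open>E_7\<close>.\<close>
  let ?ys = "take 7 (drop (k - 3) xs)"
  have len: "length (e # ?ys) = 8" using assms by simp
  have "labelled \<Delta> 3 (e # ?ys)"
  proof (rule labelled_Cons)
    show "labelled \<Delta> 0 ?ys"
      using assms by (intro labelled_chain_segment labelled_tl[OF L]) auto
    show "e \<in> \<Delta> - set ?ys" using labelled_first[OF L] by (auto dest: in_set_takeD in_set_dropD)
    fix i assume i: "i < length ?ys"
    then have "?ys ! i = xs ! (k - 3 + i)" "k - 3 + i < length xs" using assms by auto
    then show "?ys ! i \<bullet> e \<noteq> 0 \<longleftrightarrow> i = 3"
      using labelled_adj_first[OF L, of "k - 3 + i"] assms by auto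
  qed (use len in simp)
  then have "dynkin N 3 (e # ?ys)" by (rule labelled_dynkin[OF B])
  then show False
    by (rule dynkin_no_null[of _ _ _ "(!) [2, 1, 2, 3, 4, 3, 2, 1]" 0])
      (unfold len, auto simp: eval_nat_numeral less_Suc_eq lessThan_Suc cartan_def edge_def)
qed

text \<open>The strict Cauchy-Schwarz inequality for a new simple root and the highest root of the
  subdiagram found so far.\<close>

lemma attach_unique:
  assumes B: "sl_basis N \<Delta>" and L: "labelled \<Delta> k zs" and adm: "admissible k (length zs)"
    and v: "v \<in> \<Delta> - set zs" and s: "s < length zs" "zs ! s \<bullet> v \<noteq> 0"
  shows "mark k (length zs) s = 1" "i < length zs \<Longrightarrow> zs ! i \<bullet> v \<noteq> 0 \<longleftrightarrow> i = s"
proof -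
  let ?n = "length zs" and ?h = "hroot k zs"
  note D = labelled_dynkin[OF B L]
  have N: "N > 0" and vv: "v \<bullet> v = N" using B v by (auto simp: sl_basis_def)
  have le: "2 * (zs ! i \<bullet> v) = 0 \<or> 2 * (zs ! i \<bullet> v) = - N" if "i < ?n" for i
  proof -
    have "zs ! i \<in> \<Delta>" "zs ! i \<noteq> v" using L v that by (auto simp: labelled_def subset_iff)
    then show ?thesis using B v by (auto simp: sl_basis_def)
  qed
  have "?h \<bullet> - v \<le> N" and "?h \<bullet> - v = N \<Longrightarrow> ?h = - v"
    using inner_bound[of ?h N "- v"] hroot_norm[OF D adm] vv by auto
  moreover have "?h \<noteq> - v"
  proof
    assume "?h = - v"
    then have "- v \<in> span (set zs)" using hroot_in_span[of k zs] by simp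
    then have "v \<in> span (set zs)" using span_neg by fastforce
    moreover have "set zs \<subseteq> \<Delta> - {v}" using L v by (auto simp: labelled_def)
    ultimately have "v \<in> span (\<Delta> - {v})" using span_mono by blast
    then show False using B v by (auto simp: sl_basis_def dependent_def)
  qed
  ultimately have "?h \<bullet> v > - N" by fastforce
  moreover have "?h \<bullet> v = (\<Sum>i<?n. mark k ?n i * (zs ! i \<bullet> v))"
    by (simp add: hroot_def inner_sum_left)
  \<comment> \<open>A node joined to \<open>v\<close> contributes its mark times
    \<open>- N / 2\<close>, so one attachment at a mark of 2, or two attachments, would already
    reach \<open>- N\<close>.\<close>
  ultimately have bound: "(\<Sum>i<?n. mark k ?n i * (zs ! i \<bullet> v)) > - N" by simp
  have nonpos: "mark k ?n i * (zs ! i \<bullet> v) \<le> 0" if "i < ?n" for i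
    using le[OF that] N by (intro mult_nonneg_nonpos) auto
  have sub: "(\<Sum>i<?n. mark k ?n i * (zs ! i \<bullet> v)) \<le> (\<Sum>i\<in>I. mark k ?n i * (zs ! i \<bullet> v))"
    if "I \<subseteq> {..<?n}" for I
  proof -
    have "(\<Sum>i<?n. mark k ?n i * (zs ! i \<bullet> v)) =
       (\<Sum>i\<in>{..<?n} - I. mark k ?n i * (zs ! i \<bullet> v)) + (\<Sum>i\<in>I. mark k ?n i * (zs ! i \<bullet> v))"
      using that by (intro sum.subset_diff) auto
    moreover have "(\<Sum>i\<in>{..<?n} - I. mark k ?n i * (zs ! i \<bullet> v)) \<le> 0"
      by (intro sum_nonpos nonpos) auto
    ultimately show ?thesis by linarith
  qed
  have sv: "zs ! s \<bullet> v = - N / 2" using le[OF s(1)] s(2) by auto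
  have "real (mark k ?n s) * (- N / 2) > - N" using sub[of "{s}"] bound s sv by simp
  then have "real (mark k ?n s) < 2" using N by (simp add: field_simps)
  then show "mark k ?n s = 1" using mark_pos[OF adm s(1)] by simp
  assume i: "i < ?n"
  show "zs ! i \<bullet> v \<noteq> 0 \<longleftrightarrow> i = s"
  proof (rule ccontr)
    assume "\<not> ?thesis"
    then have "i \<noteq> s" "zs ! i \<bullet> v \<noteq> 0" using s by auto
    then have iv: "zs ! i \<bullet> v = - N / 2" using le[OF i] by auto
    have m: "real (mark k ?n j) * (- N / 2) \<le> - N / 2" if "j < ?n" for j
      using mark_pos[OF adm that] N by (simp add: field_simps)
    show False using sub[of "{i, s}"] bound i s sv iv \<open>i \<noteq> s\<close> m[OF i] m[OF s(1)] by simp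
  qed
qed

text \<open>By \<open>attach_unique\<close> the new root hangs on a single node of mark 1. It
  remains to relabel the enlarged diagram with the help of its symmetries, or to find an affine
  subdiagram in it.\<close>

lemma labelled_extend:
  assumes B: "sl_basis N \<Delta>" and L: "labelled \<Delta> k zs" and adm: "admissible k (length zs)"
    and v: "v \<in> \<Delta> - set zs" and s: "s < length zs" "zs ! s \<bullet> v \<noteq> 0"
  shows "\<exists>k' zs'. labelled \<Delta> k' zs' \<and> admissible k' (length zs') \<and> length zs' = Suc (length zs)"
proof -
  have ex: ?thesis if "labelled \<Delta> k' zs'" "admissible k' (length zs')" "length zs' = Suc (length zs)" for k' zs'
    using that by blast
  note att = attach_unique[OF B L adm v s]
  consider (A) "k = 0" "length zs \<ge> 1" | (D) "k = 1" "length zs \<ge> 4" | (E) "k = 2" "length zs \<in> {6, 7, 8}"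
    using adm by (auto simp: admissible_def)
  then show ?thesis
  proof cases
    case A
    \<comment> \<open>Reversing the path puts the attachment into its first half. Positions 0, 1 and
      2 lead to types A, D and E; from 3 on there are three nodes on each side, hence an affine
      \<open>E_7\<close>.\<close>
    have path: ?thesis
      if L: "labelled \<Delta> 0 ys" and len: "length ys = length zs" and v: "v \<in> \<Delta> - set ys"
        and att: "\<And>i. i < length ys \<Longrightarrow> ys ! i \<bullet> v \<noteq> 0 \<longleftrightarrow> i = t" and t: "t < length ys" "2 * t \<le> length ys - 1"
      for ys t
    proof -
      consider "t = 0" | "t = 1" | "t = 2" | "t \<ge> 3" by linarith
      then show ?thesis
      proof cases
        case 1
        have "labelled \<Delta> 0 (rev ys @ [v])"
        proof (rule labelled_snoc[OF labelled_rev[OF L]])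
          fix i assume "i < length (rev ys)"
          then show "(rev ys ! i \<bullet> v \<noteq> 0) = (i = length (rev ys) - 1)"
            using att[of "length ys - Suc i"] 1 by (auto simp: rev_nth)
        qed (use v in auto)
        then show ?thesis by (rule ex) (use len in \<open>auto simp: admissible_def\<close>)
      next
        case 2
        have "labelled \<Delta> 1 (v # ys)" using labelled_Cons[OF L v t(1) att] 2 by simp
        then show ?thesis by (rule ex) (use len t 2 in \<open>auto simp: admissible_def\<close>)
      next
        case 3
        have L2: "labelled \<Delta> 2 (v # ys)" using labelled_Cons[OF L v t(1) att] 3 by simp
        then have "\<not> length (v # ys) \<ge> 9" using not_labelled_E9[OF B] by blast
        then have "length (v # ys) \<in> {6, 7, 8}" using 3 t by auto
        then show ?thesis using ex[OF L2] len by (auto simp: admissible_def)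
      next
        case 4
        have "labelled \<Delta> t (v # ys)" using labelled_Cons[OF L v t(1) att] by simp
        then show ?thesis using not_labelled_E7_affine[OF B] 4 t by fastforce
      qed
    qed
    show ?thesis
    proof (cases "2 * s \<le> length zs - 1")
      case True
      then show ?thesis using path[OF _ refl v att(2) s(1)] L A by simp
    next
      case False
      have "labelled \<Delta> 0 (rev zs)" using labelled_rev L A by simp
      moreover have "rev zs ! i \<bullet> v \<noteq> 0 \<longleftrightarrow> i = length zs - Suc s" if "i < length (rev zs)" for i
        using att(2)[of "length zs - Suc i"] that s by (auto simp: rev_nth)
      ultimately show ?thesis using v s False by (intro path[of "rev zs" "length zs - Suc s"]) auto
    qed
  next
    case D
    \<comment> \<open>Prolonging a short leg of \<open>D_n\<close> gives parameter 2. For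
      \<open>n = 4\<close> all legs are alike and reversal shows \<open>D_5\<close>; larger
      \<open>n\<close> give type E as long as at most eight nodes result.\<close>
    have leg: ?thesis
      if L: "labelled \<Delta> 1 (a # xs)" and len: "length (a # xs) = length zs" and v: "v \<in> \<Delta> - set (a # xs)"
        and att: "\<And>i. i < length (a # xs) \<Longrightarrow> (a # xs) ! i \<bullet> v \<noteq> 0 \<longleftrightarrow> i = 1" for a xs
    proof -
      have n: "length xs \<ge> 3" using len D by simp
      have L2: "labelled \<Delta> 2 (a # v # xs)"
        using labelled_cons_chain[OF L v _ att] n by (simp add: numeral_2_eq_2)
      show ?thesis
      proof (cases "length xs = 3")
        case True
        then have "labelled \<Delta> 1 (a # rev (v # xs))"
          using labelled_rev_chain[OF L2] by simp
        then show ?thesis by (rule ex) (use True len in \<open>auto simp: admissible_def\<close>)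
      next
        case False
        have "\<not> length (a # v # xs) \<ge> 9" using not_labelled_E9[OF B L2] by blast
        then have "length (a # v # xs) \<in> {6, 7, 8}" using False n by auto
        then show ?thesis using ex[OF L2] len by (auto simp: admissible_def)
      qed
    qed
    have "mark 1 (length zs) s = 1" using att(1) D by simp
    moreover have "mark 1 (length zs) s = 2" if "\<not> (s \<le> 1 \<or> s = length zs - 1)"
      using that by (simp only: mark_def) simp
    ultimately have "s \<le> 1 \<or> s = length zs - 1" by (metis numeral_One numeral_eq_iff verit_eq_simplify(10))
    then have "s = 0 \<or> s = 1 \<or> s = length zs - 1" by linarith
    then show ?thesis
    proof (elim disjE)
      assume s0: "s = 0"
      obtain a b xs where zs: "zs = a # b # xs" using D by (cases zs; cases "tl zs") auto
      have Lsw: "labelled \<Delta> 1 (b # a # xs)" using labelled_swap L D zs by simp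
      have "(b # a # xs) ! i \<bullet> v \<noteq> 0 \<longleftrightarrow> i = 1" if i: "i < length (b # a # xs)" for i
      proof -
        consider "i = 0" | "i = 1" | j where "i = Suc (Suc j)" by (metis One_nat_def not0_implies_Suc)
        then show ?thesis
          by cases (use att(2)[of 0] att(2)[of 1] att(2)[of i] i s0 zs in simp_all)
      qed
      then show ?thesis using leg[OF Lsw] v zs by auto
    next
      assume s1: "s = 1"
      obtain a xs where zs: "zs = a # xs" using D by (cases zs) auto
      show ?thesis using leg[of a xs] L D v att(2) zs s1 by simp
    next
      assume "s = length zs - 1"
      then have "labelled \<Delta> 1 (zs @ [v])" using labelled_snoc[OF _ v, of 1] L D att(2) by simp
      then show ?thesis by (rule ex) (use D in \<open>auto simp: admissible_def\<close>)
    qed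
  next
    case E
    have last: ?thesis
      if L: "labelled \<Delta> 2 ys" and len: "length ys = length zs" and v: "v \<in> \<Delta> - set ys"
        and att: "\<And>i. i < length ys \<Longrightarrow> ys ! i \<bullet> v \<noteq> 0 \<longleftrightarrow> i = length ys - 1"
        and n: "length zs \<in> {6, 7}" for ys
    proof -
      have "labelled \<Delta> 2 (ys @ [v])" using labelled_snoc[OF L v _ att] n len by auto
      then show ?thesis by (rule ex) (use n len in \<open>auto simp: admissible_def\<close>)
    qed
    \<comment> \<open>The nodes of mark 1: the ends of the two long legs of \<open>E_6\<close>, the
      last node of \<open>E_7\<close>, and none in \<open>E_8\<close>, where the series
      stops.\<close>
    have "length zs = 6 \<and> (s = 1 \<or> s = 5) \<or> length zs = 7 \<and> s = 6"
      using E att(1) s(1) by (auto simp: mark_def eval_nat_numeral less_Suc_eq)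
    then consider "length zs = 6" "s = 1" | "length zs = 6" "s = 5" | "length zs = 7" "s = 6" by blast
    then show ?thesis
    proof cases
      case 1
      obtain e xs where zs: "zs = e # xs" using 1 by (cases zs) auto
      have Lr: "labelled \<Delta> 2 (e # rev xs)" using labelled_rev_chain[of \<Delta> 2 e xs] L E zs 1 by simp
      have "(e # rev xs) ! i \<bullet> v \<noteq> 0 \<longleftrightarrow> i = length (e # rev xs) - 1" if "i < length (e # rev xs)" for i
      proof (cases i)
        case 0
        then show ?thesis using att(2)[of 0] 1 zs by auto
      next
        case (Suc i')
        then show ?thesis using att(2)[of "Suc (length xs - Suc i')"] that 1 zs by (auto simp: rev_nth)
      qed
      then show ?thesis using last[OF Lr] 1 zs v by simp
    next
      case 2
      then show ?thesis using last[of zs] L E v att(2) by simp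
    next
      case 3
      then show ?thesis using last[of zs] L E v att(2) by simp
    qed
  qed
qed

text \<open>Take a labelled part of \<Delta> with the largest number of nodes. If it were proper,
  connectedness would provide a simple root attached to it, and the part could be enlarged.\<close>

theorem classification:
  assumes B: "sl_basis N \<Delta>" and ne: "\<Delta> \<noteq> {}"
    and conn: "\<And>A B. A \<union> B = \<Delta> \<Longrightarrow> A \<inter> B = {} \<Longrightarrow> (\<And>\<alpha> \<beta>. \<alpha> \<in> A \<Longrightarrow> \<beta> \<in> B \<Longrightarrow> \<alpha> \<bullet> \<beta> = 0) \<Longrightarrow> A = {} \<or> B = {}"
  obtains k zs where "dynkin N k zs" "admissible k (length zs)" "set zs = \<Delta>"
proof -
  let ?P = "\<lambda>n. \<exists>k zs. labelled \<Delta> k zs \<and> admissible k (length zs) \<and> length zs = n"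
  have fin: "finite \<Delta>" using B independent_imp_finite by (auto simp: sl_basis_def)
  obtain a where "a \<in> \<Delta>" using ne by auto
  then have "labelled \<Delta> 0 [a]" by (auto simp: labelled_def)
  then have P1: "?P 1" by (intro exI[of _ 0] exI[of _ "[a]"]) (auto simp: admissible_def)
  have bound: "n \<le> card \<Delta>" if P: "?P n" for n
  proof -
    from P obtain zs where "distinct zs" "set zs \<subseteq> \<Delta>" "length zs = n" by (auto simp: labelled_def)
    then show ?thesis using fin distinct_card[of zs] card_mono[of \<Delta> "set zs"] by simp
  qed
  obtain n where n: "?P n" "\<And>m. ?P m \<Longrightarrow> m \<le> n"
    using GreatestI_nat[of ?P 1 "card \<Delta>"] Greatest_le_nat[of ?P _ "card \<Delta>"] P1 bound by blast
  obtain k zs where L: "labelled \<Delta> k zs" and adm: "admissible k (length zs)" and len: "length zs = n"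
    using n(1) by blast
  have "set zs = \<Delta>"
  proof (rule ccontr)
    assume "set zs \<noteq> \<Delta>"
    then have ne: "\<Delta> - set zs \<noteq> {}" "set zs \<noteq> {}" "set zs \<subseteq> \<Delta>"
      using L by (auto simp: labelled_def)
    then obtain u v where uv: "u \<in> set zs" "v \<in> \<Delta> - set zs" "u \<bullet> v \<noteq> 0"
      using conn[of "set zs" "\<Delta> - set zs"] by blast
    then obtain s where "s < length zs" "u = zs ! s" by (auto simp: in_set_conv_nth)
    then show False using labelled_extend[OF B L adm uv(2)] uv(3) n(2)[of "Suc n"] len by auto
  qed
  then show ?thesis using that labelled_dynkin[OF B L] adm by blast
qed

subsection \<open>Coxeter number and exponents of a labelled root system\<close>

lemma span_simple_system:
  assumes "simple_system \<Phi> \<Delta>"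
  shows "span \<Phi> = span \<Delta>"
proof
  have "\<beta> \<in> span \<Delta>" if "\<beta> \<in> \<Phi>" for \<beta>
    using assms that unfolding simple_system_def
    by (metis (no_types, lifting) span_base span_scale span_sum)
  then show "span \<Phi> \<subseteq> span \<Delta>" by (simp add: span_minimal subsetI)
  show "span \<Delta> \<subseteq> span \<Phi>" using assms by (simp add: simple_system_def span_mono)
qed

lemma root_rank_eq_card: "simple_system \<Phi> \<Delta> \<Longrightarrow> root_rank \<Phi> = card \<Delta>"
  using dim_eq_card_independent[of \<Delta>] by (simp add: root_rank_def span_simple_system simple_system_def)

lemma dynkin_image:
  assumes D: "dynkin N k zs" and w: "orthogonal_transformation w" and ind: "independent (w ` set zs)"
  shows "dynkin N k (map w zs)"
proof -
  have "inj w" using w by (rule orthogonal_transformation_inj)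
  then show ?thesis
    using D ind w unfolding dynkin_def
    by (auto simp: distinct_map orthogonal_transformation_def intro: inj_on_subset)
qed

context sl_system
begin

lemma refl_prod_root:
  assumes "set \<alpha>s \<subseteq> \<Phi>"
  shows "\<beta> \<in> \<Phi> \<Longrightarrow> refl_prod \<alpha>s \<beta> \<in> \<Phi>"
  using assms by (induction \<alpha>s) (auto intro: refl)

lemma refl_prod_inj:
  assumes "set \<alpha>s \<subseteq> \<Phi>"
  shows "inj (refl_prod \<alpha>s)"
  using assms
proof (induction \<alpha>s)
  case (Cons \<alpha> \<alpha>s)
  have "inj (root_reflection \<alpha>)"
    using Cons by (intro orthogonal_transformation_inj orthogonal_reflection) auto
  moreover have "inj (refl_prod \<alpha>s)" using Cons by simp
  ultimately show ?case unfolding refl_prod_simps by (rule inj_compose)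
qed simp

lemma refl_prod_fixes_orthogonal:
  assumes "set \<alpha>s \<subseteq> \<Phi>" "\<And>\<alpha>. \<alpha> \<in> \<Phi> \<Longrightarrow> x \<bullet> \<alpha> = 0"
  shows "refl_prod \<alpha>s x = x"
  using assms by (induction \<alpha>s) (auto simp: root_reflection_def)

text \<open>The powers permute the finite set \<Phi>, so two of them agree there and some positive
  power is the identity on \<Phi>, hence on its span; the orthogonal complement of the span is fixed
  anyway.\<close>

lemma refl_prod_finite_order:
  assumes sub: "set \<alpha>s \<subseteq> \<Phi>"
  shows "\<exists>m>0. refl_prod \<alpha>s ^^ m = id"
proof -
  let ?c = "refl_prod \<alpha>s"
  have mem: "(?c ^^ j) \<beta> \<in> \<Phi>" if "\<beta> \<in> \<Phi>" for j \<beta>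
    by (induction j) (use that refl_prod_root[OF sub] in auto)
  let ?f = "\<lambda>j. restrict (?c ^^ j) \<Phi>"
  have "range ?f \<subseteq> \<Phi> \<rightarrow>\<^sub>E \<Phi>" using mem by auto
  then have "finite (range ?f)" using fin by (meson finite_PiE finite_subset)
  then have "\<not> inj ?f" using finite_imageD infinite_UNIV_nat by blast
  then obtain i j where ij: "i < j" "?f i = ?f j" by (meson linorder_injI)
  define m where "m = j - i"
  have m: "m > 0" "j = i + m" using ij by (auto simp: m_def)
  have inj_pow: "inj (?c ^^ i)" using refl_prod_inj[OF sub] by (rule inj_fn)
  have fix_root: "(?c ^^ m) \<beta> = \<beta>" if "\<beta> \<in> \<Phi>" for \<beta>
  proof -
    have "(?c ^^ i) \<beta> = (?c ^^ (i + m)) \<beta>"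
      using fun_cong[OF ij(2), of \<beta>] that m by simp
    then have "(?c ^^ i) \<beta> = (?c ^^ i) ((?c ^^ m) \<beta>)" by (simp add: funpow_add)
    then show ?thesis using inj_pow by (simp add: inj_eq)
  qed
  have lin: "linear (?c ^^ m)"
  proof (induction m)
    case (Suc m)
    then show ?case unfolding funpow.simps by (rule linear_compose[OF _ linear_refl_prod])
  next
    case 0
    show ?case using linear_id by (simp add: id_def)
  qed
  have fix_span: "(?c ^^ m) x = x" if "x \<in> span \<Phi>" for x
    using linear_eq_on_span[OF lin linear_id, of \<Phi> x] fix_root that by simp
  have "(?c ^^ m) x = x" for x
  proof -
    obtain y z where yz: "y \<in> span \<Phi>" "\<And>w. w \<in> span \<Phi> \<Longrightarrow> orthogonal z w" "x = y + z"
      using orthogonal_subspace_decomp_exists[of \<Phi> x] by metis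
    have "z \<bullet> \<alpha> = 0" if "\<alpha> \<in> \<Phi>" for \<alpha> using yz(2) that span_base by (auto simp: orthogonal_def)
    then have "?c z = z" by (rule refl_prod_fixes_orthogonal[OF sub])
    then have "(?c ^^ m) z = z" by (induction m) auto
    then show ?thesis using fix_span[OF yz(1)] yz(3) by (simp add: linear_add[OF lin])
  qed
  then have "?c ^^ m = id" by auto
  then show ?thesis using m by blast
qed

end

text \<open>The chosen Coxeter element may come from a simple system other than
  \<open>set zs\<close>. Conjugacy transports the labelling to it by an orthogonal map, and the
  characteristic polynomial accepts any order of the reflections.\<close>

theorem coxeter_number_and_exponents:
  fixes \<Phi> :: "(real ^ 'n) set"
  assumes sl: "sl_system \<Phi> N" and S: "simple_system \<Phi> (set zs)" and D: "dynkin N k zs"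
    and data: "coxeter_data k (length zs) h ms"
  shows "coxeter_number \<Phi> = h" and "span \<Phi> = UNIV \<Longrightarrow> exponents \<Phi> = ms"
proof -
  interpret sl_system \<Phi> N by fact
  have dist: "distinct zs" using D by (simp add: dynkin_def)
  have "\<exists>c. is_coxeter_element \<Phi> c"
    using S dist unfolding is_coxeter_element_def by blast
  then have "is_coxeter_element \<Phi> (coxeter_element \<Phi>)"
    unfolding coxeter_element_def by (rule someI_ex)
  then obtain \<alpha>s where \<alpha>s: "distinct \<alpha>s" "simple_system \<Phi> (set \<alpha>s)" and c: "coxeter_element \<Phi> = refl_prod \<alpha>s"
    by (auto simp: is_coxeter_element_def refl_prod_def)
  obtain w where w: "orthogonal_transformation w" "w ` set zs = set \<alpha>s"
    using simple_systems_conjugate[OF S \<alpha>s(2)] by blast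
  have Dw: "dynkin N k (map w zs)"
    using D w simple_independent[OF \<alpha>s(2)] by (intro dynkin_image) auto
  have prod: "tree_det z k (length zs) = (\<Prod>m\<leftarrow>ms. z - unity_root h m)"
    and ms: "sorted ms" "length ms = length zs" "1 \<in> set ms" "\<forall>m\<in>set ms. m < h" for z
    using data by (auto simp: coxeter_data_def)
  have h: "h > 0" using ms by auto
  have det: "det (mat z - cmat (matrix (coxeter_element \<Phi>))) =
      (z - 1) ^ (CARD('n) - length zs) * (\<Prod>m\<leftarrow>ms. z - unity_root h m)" for z
    using dynkin_charpoly[OF Dw \<alpha>s(1), of z] w(2) c prod by simp
  obtain m where m: "m > 0" "coxeter_element \<Phi> ^^ m = id"
    using refl_prod_finite_order[OF simple_roots[OF \<alpha>s(2)]] c by auto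
  show num: "coxeter_number \<Phi> = h"
    unfolding coxeter_number_def
  proof (rule funpow_order_eq[OF _ m h])
    show "linear (coxeter_element \<Phi>)" unfolding c by (rule linear_refl_prod)
    show "z ^ h = 1" if "det (mat z - cmat (matrix (coxeter_element \<Phi>))) = 0" for z
    proof -
      have "z = 1 \<or> (\<exists>m\<in>set ms. z = unity_root h m)"
        using that unfolding det by (auto simp: prod_list_zero_iff)
      then show ?thesis using h by (auto simp: unity_root_power_eq_1_iff)
    qed
    show "det (mat (unity_root h 1) - cmat (matrix (coxeter_element \<Phi>))) = 0"
      unfolding det using ms(3) by (auto simp: prod_list_zero_iff)
  qed
  assume UN: "span \<Phi> = UNIV"
  \<comment> \<open>Spanning makes the power of \<open>z - 1\<close> trivial, so the two products
    can be compared for every \<open>z\<close>, including 1.\<close>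
  have rank: "root_rank \<Phi> = length zs" "CARD('n) = length zs"
    using root_rank_eq_card[OF S] dist UN by (simp_all add: distinct_card root_rank_def)
  show "exponents \<Phi> = ms"
    unfolding exponents_def num rank(1) unfolding unity_root_def[symmetric]
  proof (rule the_equality)
    show "sorted ms \<and> length ms = length zs \<and> (\<forall>m\<in>set ms. m < h) \<and>
      (\<forall>z. det (mat z - cmat (matrix (coxeter_element \<Phi>))) =
         (z - 1) ^ (CARD('n) - length zs) * (\<Prod>m\<leftarrow>ms. z - unity_root h m))"
      using ms det by blast
    fix ms'
    assume "sorted ms' \<and> length ms' = length zs \<and> (\<forall>m\<in>set ms'. m < h) \<and>
      (\<forall>z. det (mat z - cmat (matrix (coxeter_element \<Phi>))) =
         (z - 1) ^ (CARD('n) - length zs) * (\<Prod>m\<leftarrow>ms'. z - unity_root h m))"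
    then show "ms' = ms" using det ms rank(2) by (intro exponent_list_unique[of _ _ h]) auto
  qed
qed

subsection \<open>The highest root and its orthogonal complement\<close>

lemma sl_system_of_root_system:
  assumes "root_system \<Phi>" "simply_laced \<Phi>" "\<Phi> \<noteq> {}"
  obtains N where "sl_system \<Phi> N"
proof -
  obtain \<alpha>0 where a0: "\<alpha>0 \<in> \<Phi>" using assms(3) by auto
  let ?N = "\<alpha>0 \<bullet> \<alpha>0"
  have norm: "\<alpha> \<bullet> \<alpha> = ?N" if "\<alpha> \<in> \<Phi>" for \<alpha>
    using assms(2) a0 that by (metis dot_square_norm simply_laced_def)
  have N: "?N > 0" using a0 assms(1) by (auto simp: root_system_def)
  have "sl_system \<Phi> ?N"
  proof
    fix \<alpha> \<beta> assume r: "\<alpha> \<in> \<Phi>" "\<beta> \<in> \<Phi>"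
    then have "2 * (\<alpha> \<bullet> \<beta>) / (\<beta> \<bullet> \<beta>) \<in> \<int>" using assms(1) by (auto simp: root_system_def)
    then obtain j :: int where "2 * (\<alpha> \<bullet> \<beta>) / ?N = of_int j" using norm r by (auto elim: Ints_cases)
    then show "\<exists>j::int. 2 * (\<alpha> \<bullet> \<beta>) = of_int j * ?N" using N by (auto simp: field_simps)
    show "root_reflection \<alpha> \<beta> \<in> \<Phi>" using assms(1) r by (auto simp: root_system_def)
  qed (use assms(1) N norm in \<open>auto simp: root_system_def\<close>)
  then show ?thesis by (rule that)
qed

context sl_system
begin

lemma sl_basis_simple: "simple_system \<Phi> \<Delta> \<Longrightarrow> sl_basis N \<Delta>"
  using simple_roots[of \<Delta>] simple_inner[of \<Delta>] simple_independent[of \<Delta>] norm N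
  by (auto simp: sl_basis_def)

lemma hroot_icomb:
  assumes "distinct zs"
  obtains l where "hroot k zs = icomb (set zs) l" "\<forall>\<alpha>\<in>set zs. l \<alpha> \<ge> 0"
proof -
  have inj: "inj_on ((!) zs) {..<length zs}"
    using assms by (auto simp: inj_on_def nth_eq_iff_index_eq)
  define l where "l x = int (mark k (length zs) (inv_into {..<length zs} ((!) zs) x))" for x
  have "icomb ((!) zs ` {..<length zs}) l = hroot k zs"
    unfolding icomb_def hroot_def using inj by (subst sum.reindex) (auto simp: l_def inv_into_f_f)
  moreover have "(!) zs ` {..<length zs} = set zs" by (auto simp: set_conv_nth)
  ultimately show ?thesis using that[of l] by (simp add: l_def)
qed

text \<open>Let \<open>t\<close> be the dominant vector; it is a root by its length. Since
  \<open>\<theta> - t\<close> is a sum of positive roots, its inner product with \<open>t\<close> is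
  nonnegative, so \<open>\<theta> \<bullet> t \<ge> N\<close>, the equality case of
  Cauchy-Schwarz.\<close>

lemma highest_root_unique:
  assumes S: "simple_system \<Phi> \<Delta>"
    and P: "P = {\<beta>\<in>\<Phi>. \<exists>k::'a \<Rightarrow> nat. \<beta> = (\<Sum>\<alpha>\<in>\<Delta>. of_nat (k \<alpha>) *\<^sub>R \<alpha>)}"
    and \<theta>: "highest_root \<Phi> P \<theta>"
    and l: "icomb \<Delta> l \<bullet> icomb \<Delta> l = N" "\<And>\<alpha>. \<alpha> \<in> \<Delta> \<Longrightarrow> icomb \<Delta> l \<bullet> \<alpha> \<ge> 0"
  shows "\<theta> = icomb \<Delta> l"
proof -
  let ?t = "icomb \<Delta> l"
  have t: "?t \<in> \<Phi>" using icomb_root[OF S l(1)] .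
  then have "root_le P ?t \<theta>" and th: "\<theta> \<in> \<Phi>" using \<theta> by (auto simp: highest_root_def)
  then obtain n :: "'a \<Rightarrow> nat" where n: "\<theta> - ?t = (\<Sum>\<gamma>\<in>P. of_nat (n \<gamma>) *\<^sub>R \<gamma>)"
    by (auto simp: root_le_def)
  have "?t \<bullet> \<gamma> \<ge> 0" if \<gamma>: "\<gamma> \<in> P" for \<gamma>
  proof -
    from \<gamma> P obtain k :: "'a \<Rightarrow> nat" where "\<gamma> = (\<Sum>\<alpha>\<in>\<Delta>. of_nat (k \<alpha>) *\<^sub>R \<alpha>)" by auto
    then have "?t \<bullet> \<gamma> = (\<Sum>\<alpha>\<in>\<Delta>. of_nat (k \<alpha>) * (?t \<bullet> \<alpha>))" by (simp add: inner_sum_right)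
    also have "\<dots> \<ge> 0" using l(2) by (intro sum_nonneg) auto
    finally show ?thesis .
  qed
  then have "?t \<bullet> (\<theta> - ?t) \<ge> 0" unfolding n by (simp add: inner_sum_right sum_nonneg)
  then have "\<theta> \<bullet> ?t \<ge> N" using l(1) by (simp add: inner_diff_right inner_commute)
  then show ?thesis using inner_bound[of \<theta> N ?t] norm[OF th] l(1) by simp
qed

lemma component_sl_system:
  assumes C: "irreducible_component {\<alpha>\<in>\<Phi>. \<alpha> \<bullet> \<theta> = 0} \<Omega>"
  shows "sl_system \<Omega> N"
proof
  have sub: "\<Omega> \<subseteq> {\<alpha>\<in>\<Phi>. \<alpha> \<bullet> \<theta> = 0}" using C by (auto simp: irreducible_component_def)
  then show "finite \<Omega>" using finite_subset[of \<Omega> \<Phi>] fin by auto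
  fix \<alpha> assume a: "\<alpha> \<in> \<Omega>"
  then show "\<alpha> \<bullet> \<alpha> = N" using sub norm by auto
  fix \<beta> assume b: "\<beta> \<in> \<Omega>"
  have r: "\<alpha> \<in> \<Phi>" "\<beta> \<in> \<Phi>" "\<alpha> \<bullet> \<theta> = 0" "\<beta> \<bullet> \<theta> = 0" using a b sub by auto
  show "\<exists>j::int. 2 * (\<alpha> \<bullet> \<beta>) = of_int j * N" using int r by simp
  let ?s = "root_reflection \<alpha> \<beta>"
  have sP: "?s \<in> \<Phi>" "?s \<bullet> \<theta> = 0" using refl r by (auto simp: root_reflection_def inner_diff_left)
  show "?s \<in> \<Omega>"
  proof (rule ccontr)
    assume "?s \<notin> \<Omega>"
    \<comment> \<open>The reflected root is a combination of \<open>\<alpha>\<close> and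
      \<open>\<beta>\<close>; outside \<Omega> it would be orthogonal to both, hence to
      itself.\<close>
    then have "\<alpha> \<bullet> ?s = 0" "\<beta> \<bullet> ?s = 0"
      using C a b sP by (auto simp: irreducible_component_def)
    then have "?s \<bullet> ?s = 0"
      unfolding root_reflection_def by (simp only: inner_diff_left inner_scaleR_left)
    then show False using root_ne_0[OF sP(1)] by simp
  qed
qed (rule N)

text \<open>As the coefficients of a root have one sign and \<theta> is dominant, a root orthogonal
  to \<theta> involves only simple roots orthogonal to \<theta>. For a root in \<Omega>, the part
  supported outside \<Omega> is orthogonal to itself and vanishes.\<close>

lemma component_simple_system:
  assumes S: "simple_system \<Phi> \<Delta>" and dom: "\<And>\<alpha>. \<alpha> \<in> \<Delta> \<Longrightarrow> \<alpha> \<bullet> \<theta> \<ge> 0"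
    and C: "irreducible_component {\<alpha>\<in>\<Phi>. \<alpha> \<bullet> \<theta> = 0} \<Omega>"
  shows "simple_system \<Omega> (\<Delta> \<inter> \<Omega>)"
  unfolding simple_system_def
proof (intro conjI ballI)
  note [simp] = simple_finite[OF S]
  have sub: "\<Omega> \<subseteq> {\<alpha>\<in>\<Phi>. \<alpha> \<bullet> \<theta> = 0}" using C by (auto simp: irreducible_component_def)
  show "independent (\<Delta> \<inter> \<Omega>)" using simple_independent[OF S] by (rule independent_mono) auto
  fix \<beta> assume b: "\<beta> \<in> \<Omega>"
  then have r: "\<beta> \<in> \<Phi>" "\<beta> \<bullet> \<theta> = 0" using sub by auto
  obtain k where k: "\<beta> = icomb \<Delta> k" and sgn: "(\<forall>\<alpha>\<in>\<Delta>. k \<alpha> \<ge> 0) \<or> (\<forall>\<alpha>\<in>\<Delta>. k \<alpha> \<le> 0)"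
    using root_icomb[OF S r(1)] by metis
  have "(\<Sum>\<alpha>\<in>\<Delta>. of_int (k \<alpha>) * (\<alpha> \<bullet> \<theta>)) = 0"
    using r(2) by (simp add: k icomb_def inner_sum_left)
  then have sum0: "(\<Sum>\<alpha>\<in>\<Delta>. of_int \<bar>k \<alpha>\<bar> * (\<alpha> \<bullet> \<theta>)) = 0"
    using sgn
  proof (elim disjE)
    assume "\<forall>\<alpha>\<in>\<Delta>. k \<alpha> \<le> 0"
    then have "(\<Sum>\<alpha>\<in>\<Delta>. of_int \<bar>k \<alpha>\<bar> * (\<alpha> \<bullet> \<theta>)) = - (\<Sum>\<alpha>\<in>\<Delta>. of_int (k \<alpha>) * (\<alpha> \<bullet> \<theta>))"
      by (simp add: sum_negf[symmetric])
    then show ?thesis if "(\<Sum>\<alpha>\<in>\<Delta>. of_int (k \<alpha>) * (\<alpha> \<bullet> \<theta>)) = 0" using that by simp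
  qed simp
  have z1: "k \<alpha> = 0" if "\<alpha> \<in> \<Delta>" "\<alpha> \<bullet> \<theta> \<noteq> 0" for \<alpha>
  proof -
    have "\<forall>\<alpha>\<in>\<Delta>. of_int \<bar>k \<alpha>\<bar> * (\<alpha> \<bullet> \<theta>) = 0"
      using sum0 dom by (subst (asm) sum_nonneg_eq_0_iff) auto
    then show ?thesis using that by auto
  qed
  define D0 where "D0 = {\<alpha>\<in>\<Delta>. \<alpha> \<bullet> \<theta> = 0} - \<Omega>"
  have "\<beta> \<bullet> \<alpha> = 0" if "\<alpha> \<in> D0" for \<alpha>
    using C b that simple_roots[OF S] by (auto simp: irreducible_component_def D0_def)
  then have "\<beta> \<bullet> icomb D0 k = 0" by (simp add: icomb_def inner_sum_right)
  moreover have "icomb (\<Delta> \<inter> \<Omega>) k \<bullet> icomb D0 k = 0"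
    unfolding icomb_def inner_sum_left inner_sum_right using C simple_roots[OF S]
    by (intro sum.neutral ballI) (auto simp: irreducible_component_def D0_def)
  moreover have split: "\<beta> = icomb (\<Delta> \<inter> \<Omega>) k + icomb D0 k"
  proof -
    have "icomb \<Delta> k = icomb ((\<Delta> \<inter> \<Omega>) \<union> D0) k"
      unfolding icomb_def using z1 sub by (intro sum.mono_neutral_right) (auto simp: D0_def)
    also have "\<dots> = icomb (\<Delta> \<inter> \<Omega>) k + icomb D0 k"
      unfolding icomb_def by (intro sum.union_disjoint) (auto simp: D0_def)
    finally show ?thesis using k by simp
  qed
  ultimately have "icomb D0 k \<bullet> icomb D0 k = 0" by (simp add: inner_add_left)
  then have "\<beta> = icomb (\<Delta> \<inter> \<Omega>) k" using split by simp
  then show "\<exists>k. \<beta> = (\<Sum>\<alpha>\<in>\<Delta> \<inter> \<Omega>. of_int (k \<alpha>) *\<^sub>R \<alpha>) \<and>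
      ((\<forall>\<alpha>\<in>\<Delta> \<inter> \<Omega>. 0 \<le> k \<alpha>) \<or> (\<forall>\<alpha>\<in>\<Delta> \<inter> \<Omega>. k \<alpha> \<le> 0))"
    using sgn by (intro exI[of _ k]) (auto simp: icomb_def)
qed simp

end

section \<open>Components of the diagram orthogonal to the highest root\<close>

lemma dynkin_connected:
  assumes D: "dynkin N k zs" and A: "A \<subseteq> set zs" "A \<noteq> {}"
    and orth: "\<And>\<alpha> \<beta>. \<alpha> \<in> A \<Longrightarrow> \<beta> \<in> set zs - A \<Longrightarrow> \<alpha> \<bullet> \<beta> = 0"
  shows "A = set zs"
proof -
  let ?n = "length zs"
  have N: "N > 0" using D by (simp add: dynkin_def)
  \<comment> \<open>Adjacent nodes are not orthogonal, so membership in \<open>A\<close> spreads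
    along every edge, first on the path and then to node 0.\<close>
  have step: "zs ! i \<in> A \<longleftrightarrow> zs ! j \<in> A" if ij: "i < ?n" "j < ?n" "edge k i j" for i j
  proof -
    have "2 * (zs ! i \<bullet> zs ! j) = N * cartan k i j" using D ij by (simp add: dynkin_def)
    moreover have "cartan k i j \<noteq> 0" using ij by (simp add: cartan_def)
    ultimately have "zs ! i \<bullet> zs ! j \<noteq> 0" "zs ! j \<bullet> zs ! i \<noteq> 0" using N by (auto simp: inner_commute)
    then show ?thesis using orth[of "zs ! i" "zs ! j"] orth[of "zs ! j" "zs ! i"] ij by auto
  qed
  have path: "zs ! Suc i \<in> A \<longleftrightarrow> zs ! 1 \<in> A" if "Suc i < ?n" for i
    using that
  proof (induction i)
    case (Suc i)
    then show ?case using step[of "Suc i" "Suc (Suc i)"] by (auto simp: edge_def)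
  qed simp
  have all: "zs ! i \<in> A \<longleftrightarrow> zs ! 0 \<in> A" if "i < ?n" for i
  proof (cases "?n = 1")
    case False
    then have k: "Suc k < ?n" using D by (auto simp: dynkin_def)
    moreover have "zs \<noteq> []" using k by auto
    ultimately have "zs ! 0 \<in> A \<longleftrightarrow> zs ! Suc k \<in> A" using step[of 0 "Suc k"] by (auto simp: edge_def)
    then show ?thesis using path[OF k] path[of "i - 1"] that by (cases "i = 0") simp_all
  qed (use that in simp)
  obtain a where "a \<in> A" using A(2) by auto
  then obtain i where "i < ?n" "zs ! i \<in> A" using A(1) by (metis in_set_conv_nth subsetD)
  then have "zs ! j \<in> A" if "j < ?n" for j using all that by blast
  then show ?thesis using A(1) by (auto simp: in_set_conv_nth)
qed

lemma dynkin_subdiagram: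
  assumes D: "dynkin N k zs" and js: "distinct js" "set js \<subseteq> {..<length zs}"
    "length js = 1 \<or> Suc k' < length js"
    and cart: "\<And>a b. a < length js \<Longrightarrow> b < length js \<Longrightarrow> cartan k (js ! a) (js ! b) = cartan k' a b"
  shows "dynkin N k' (map ((!) zs) js)"
proof -
  have dist: "distinct zs" and ind: "independent (set zs)" using D by (auto simp: dynkin_def)
  have lt: "js ! a < length zs" if "a < length js" for a using js(2) that nth_mem by blast
  have "inj_on ((!) zs) (set js)"
    using dist js(2) by (auto simp: inj_on_def nth_eq_iff_index_eq subset_iff)
  moreover have "set (map ((!) zs) js) \<subseteq> set zs" using js(2) by auto
  ultimately show ?thesis
    using D js cart lt independent_mono[OF ind] by (auto simp: dynkin_def distinct_map)
qed

lemma orthogonal_split_cases: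
  assumes "\<And>A B. A \<union> B = D \<Longrightarrow> A \<inter> B = {} \<Longrightarrow> (\<And>\<alpha> \<beta>. \<alpha> \<in> A \<Longrightarrow> \<beta> \<in> B \<Longrightarrow> \<alpha> \<bullet> \<beta> = 0) \<Longrightarrow> A = {} \<or> B = {}"
    and "D \<subseteq> X \<union> Y" "X \<inter> Y = {}" "\<And>\<alpha> \<beta>. \<alpha> \<in> X \<Longrightarrow> \<beta> \<in> Y \<Longrightarrow> (\<alpha>::'a::euclidean_space) \<bullet> \<beta> = 0"
  shows "D \<subseteq> X \<or> D \<subseteq> Y"
proof -
  have "D \<inter> X = {} \<or> D \<inter> Y = {}" by (rule assms(1)) (use assms(2-4) in auto)
  then show ?thesis using assms(2) by auto
qed

text \<open>The diagrams of the components of \<open>\<theta>\<^sup>\<bottom>\<close>: a node isolated in it, or one of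
  \<open>A\<^sub>n \<leadsto> A\<^sub>n\<^sub>-\<^sub>2\<close>, \<open>D\<^sub>n \<leadsto> D\<^sub>n\<^sub>-\<^sub>2\<close>, \<open>E\<^sub>6 \<leadsto> A\<^sub>5\<close>, \<open>E\<^sub>7 \<leadsto> D\<^sub>6\<close>, \<open>E\<^sub>8 \<leadsto> E\<^sub>7\<close>.\<close>

lemma orthogonal_diagram:
  assumes D: "dynkin N k zs" and adm: "admissible k (length zs)" and n3: "length zs \<ge> 3"
    and A: "A \<subseteq> {zs ! i |i. i < length zs \<and> mark_pairing k (length zs) i = 0}" "A \<noteq> {}"
    and closed: "\<And>\<alpha> i. \<alpha> \<in> A \<Longrightarrow> i < length zs \<Longrightarrow> mark_pairing k (length zs) i = 0 \<Longrightarrow> zs ! i \<notin> A \<Longrightarrow> \<alpha> \<bullet> zs ! i = 0"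
    and conn: "\<And>X Y. X \<union> Y = A \<Longrightarrow> X \<inter> Y = {} \<Longrightarrow> (\<And>\<alpha> \<beta>. \<alpha> \<in> X \<Longrightarrow> \<beta> \<in> Y \<Longrightarrow> \<alpha> \<bullet> \<beta> = 0) \<Longrightarrow> X = {} \<or> Y = {}"
  obtains (isolated) ys where "dynkin N 0 ys" "set ys = A" "length ys = 1"
  | (diagram) k' ys where "dynkin N k' ys" "set ys = A"
      "(k, length zs, k', length ys) \<in> {(0, m + 2, 0, m) |m. True} \<union> {(1, m + 2, 1, m) |m. m \<ge> 3}
         \<union> {(2, 6, 0, 5), (2, 7, 1, 6), (2, 8, 2, 7)}"
proof -
  let ?n = "length zs"
  have gram: "2 * (zs ! i \<bullet> zs ! j) = N * cartan k i j" if "i < ?n" "j < ?n" for i j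
    using D that by (simp add: dynkin_def)
  have image: "A \<subseteq> (!) zs ` set js"
    if "\<And>i. i < ?n \<Longrightarrow> mark_pairing k ?n i = 0 \<Longrightarrow> i \<in> set js" for js
    using A(1) that by blast
  have single: thesis if "A = {zs ! i}" "i < ?n" for i
  proof (rule isolated)
    show "dynkin N 0 [zs ! i]"
      using dynkin_subdiagram[OF D, of "[i]" 0] that by (simp add: cartan_def)
  qed (use that in auto)
  have whole: thesis
    if js: "distinct js" "set js \<subseteq> {i. i < ?n \<and> mark_pairing k ?n i = 0}" "length js = 1 \<or> Suc k' < length js"
      and cart: "\<And>a b. a < length js \<Longrightarrow> b < length js \<Longrightarrow> cartan k (js ! a) (js ! b) = cartan k' a b"
      and sub: "A \<subseteq> (!) zs ` set js"
      and type: "(k, ?n, k', length js) \<in> {(0, m + 2, 0, m) |m. True} \<union> {(1, m + 2, 1, m) |m. m \<ge> 3}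
         \<union> {(2, 6, 0, 5), (2, 7, 1, 6), (2, 8, 2, 7)}" for js k'
  proof (rule diagram)
    have Djs: "dynkin N k' (map ((!) zs) js)"
      by (rule dynkin_subdiagram[OF D js(1) _ js(3) cart]) (use js(2) in auto)
    then show "dynkin N k' (map ((!) zs) js)" .
    have "A = set (map ((!) zs) js)"
      by (rule dynkin_connected[OF Djs]) (use A sub closed js(2) in auto)
    then show "set (map ((!) zs) js) = A" by simp
  qed (use type in simp)
  have "?n \<ge> 4 \<longleftrightarrow> ?n = 4 \<or> ?n \<ge> 5" by linarith
  then consider "k = 0" | "k = 1" "?n = 4" | "k = 1" "?n \<ge> 5" | "k = 2" "?n = 6" | "k = 2" "?n = 7" | "k = 2" "?n = 8"
    using adm by (auto simp: admissible_def)
  then show thesis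
  proof cases
    case 1
    show ?thesis
    proof (rule whole[of "[1..<?n - 1]" 0])
      show "A \<subseteq> (!) zs ` set [1..<?n - 1]"
        using A(1) 1 by (auto simp: mark_pairing_def)
      show "(k, ?n, 0, length [1..<?n - 1]) \<in> {(0, m + 2, 0, m) |m. True} \<union> {(1, m + 2, 1, m) |m. m \<ge> 3}
         \<union> {(2, 6, 0, 5), (2, 7, 1, 6), (2, 8, 2, 7)}" using 1 n3 by (auto intro: exI[of _ "?n - 2"])
    qed (use 1 n3 in \<open>auto simp: mark_pairing_def cartan_def edge_def\<close>)
  next
    case 2
    \<comment> \<open>In \<open>D_4\<close> the affine node hangs on the centre, so the three legs
      remain as mutually orthogonal nodes.\<close>
    have sub: "A \<subseteq> {zs ! 0, zs ! 1, zs ! 3}"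
      using A(1) 2 by (auto simp: mark_pairing_def affine_node_def eval_nat_numeral less_Suc_eq)
    have orth: "zs ! 0 \<bullet> zs ! 1 = 0" "zs ! 0 \<bullet> zs ! 3 = 0" "zs ! 1 \<bullet> zs ! 3 = 0"
      using gram[of 0 1] gram[of 0 3] gram[of 1 3] 2 by (auto simp: cartan_def edge_def)
    have "zs ! 0 \<noteq> zs ! 1" "zs ! 0 \<noteq> zs ! 3" "zs ! 1 \<noteq> zs ! 3"
      using D 2 by (auto simp: dynkin_def nth_eq_iff_index_eq)
    note ne = this
    have "A \<subseteq> {zs ! 0} \<or> A \<subseteq> {zs ! 1, zs ! 3}"
      by (rule orthogonal_split_cases[OF conn]) (use sub ne orth in \<open>auto simp: inner_commute\<close>)
    moreover have "A \<subseteq> {zs ! 1} \<or> A \<subseteq> {zs ! 0, zs ! 3}"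
      by (rule orthogonal_split_cases[OF conn]) (use sub ne orth in \<open>auto simp: inner_commute\<close>)
    ultimately have "A \<subseteq> {zs ! 0} \<or> A \<subseteq> {zs ! 1} \<or> A \<subseteq> {zs ! 3}"
      using ne by blast
    then show ?thesis using single[of 0] single[of 1] single[of 3] 2 A(2) by auto
  next
    case 3
    \<comment> \<open>The affine node hangs on the last but one node; removing the latter isolates
      the last node from a diagram of type \<open>D_(n-2)\<close>.\<close>
    let ?X = "(!) zs ` set [0..<?n - 2]" and ?Y = "{zs ! (?n - 1)}"
    have sub: "A \<subseteq> ?X \<union> ?Y"
    proof
      fix x assume "x \<in> A"
      then obtain i where i: "x = zs ! i" "i < ?n" "i \<noteq> ?n - 2"
        using A(1) 3 by (auto simp: mark_pairing_def affine_node_def)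
      then have "i < ?n - 2 \<or> i = ?n - 1" by linarith
      then show "x \<in> ?X \<union> ?Y" using i by auto
    qed
    have "A \<subseteq> ?X \<or> A \<subseteq> ?Y"
    proof (rule orthogonal_split_cases[OF conn sub])
      show "?X \<inter> ?Y = {}" using D 3 by (auto simp: dynkin_def nth_eq_iff_index_eq)
      fix \<alpha> \<beta> assume "\<alpha> \<in> ?X" "\<beta> \<in> ?Y"
      then obtain i where i: "i < ?n - 2" "\<alpha> = zs ! i" "\<beta> = zs ! (?n - 1)" by auto
      have "i \<noteq> ?n - 1" "\<not> edge k i (?n - 1)" using i(1) 3 by (auto simp: edge_def)
      then show "\<alpha> \<bullet> \<beta> = 0" using gram[of i "?n - 1"] i by (simp add: cartan_def)
    qed auto
    then show ?thesis
    proof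
      assume "A \<subseteq> ?Y"
      then have "A = {zs ! (?n - 1)}" using A(2) by blast
      then show ?thesis by (rule single) (use n3 in simp)
    next
      assume X: "A \<subseteq> ?X"
      show ?thesis
      proof (rule whole[OF _ _ _ _ X, of 1])
        show "(k, ?n, 1, length [0..<?n - 2]) \<in> {(0, m + 2, 0, m) |m. True} \<union> {(1, m + 2, 1, m) |m. m \<ge> 3}
           \<union> {(2, 6, 0, 5), (2, 7, 1, 6), (2, 8, 2, 7)}" using 3 by (auto intro: exI[of _ "?n - 2"])
      qed (use 3 in \<open>auto simp: mark_pairing_def affine_node_def\<close>)
    qed
  next
    case 4
    show ?thesis
    proof (rule whole[of "[1..<6]" 0])
      show "A \<subseteq> (!) zs ` set [1..<6]"
        by (rule image) (use 4 in \<open>simp add: mark_pairing_def affine_node_def del: upt_rec_numeral\<close>)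
    qed (use 4 in \<open>auto simp: mark_pairing_def affine_node_def cartan_def edge_def
        simp del: upt_rec_numeral\<close>)
  next
    case 5
    \<comment> \<open>Removing node 1 shortens the leg before the branch node: node 0 now hangs on
      the second node of the path, so the parameter drops from 2 to 1.\<close>
    show ?thesis
    proof (rule whole[of "0 # [2..<7]" 1])
      show "A \<subseteq> (!) zs ` set (0 # [2..<7])"
        by (rule image)
          (use 5 in \<open>simp add: mark_pairing_def affine_node_def del: upt_rec_numeral, linarith\<close>)
      fix a b assume ab: "a < length (0 # [2..<7])" "b < length (0 # [2..<7])"
      have "(0 # [2..<7]) ! i = (if i = 0 then 0 else Suc i)" if "i < 6" for i :: nat
        using that by (cases i) (auto simp del: upt_Suc upt_rec_numeral)
      then show "cartan k ((0 # [2..<7]) ! a) ((0 # [2..<7]) ! b) = cartan 1 a b"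
        using ab 5(1) by (simp del: upt_rec_numeral add: cartan_def edge_def)
    qed (use 5 in \<open>auto simp: mark_pairing_def affine_node_def simp del: upt_rec_numeral\<close>)
  next
    case 6
    show ?thesis
    proof (rule whole[of "[0..<7]" 2])
      show "A \<subseteq> (!) zs ` set [0..<7]"
        by (rule image)
          (use 6 in \<open>simp add: mark_pairing_def affine_node_def del: upt_rec_numeral\<close>)
    qed (use 6 in \<open>auto simp: mark_pairing_def affine_node_def simp del: upt_rec_numeral\<close>)
  qed
qed

section \<open>Comparing Coxeter numbers type by type\<close>

theorem corollary4p35:
  fixes \<Phi> P \<Omega> :: "(real ^ 'n::finite) set" and \<theta> :: "real ^ 'n"
  assumes "CARD('n) \<ge> 3"
    and "root_system \<Phi>"
    and "span \<Phi> = UNIV"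
    and "irreducible_roots \<Phi>"
    and "simply_laced \<Phi>"
    and "positive_system \<Phi> P"
    and "highest_root \<Phi> P \<theta>"
    and "irreducible_component {\<alpha> \<in> \<Phi>. \<alpha> \<bullet> \<theta> = 0} \<Omega>"
  shows "(root_rank \<Omega> = 1 \<longrightarrow> coxeter_number \<Omega> = 2) \<and>
         (root_rank \<Omega> \<ge> 2 \<longrightarrow>
            int (coxeter_number \<Omega>) = int (coxeter_number \<Phi>) - 2 * int (exponent \<Phi> 2) + 2)"
proof -
  have "\<Phi> \<noteq> {}" using assms(4) by (simp add: irreducible_roots_def)
  then obtain N where sl: "sl_system \<Phi> N" using sl_system_of_root_system assms(2,5) by metis
  interpret sl_system \<Phi> N by fact
  obtain \<Delta> where S: "simple_system \<Phi> \<Delta>"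
    and P: "P = {\<beta>\<in>\<Phi>. \<exists>k::real ^ 'n \<Rightarrow> nat. \<beta> = (\<Sum>\<alpha>\<in>\<Delta>. of_nat (k \<alpha>) *\<^sub>R \<alpha>)}"
    using assms(6) by (auto simp: positive_system_def)
  have rank: "card \<Delta> = CARD('n)"
    using root_rank_eq_card[OF S] assms(3) by (simp add: root_rank_def)
  then have ne: "\<Delta> \<noteq> {}" using assms(1) by auto
  obtain k zs where D: "dynkin N k zs" and adm: "admissible k (length zs)" and zs: "set zs = \<Delta>"
    by (rule classification[OF sl_basis_simple[OF S] ne simple_connected[OF S assms(4)]])
  have n: "length zs = CARD('n)" using D rank zs by (metis distinct_card dynkin_def)
  have Sz: "simple_system \<Phi> (set zs)" using S zs by simp
  have dist: "distinct zs" using D by (simp add: dynkin_def)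
  have hr: "2 * (hroot k zs \<bullet> zs ! i) = N * mark_pairing k (length zs) i" if "i < length zs" for i
    using hroot_inner[OF D adm that] .
  \<comment> \<open>The given highest root is identified with the vector of marks, because the
    latter is dominant and as long as a root.\<close>
  have \<theta>: "\<theta> = hroot k zs"
  proof -
    obtain l where l: "hroot k zs = icomb \<Delta> l" using hroot_icomb[OF dist] zs by metis
    have "\<theta> = icomb \<Delta> l"
    proof (rule highest_root_unique[OF S P assms(7)])
      show "icomb \<Delta> l \<bullet> icomb \<Delta> l = N" using hroot_norm[OF D adm] l by simp
      fix \<alpha> assume "\<alpha> \<in> \<Delta>"
      then obtain i where "i < length zs" "\<alpha> = zs ! i" using zs by (auto simp: in_set_conv_nth)
      moreover have "N * mark_pairing k (length zs) i \<ge> 0" using N by simp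
      ultimately show "icomb \<Delta> l \<bullet> \<alpha> \<ge> 0" using hr[of i] l by simp
    qed
    then show ?thesis using l by simp
  qed
  have perp: "\<theta> \<bullet> zs ! i = 0 \<longleftrightarrow> mark_pairing k (length zs) i = 0" if "i < length zs" for i
    using hr[OF that] N \<theta> by auto
  have dom: "\<alpha> \<bullet> \<theta> \<ge> 0" if "\<alpha> \<in> \<Delta>" for \<alpha>
  proof -
    obtain i where "i < length zs" "\<alpha> = zs ! i" using zs \<open>\<alpha> \<in> \<Delta>\<close> by (auto simp: in_set_conv_nth)
    moreover have "N * mark_pairing k (length zs) i \<ge> 0" using N by simp
    ultimately show ?thesis using hr[of i] \<theta> by (simp add: inner_commute)
  qed
  note C = assms(8)
  note sl\<Omega> = component_sl_system[OF C]
  note S\<Omega> = component_simple_system[OF S dom C]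
  have irr\<Omega>: "irreducible_roots \<Omega>" and sub\<Omega>: "\<Omega> \<subseteq> {\<alpha>\<in>\<Phi>. \<alpha> \<bullet> \<theta> = 0}"
    using C by (auto simp: irreducible_component_def)
  have ne\<Omega>: "\<Delta> \<inter> \<Omega> \<noteq> {}"
  proof
    assume "\<Delta> \<inter> \<Omega> = {}"
    then have "\<Omega> \<subseteq> {0}" using S\<Omega> by (auto simp: simple_system_def)
    moreover have "0 \<notin> \<Omega>" using sub\<Omega> root_ne_0 by auto
    ultimately show False using irr\<Omega> by (auto simp: irreducible_roots_def)
  qed
  have cox: "coxeter_number \<Omega> = h" "root_rank \<Omega> = length ys"
    if "dynkin N k' ys" "set ys = \<Delta> \<inter> \<Omega>" "coxeter_data k' (length ys) h ms" for k' ys h ms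
    using distinct_card[of ys] coxeter_number_and_exponents(1)[OF sl\<Omega> _ that(1,3)] S\<Omega> that root_rank_eq_card[OF S\<Omega>]
    by (auto simp: dynkin_def)
  have cox\<Phi>: "coxeter_number \<Phi> = h" "exponent \<Phi> 2 = ms ! 1" if "coxeter_data k (length zs) h ms" for h ms
    using coxeter_number_and_exponents[OF sl Sz D that] assms(3) by (simp_all add: exponent_def)
  show ?thesis
  proof (rule orthogonal_diagram[OF D adm, of "\<Delta> \<inter> \<Omega>"])
    show "length zs \<ge> 3" using n assms(1) by simp
    show "\<Delta> \<inter> \<Omega> \<subseteq> {zs ! i |i. i < length zs \<and> mark_pairing k (length zs) i = 0}"
    proof
      fix x assume x: "x \<in> \<Delta> \<inter> \<Omega>"
      then obtain i where "i < length zs" "x = zs ! i" using zs by (auto simp: in_set_conv_nth)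
      moreover have "\<theta> \<bullet> x = 0" using x sub\<Omega> by (auto simp: inner_commute)
      ultimately show "x \<in> {zs ! i |i. i < length zs \<and> mark_pairing k (length zs) i = 0}"
        using perp by blast
    qed
    show "\<Delta> \<inter> \<Omega> \<noteq> {}" by fact
    show "\<alpha> \<bullet> zs ! i = 0" if "\<alpha> \<in> \<Delta> \<inter> \<Omega>" "i < length zs" "mark_pairing k (length zs) i = 0" "zs ! i \<notin> \<Delta> \<inter> \<Omega>"
      for \<alpha> i
    proof -
      have "zs ! i \<in> \<Delta>" using that zs by auto
      then have "zs ! i \<in> {\<alpha>\<in>\<Phi>. \<alpha> \<bullet> \<theta> = 0} - \<Omega>"
        using that perp simple_roots[OF S] by (auto simp: inner_commute)
      then show ?thesis using C that(1) unfolding irreducible_component_def by blast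
    qed
    show "X = {} \<or> Y = {}"
      if "X \<union> Y = \<Delta> \<inter> \<Omega>" "X \<inter> Y = {}" "\<And>\<alpha> \<beta>. \<alpha> \<in> X \<Longrightarrow> \<beta> \<in> Y \<Longrightarrow> \<alpha> \<bullet> \<beta> = 0" for X Y
      using sl_system.simple_connected[OF sl\<Omega> S\<Omega> irr\<Omega> that] .
  next
    fix ys
    assume "dynkin N 0 ys" "set ys = \<Delta> \<inter> \<Omega>" "length ys = 1"
    \<comment> \<open>An isolated node has type \<open>A_1\<close>: rank 1 and Coxeter number 2, so
      the second clause is vacuous.\<close>
    then show ?thesis using cox[of 0 ys] coxeter_data_A[of 1] by simp
  next
    fix k' ys
    assume ys: "dynkin N k' ys" "set ys = \<Delta> \<inter> \<Omega>"
      and type: "(k, length zs, k', length ys) \<in> {(0, m + 2, 0, m) |m. True} \<union> {(1, m + 2, 1, m) |m. m \<ge> 3}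
         \<union> {(2, 6, 0, 5), (2, 7, 1, 6), (2, 8, 2, 7)}"
    note c = cox[OF ys]
    have nz: "length ys > 0" using ys ne\<Omega> by auto
    consider "k = 0" "length zs = length ys + 2" "k' = 0"
      | "k = 1" "length zs = length ys + 2" "k' = 1" "length ys \<ge> 3"
      | "k = 2" "length zs = 6" "k' = 0" "length ys = 5"
      | "k = 2" "length zs = 7" "k' = 1" "length ys = 6"
      | "k = 2" "length zs = 8" "k' = 2" "length ys = 7"
      using type by auto
    then show ?thesis
    proof cases
      case 1
      \<comment> \<open>For \<open>A_n\<close>: \<open>(n + 1) - 2 * 2 + 2 = n - 1\<close>, the
        Coxeter number of \<open>A_(n-2)\<close>; for \<open>n = 3\<close> this is 2, in accordance
        with rank 1.\<close>
      have "coxeter_data k (length zs) (Suc (length zs)) [1..<Suc (length zs)]"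
        using coxeter_data_A[of "length zs"] 1 by simp
      note cox\<Phi>[OF this]
      moreover have "[1..<Suc (length zs)] ! 1 = 2" using 1 nz by (subst nth_upt) auto
      moreover have "coxeter_number \<Omega> = Suc (length ys)" "root_rank \<Omega> = length ys"
        using c[of "Suc (length ys)"] coxeter_data_A[of "length ys"] 1 nz by auto
      ultimately show ?thesis using 1 by simp
    next
      case 2
      define m where "m = length ys + 1"
      have "coxeter_data k (length zs) (2 * m) (insort m (map (\<lambda>i. 2 * i + 1) [0..<m]))"
        using coxeter_data_D[of "length zs"] 2 by (simp add: m_def)
      note cox\<Phi>[OF this]
      \<comment> \<open>Here \<open>n \<ge> 5\<close>, so the extra exponent
        \<open>m = n - 1\<close> exceeds 3 and the list begins with 1, 3. Then
        \<open>2 (n - 1) - 2 * 3 + 2 = 2 (n - 3)\<close>, as for \<open>D_(n-2)\<close>.\<close>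
      moreover have "insort m (map (\<lambda>i. 2 * i + 1) [0..<m]) ! 1 = 3"
      proof -
        have "[0..<m] = 0 # [1..<m]" "[1..<m] = 1 # [2..<m]"
          using 2 by (subst upt_conv_Cons; simp add: m_def numeral_2_eq_2)+
        moreover have "m > 3" using 2 by (simp add: m_def)
        moreover from this have "\<not> m \<le> 1" "\<not> m \<le> 3" by linarith+
        ultimately show ?thesis by simp
      qed
      moreover have "coxeter_number \<Omega> = 2 * (length ys - 1)" "root_rank \<Omega> = length ys"
        using c[of "2 * (length ys - 1)"] coxeter_data_D[of "length ys"] 2 by auto
      ultimately show ?thesis using 2 nz by (simp add: m_def)
    next
      case 3
      \<comment> \<open>For \<open>E_6\<close> and \<open>A_5\<close>:
        \<open>12 - 2 * 4 + 2 = 6\<close>.\<close>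
      have "coxeter_data k (length zs) 12 [1, 4, 5, 7, 8, 11]" using coxeter_data_E6 3 by simp
      note c1 = cox\<Phi>[OF this]
      have "\<exists>ms. coxeter_data k' (length ys) 6 ms" using coxeter_data_A[of 5] 3 by auto
      then obtain ms where "coxeter_data k' (length ys) 6 ms" by blast
      from c[OF this] c1 show ?thesis using 3 by simp
    next
      case 4
      \<comment> \<open>For \<open>E_7\<close> and \<open>D_6\<close>:
        \<open>18 - 2 * 5 + 2 = 10\<close>.\<close>
      have "coxeter_data k (length zs) 18 [1, 5, 7, 9, 11, 13, 17]" using coxeter_data_E7 4 by simp
      note c1 = cox\<Phi>[OF this]
      have "\<exists>ms. coxeter_data k' (length ys) 10 ms" using coxeter_data_D[of 6] 4 by auto
      then obtain ms where "coxeter_data k' (length ys) 10 ms" by blast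
      from c[OF this] c1 show ?thesis using 4 by simp
    next
      case 5
      \<comment> \<open>For \<open>E_8\<close> and \<open>E_7\<close>:
        \<open>30 - 2 * 7 + 2 = 18\<close>.\<close>
      have "coxeter_data k (length zs) 30 [1, 7, 11, 13, 17, 19, 23, 29]" using coxeter_data_E8 5 by simp
      note c1 = cox\<Phi>[OF this]
      have "\<exists>ms. coxeter_data k' (length ys) 18 ms" using coxeter_data_E7 5 by auto
      then obtain ms where "coxeter_data k' (length ys) 18 ms" by blast
      from c[OF this] c1 show ?thesis using 5 by simp
    qed
  qed
qed

end
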